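(* Let $F$ be a field of characteristic $0$, and let $B$ be a central simple algebra of degree $m\geq 2$ over $F$ which is split by a field extension $K/F$, $K\neq F$, in which $F$ is algebraically closed. Then there is a derivation $\delta$ on $K$ with field of constants $F$ and a differential polynomial $f\in K[t;\delta]$ of degree $m$ such that $$S_f=K[t;\delta]/K[t;\delta]f$$ is an infinite-dimensional algebra over $F$ with right nucleus (isomorphic to) $B$ and left and middle nucleus $K$. Moreover, every automorphism $H\in \mathrm{Aut}_F(S_f)$ extends an inner automorphism of $B$ (i.e. $H$ maps $B=\mathrm{Nuc}_r(S_f)$ onto itself and $H|_B$ is an inner automorphism of $B$).
   Context: For a field $K$ with a derivation $\delta$ (an additive map with $\delta(ab)=a\delta(b)+\delta(a)b$), the field of constants is $\mathrm{Const}(\delta)=\{a\in K\mid \delta(a)=0\}$. The differential polynomial ring $R=K[t;\delta]$ is the set of polynomials $a_0+a_1t+\dots+a_nt^n$ ($a_i\in K$) with termwise addition and multiplication determined by $ta=at+\delta(a)$ for $a\in K$. For $f\in R$ of degree $m$ and $g\in R$ there are unique $q,r\in R$ with $\deg(r)<m$ and $g=qf+r$; write $r=g \bmod_r f$. The Petit algebra $S_f$, also written $K[t;\delta]/K[t;\delta]f$, is the set $R_m=\{g\in R\mid \deg(g)<m\}$ with the usual addition and the multiplication $g\circ h=gh \bmod_r f$; it is a unital, in general nonassociative, algebra over $\mathrm{Const}(\delta)$, and $K$ is regarded as a subset of $S_f$ (polynomials of degree $\le 0$). For an algebra $A$ with associator $[x,y,z]=(xy)z-x(yz)$: $\mathrm{Nuc}_l(A)=\{x\mid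 [x,A,A]=0\}$, $\mathrm{Nuc}_m(A)=\{x\mid [A,x,A]=0\}$, $\mathrm{Nuc}_r(A)=\{x\mid [A,A,x]=0\}$ are the left, middle and right nucleus. The degree of a central simple $F$-algebra $B$ is $\sqrt{\dim_F B}$; $K$ splits $B$ if $B\otimes_F K\cong \mathrm{Mat}_m(K)$. Standing assumptions: $\deg(f)=m\geq 2$ and $\delta\neq 0$. *)

theory Defs
  imports
    Complex_Main
    "HOL-Library.Poly_Mapping"
    "HOL-Computational_Algebra.Polynomial"
    "HOL-Algebra.Ideal"
    "Jordan_Normal_Form.Matrix"
begin

hide_const (open) Polynomial.smult

section \<open>Algebras over a field\<close>

text \<open>
  Base fields are types. A not necessarily associative algebra over a field is given by the
  record \<open>module\<close> of HOL-Algebra (carrier, multiplication, unit, addition, scalar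
  multiplication), used here only as a signature. An associative algebra on a whole type is given
  by the ring structure of the type and a scalar multiplication \<open>s\<close>.
\<close>

definition type_algebra :: "('f \<Rightarrow> 'b::ring_1 \<Rightarrow> 'b) \<Rightarrow> ('f, 'b) module" where
  "type_algebra s = \<lparr>carrier = UNIV, mult = (*), one = 1, zero = 0, add = (+), smult = s\<rparr>"

text \<open>A bijective multiplicative map preserves the unit element, if there is one.\<close>

definition algebra_iso :: "('f, 'a) module \<Rightarrow> ('f, 'b) module \<Rightarrow> ('a \<Rightarrow> 'b) \<Rightarrow> bool" where
  "algebra_iso A B h \<longleftrightarrow>
     bij_betw h (carrier A) (carrier B) \<and>
     (\<forall>x\<in>carrier A. \<forall>y\<in>carrier A. h (x \<oplus>\<^bsub>A\<^esub> y) = h x \<oplus>\<^bsub>B\<^esub> h y) \<and>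
     (\<forall>x\<in>carrier A. \<forall>y\<in>carrier A. h (x \<otimes>\<^bsub>A\<^esub> y) = h x \<otimes>\<^bsub>B\<^esub> h y) \<and>
     (\<forall>c. \<forall>x\<in>carrier A. h (c \<odot>\<^bsub>A\<^esub> x) = c \<odot>\<^bsub>B\<^esub> h x)"

definition associator :: "('a, 'm) ring_scheme \<Rightarrow> 'a \<Rightarrow> 'a \<Rightarrow> 'a \<Rightarrow> 'a" where
  "associator A x y z = ((x \<otimes>\<^bsub>A\<^esub> y) \<otimes>\<^bsub>A\<^esub> z) \<ominus>\<^bsub>A\<^esub> (x \<otimes>\<^bsub>A\<^esub> (y \<otimes>\<^bsub>A\<^esub> z))"

definition nuc_left :: "('a, 'm) ring_scheme \<Rightarrow> 'a set" where
  "nuc_left A = {x \<in> carrier A. \<forall>y\<in>carrier A. \<forall>z\<in>carrier A. associator A x y z = \<zero>\<^bsub>A\<^esub>}"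

definition nuc_middle :: "('a, 'm) ring_scheme \<Rightarrow> 'a set" where
  "nuc_middle A = {x \<in> carrier A. \<forall>y\<in>carrier A. \<forall>z\<in>carrier A. associator A y x z = \<zero>\<^bsub>A\<^esub>}"

definition nuc_right :: "('a, 'm) ring_scheme \<Rightarrow> 'a set" where
  "nuc_right A = {x \<in> carrier A. \<forall>y\<in>carrier A. \<forall>z\<in>carrier A. associator A y z x = \<zero>\<^bsub>A\<^esub>}"

definition finite_dimensional_on :: "('f::field \<Rightarrow> 'v::ab_group_add \<Rightarrow> 'v) \<Rightarrow> 'v set \<Rightarrow> bool" where
  "finite_dimensional_on s V \<longleftrightarrow> (\<exists>X. finite X \<and> X \<subseteq> V \<and> V \<subseteq> Modules.module.span s X)"


section \<open>Field extensions and central simple algebras\<close>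

text \<open>
  An extension \<open>K/F\<close> is a field homomorphism \<open>\<iota>\<close> from \<open>F\<close> to
  \<open>K\<close>; the copy of \<open>F\<close> inside \<open>K\<close> is \<open>range \<iota>\<close>.
\<close>

definition algebraically_closed_in :: "('f::field \<Rightarrow> 'k::field) \<Rightarrow> bool" where
  "algebraically_closed_in \<iota> \<longleftrightarrow>
     (\<forall>x. (\<exists>p. p \<noteq> 0 \<and> poly (map_poly \<iota> p) x = 0) \<longrightarrow> x \<in> range \<iota>)"

definition central_simple_algebra :: "('f::field \<Rightarrow> 'b::ring_1 \<Rightarrow> 'b) \<Rightarrow> bool" where
  "central_simple_algebra s \<longleftrightarrow>
     Vector_Spaces.vector_space s \<and>
     (\<forall>c x y. s c (x * y) = s c x * y \<and> s c (x * y) = x * s c y) \<and>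
     finite_dimensional_on s UNIV \<and>
     {z. \<forall>x. z * x = x * z} = range (\<lambda>c. s c 1) \<and>
     (\<forall>I. ideal I (type_algebra s) \<longrightarrow> I = {0} \<or> I = UNIV)"

definition algebra_degree :: "('f::field \<Rightarrow> 'b::ring_1 \<Rightarrow> 'b) \<Rightarrow> real" where
  "algebra_degree s = sqrt (real (vector_space.dim s (UNIV :: 'b set)))"


section \<open>The tensor product of an algebra with an extension field\<close>

text \<open>
  \<open>B \<otimes> K\<close> over \<open>F\<close> is the free abelian group on \<open>B \<times> K\<close> modulo the subgroup generated by the
  biadditivity and balancing relations; its elements are cosets. The extension field acts on the
  right factor.
\<close>

inductive_set tensor_null ::
  "('f \<Rightarrow> 'b::ring_1 \<Rightarrow> 'b) \<Rightarrow> ('f \<Rightarrow> 'k::field) \<Rightarrow> ('b \<times> 'k \<Rightarrow>\<^sub>0 int) set"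
  for s :: "'f \<Rightarrow> 'b::ring_1 \<Rightarrow> 'b" and \<iota> :: "'f \<Rightarrow> 'k::field" where
  zero: "0 \<in> tensor_null s \<iota>"
| diff: "p \<in> tensor_null s \<iota> \<Longrightarrow> q \<in> tensor_null s \<iota> \<Longrightarrow> p - q \<in> tensor_null s \<iota>"
| add_left: "frag_of (x + y, a) - frag_of (x, a) - frag_of (y, a) \<in> tensor_null s \<iota>"
| add_right: "frag_of (x, a + b) - frag_of (x, a) - frag_of (x, b) \<in> tensor_null s \<iota>"
| balanced: "frag_of (s c x, a) - frag_of (x, \<iota> c * a) \<in> tensor_null s \<iota>"

definition tensor_rel ::
  "('f \<Rightarrow> 'b::ring_1 \<Rightarrow> 'b) \<Rightarrow> ('f \<Rightarrow> 'k::field) \<Rightarrow>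
     (('b \<times> 'k \<Rightarrow>\<^sub>0 int) \<times> ('b \<times> 'k \<Rightarrow>\<^sub>0 int)) set" where
  "tensor_rel s \<iota> = {(p, q). p - q \<in> tensor_null s \<iota>}"

definition free_mult :: "('b::ring_1 \<times> 'k::field \<Rightarrow>\<^sub>0 int) \<Rightarrow> ('b \<times> 'k \<Rightarrow>\<^sub>0 int) \<Rightarrow> ('b \<times> 'k \<Rightarrow>\<^sub>0 int)" where
  "free_mult p q =
     frag_extend (\<lambda>(x, a). frag_extend (\<lambda>(y, b). frag_of (x * y, a * b)) q) p"

definition free_scale :: "'k::field \<Rightarrow> ('b::ring_1 \<times> 'k \<Rightarrow>\<^sub>0 int) \<Rightarrow> ('b \<times> 'k \<Rightarrow>\<^sub>0 int)" where
  "free_scale a p = frag_extend (\<lambda>(x, b). frag_of (x, a * b)) p"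

definition tensor_algebra ::
  "('f \<Rightarrow> 'b::ring_1 \<Rightarrow> 'b) \<Rightarrow> ('f \<Rightarrow> 'k::field) \<Rightarrow> ('k, ('b \<times> 'k \<Rightarrow>\<^sub>0 int) set) module" where
  "tensor_algebra s \<iota> =
     \<lparr>carrier = UNIV // tensor_rel s \<iota>,
      mult = (\<lambda>X Y. \<Union>p\<in>X. \<Union>q\<in>Y. tensor_rel s \<iota> `` {free_mult p q}),
      one = tensor_rel s \<iota> `` {frag_of (1, 1)},
      zero = tensor_rel s \<iota> `` {0},
      add = (\<lambda>X Y. \<Union>p\<in>X. \<Union>q\<in>Y. tensor_rel s \<iota> `` {p + q}),
      smult = (\<lambda>a X. \<Union>p\<in>X. tensor_rel s \<iota> `` {free_scale a p})\<rparr>"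

definition splits :: "('f \<Rightarrow> 'k::field) \<Rightarrow> ('f \<Rightarrow> 'b::ring_1 \<Rightarrow> 'b) \<Rightarrow> nat \<Rightarrow> bool" where
  "splits \<iota> s m \<longleftrightarrow> (\<exists>h. algebra_iso (tensor_algebra s \<iota>) (module_mat TYPE('k) m m) h)"


section \<open>Differential polynomials\<close>

definition derivation :: "('k::field \<Rightarrow> 'k) \<Rightarrow> bool" where
  "derivation \<delta> \<longleftrightarrow>
     (\<forall>a b. \<delta> (a + b) = \<delta> a + \<delta> b) \<and> (\<forall>a b. \<delta> (a * b) = a * \<delta> b + \<delta> a * b)"

definition constants :: "('k::field \<Rightarrow> 'k) \<Rightarrow> 'k set" where
  "constants \<delta> = {a. \<delta> a = 0}"

text \<open>
  An element of \<open>K[t;\<delta>]\<close> is represented by its left coefficients, as a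
  polynomial of type \<open>'k poly\<close>; only the additive structure and the left scalar
  multiplication of that type are used. From \<open>t a = a t + \<delta> a\<close>, left
  multiplication by \<open>t\<close> sends \<open>\<Sum> a\<^sub>i t\<^sup>i\<close> to
  \<open>\<Sum> a\<^sub>i t\<^sup>i\<^sup>+\<^sup>1 + \<Sum> (\<delta> a\<^sub>i) t\<^sup>i\<close>.
\<close>

definition t_mult :: "('k::field \<Rightarrow> 'k) \<Rightarrow> 'k poly \<Rightarrow> 'k poly" where
  "t_mult \<delta> g = pCons 0 g + map_poly \<delta> g"

definition diff_mult :: "('k::field \<Rightarrow> 'k) \<Rightarrow> 'k poly \<Rightarrow> 'k poly \<Rightarrow> 'k poly" where
  "diff_mult \<delta> g h = (\<Sum>i\<le>degree g. Polynomial.smult (coeff g i) ((t_mult \<delta> ^^ i) h))"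

text \<open>
  Remainder of right division by \<open>f\<close>, for \<open>degree f > 0\<close>. The zero polynomial has
  \<open>degree 0 = 0\<close>, which is harmless under this assumption.
\<close>

definition mod_right :: "('k::field \<Rightarrow> 'k) \<Rightarrow> 'k poly \<Rightarrow> 'k poly \<Rightarrow> 'k poly" where
  "mod_right \<delta> g f = (THE r. degree r < degree f \<and> (\<exists>q. g = diff_mult \<delta> q f + r))"

definition petit_algebra ::
  "('f::field \<Rightarrow> 'k::field) \<Rightarrow> ('k \<Rightarrow> 'k) \<Rightarrow> 'k poly \<Rightarrow> ('f, 'k poly) module" where
  "petit_algebra \<iota> \<delta> f =
     \<lparr>carrier = {g. degree g < degree f},
      mult = (\<lambda>g h. mod_right \<delta> (diff_mult \<delta> g h) f),
      one = 1, zero = 0, add = (+),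
      smult = (\<lambda>c. Polynomial.smult (\<iota> c))\<rparr>"

end

theory Submission
  imports Defs "HOL-Library.Function_Algebras"
begin

text \<open>
  Write \<open>F\<close> for the range of \<open>\<iota>\<close>. The proof turns the splitting of \<open>B\<close> into a differential
  module over \<open>K\<close> and reads \<open>S\<^sub>f\<close> off a cyclic vector of this module.

  First, \<open>K\<close> carries a derivation \<open>\<delta>\<close> with field of constants \<open>F\<close>. In characteristic \<open>0\<close> an element
  that is transcendental over a subfield has derivative \<open>1\<close> under some derivation that kills the
  subfield (\<open>exists_derivation_over\<close>), and the differentials of the elements of \<open>K\<close> have a basis
  \<open>{dx | x \<in> T}\<close>. So the derivations over \<open>F\<close> may be prescribed freely on \<open>T\<close>. If \<open>T\<close> is infinite,
  it splits into infinite chains and \<open>\<delta>\<close> moves each element to its successor. If \<open>T\<close> is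
  \<open>{x\<^sub>0, \<dots>, x\<^sub>n}\<close>, then \<open>\<delta> x\<^sub>0 = 1\<close> and \<open>\<delta> x\<^sub>l = 1 / (x\<^sub>0 + l)\<close>: the \<open>x\<^sub>l\<close> are independent
  logarithms over \<open>F(x\<^sub>0)\<close> (\<open>exists_derivation_with_constants\<close>).

  Next, the splitting lets \<open>B\<close> act from the right on the rows \<open>V = K\<^sup>m\<close>, and every \<open>K\<close>-linear
  operator on \<open>V\<close> is a unique \<open>K\<close>-combination of the actions of an \<open>F\<close>-basis of \<open>B\<close>. The map
  \<open>id \<otimes> \<delta>\<close> on the operators descends to a connection \<open>nabla\<close> on \<open>V\<close> that commutes with \<open>B\<close>, and
  the \<open>K\<close>-linear operators that commute with \<open>nabla\<close> are exactly the actions of \<open>B\<close>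
  (\<open>invariant_connection_exists\<close>, \<open>commutant_of_connection\<close>). With \<open>t\<close> acting as \<open>nabla\<close>, \<open>V\<close> is a
  module over \<open>K[t;\<delta>]\<close>. As \<open>\<delta> \<noteq> 0\<close>, this ring is simple, and therefore \<open>V\<close> has a cyclic vector
  \<open>w\<close> (\<open>cyclic_vector\<close>); let \<open>f\<close> be the monic generator of its annihilator, which has degree \<open>m\<close>.

  Finally, \<open>g \<mapsto> g w\<close> identifies \<open>S\<^sub>f\<close> with \<open>V\<close>, and \<open>g \<circ> h\<close> corresponds to \<open>g (h w)\<close>. If \<open>q\<close> is the
  quotient of \<open>x y\<close> by \<open>f\<close>, the associator \<open>[x, y, z]\<close> corresponds to \<open>- q f (z w)\<close>. Hence the
  right nucleus consists of the \<open>z\<close> with \<open>f (z w) = 0\<close>; such \<open>z\<close> correspond to the operators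
  that commute with \<open>nabla\<close>, that is, to \<open>B\<close>. The left and middle nuclei are \<open>K\<close>, because \<open>f\<close> does
  not annihilate \<open>V\<close>, again as \<open>K[t;\<delta>]\<close> is simple. An automorphism of \<open>S\<^sub>f\<close> preserves the right
  nucleus, and \<open>skolem_noether\<close> shows that it acts there as an inner automorphism. The dimension is
  infinite since the powers of an element of \<open>K\<close> outside \<open>F\<close> are linearly independent over \<open>F\<close>.
\<close>

section \<open>Extending derivations in characteristic zero\<close>

definition subfield_set :: "'k::field set \<Rightarrow> bool" where
  "subfield_set E \<longleftrightarrow> 1 \<in> E \<and> (\<forall>a\<in>E. \<forall>b\<in>E. a - b \<in> E \<and> a * b \<in> E) \<and> (\<forall>a\<in>E. inverse a \<in> E)"

definition polys_over :: "'k::field set \<Rightarrow> 'k poly set" where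
  "polys_over E = {p. \<forall>i. coeff p i \<in> E}"

definition algebraic_over :: "'k::field set \<Rightarrow> 'k \<Rightarrow> bool" where
  "algebraic_over E x \<longleftrightarrow> (\<exists>p\<in>polys_over E. p \<noteq> 0 \<and> poly p x = 0)"

text \<open>
  The pair \<open>(a, a')\<close> stands for the dual number \<open>a + a' \<epsilon>\<close> with \<open>\<epsilon>\<^sup>2 = 0\<close>. A map on a subring
  of \<open>K\<close> is a derivation iff its graph is a subring of \<open>K[\<epsilon>]\<close>, and a subring is such a graph iff it meets
  \<open>K \<epsilon>\<close> only in \<open>0\<close>.
\<close>

definition dual_subring :: "('k::field \<times> 'k) set \<Rightarrow> bool" where
  "dual_subring G \<longleftrightarrow> (1, 0) \<in> G \<and>
     (\<forall>a a' b b'. (a, a') \<in> G \<and> (b, b') \<in> G \<longrightarrow> (a - b, a' - b') \<in> G \<and> (a * b, a * b' + a' * b) \<in> G)"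

definition dual_graph :: "('k::field \<times> 'k) set \<Rightarrow> bool" where
  "dual_graph G \<longleftrightarrow> dual_subring G \<and> (\<forall>u. (0, u) \<in> G \<longrightarrow> u = 0)"

lemma dual_subring_rules:
  assumes "dual_subring G"
  shows "(1, 0) \<in> G" "(0, 0) \<in> G"
    "(a, a') \<in> G \<Longrightarrow> (b, b') \<in> G \<Longrightarrow> (a - b, a' - b') \<in> G"
    "(a, a') \<in> G \<Longrightarrow> (b, b') \<in> G \<Longrightarrow> (a + b, a' + b') \<in> G"
    "(a, a') \<in> G \<Longrightarrow> (b, b') \<in> G \<Longrightarrow> (a * b, a * b' + a' * b) \<in> G"
proof -
  show 1: "(1, 0) \<in> G"
    and d: "\<And>a a' b b'. (a, a') \<in> G \<Longrightarrow> (b, b') \<in> G \<Longrightarrow> (a - b, a' - b') \<in> G"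
    and "(a, a') \<in> G \<Longrightarrow> (b, b') \<in> G \<Longrightarrow> (a * b, a * b' + a' * b) \<in> G"
    using assms unfolding dual_subring_def by blast+
  show z: "(0, 0) \<in> G" using d[OF 1 1] by simp
  show "(a, a') \<in> G \<Longrightarrow> (b, b') \<in> G \<Longrightarrow> (a + b, a' + b') \<in> G"
    using d[of a a' "- b" "- b'"] d[OF z, of b b'] by simp
qed

lemma dual_subring_sum:
  assumes "dual_subring G" and "\<And>i. i \<in> I \<Longrightarrow> (f i, g i) \<in> G"
  shows "(sum f I, sum g I) \<in> G"
  using assms(2)
  by (induction I rule: infinite_finite_induct)
     (auto intro: dual_subring_rules[OF assms(1)])

text \<open>
  Polynomials over the ring \<open>G\<close> of dual numbers, split into the parts without and with \<open>\<epsilon>\<close>.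
\<close>

definition dual_polys :: "('k::field \<times> 'k) set \<Rightarrow> ('k poly \<times> 'k poly) set" where
  "dual_polys G = {(p, q). \<forall>i. (coeff p i, coeff q i) \<in> G}"

lemma dual_polys_rules:
  assumes G: "dual_subring G"
  shows "(p, q) \<in> dual_polys G \<Longrightarrow> (p2, q2) \<in> dual_polys G \<Longrightarrow> (p - p2, q - q2) \<in> dual_polys G"
    "(p, q) \<in> dual_polys G \<Longrightarrow> (p2, q2) \<in> dual_polys G \<Longrightarrow> (p * p2, p * q2 + q * p2) \<in> dual_polys G"
    "(a, a') \<in> G \<Longrightarrow> ([:a:], [:a':]) \<in> dual_polys G"
    "(monom 1 n, 0) \<in> dual_polys G"
    "(p, q) \<in> dual_polys G \<Longrightarrow> (pderiv p, pderiv q) \<in> dual_polys G"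
proof -
  note R = dual_subring_rules[OF G]
  show "(p, q) \<in> dual_polys G \<Longrightarrow> (p2, q2) \<in> dual_polys G \<Longrightarrow> (p - p2, q - q2) \<in> dual_polys G"
    by (auto simp: dual_polys_def intro: R)
  show "(p * p2, p * q2 + q * p2) \<in> dual_polys G"
    if "(p, q) \<in> dual_polys G" "(p2, q2) \<in> dual_polys G"
    using that
    by (auto simp: dual_polys_def coeff_mult sum.distrib[symmetric]
        intro!: dual_subring_sum[OF G] R(5))
  show "(a, a') \<in> G \<Longrightarrow> ([:a:], [:a':]) \<in> dual_polys G"
    by (auto simp: dual_polys_def coeff_pCons R split: nat.split)
  show "(monom 1 n, 0) \<in> dual_polys G"
    by (auto simp: dual_polys_def R)
  have nat_mult: "(of_nat n * a, of_nat n * a') \<in> G" if "(a, a') \<in> G" for n a a'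
    using R(4)[OF that] by (induction n) (auto simp: R(2) distrib_right)
  show "(p, q) \<in> dual_polys G \<Longrightarrow> (pderiv p, pderiv q) \<in> dual_polys G"
    by (auto simp: dual_polys_def coeff_pderiv intro: nat_mult simp del: of_nat_Suc)
qed

text \<open>
  The type of \<open>K\<close> is just a field; its characteristic is inherited from \<open>F\<close>.
\<close>

abbreviation char_zero_field :: "'k::field itself \<Rightarrow> bool" where
  "char_zero_field _ \<equiv> (\<forall>n. of_nat (Suc n) \<noteq> (0::'k))"

lemma pderiv_nonzero:
  fixes p :: "'k::field poly"
  assumes "char_zero_field TYPE('k)" and "degree p > 0"
  shows "pderiv p \<noteq> 0" "degree (pderiv p) < degree p"
proof -
  obtain n where n: "degree p = Suc n" using assms(2) by (cases "degree p") auto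
  have "coeff (pderiv p) n = of_nat (Suc n) * lead_coeff p"
    by (simp add: coeff_pderiv n)
  moreover have "lead_coeff p \<noteq> 0" using assms(2) by auto
  ultimately have "coeff (pderiv p) n \<noteq> 0" using assms(1) by (metis mult_eq_0_iff)
  then show "pderiv p \<noteq> 0" by auto
  have "degree (pderiv p) \<le> n"
    by (intro degree_le) (auto simp: coeff_pderiv n coeff_eq_0 simp del: of_nat_Suc)
  then show "degree (pderiv p) < degree p" by (simp add: n)
qed

text \<open>
  A derivation on a subring extends to the subring generated by a further element \<open>y\<close>. The value
  \<open>u\<close> at \<open>y\<close> is arbitrary if \<open>y\<close> is transcendental. Otherwise let \<open>p\<close> have least degree among the
  nonzero polynomials over the subring that vanish at \<open>y\<close>; then \<open>p'(y) \<noteq> 0\<close> in characteristic \<open>0\<close>,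
  and differentiating \<open>p(y) = 0\<close> determines \<open>u\<close>.
\<close>

lemma dual_graph_adjoin:
  fixes G :: "('k::field \<times> 'k) set"
  assumes char: "char_zero_field TYPE('k)" and G: "dual_graph G"
  shows "\<exists>u G'. dual_graph G' \<and> G \<subseteq> G' \<and> (y, u) \<in> G'"
    and "\<not> (\<exists>(p, q)\<in>dual_polys G. p \<noteq> 0 \<and> poly p y = 0) \<Longrightarrow>
           \<exists>G'. dual_graph G' \<and> G \<subseteq> G' \<and> (y, u0) \<in> G'"
proof -
  have Gs: "dual_subring G" and Gf: "\<And>u. (0, u) \<in> G \<Longrightarrow> u = 0"
    using G by (auto simp: dual_graph_def)
  note R = dual_subring_rules[OF Gs] and P = dual_polys_rules[OF Gs]
  have p0: "q = 0" if "(0, q) \<in> dual_polys G" for q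
    using that by (auto simp: dual_polys_def poly_eq_iff intro: Gf)
  define v where "v u = (\<lambda>(p, q). (poly p y, poly q y + poly (pderiv p) y * u))" for u
  have ext: "\<exists>G'. dual_graph G' \<and> G \<subseteq> G' \<and> (y, u) \<in> G'"
    if star: "\<And>p q. (p, q) \<in> dual_polys G \<Longrightarrow> poly p y = 0 \<Longrightarrow>
               poly q y + poly (pderiv p) y * u = 0" for u
  proof (intro exI conjI)
    have in1: "(p2, q2) \<in> v u ` dual_polys G"
      if "(p, q) \<in> dual_polys G" "p2 = poly p y" "q2 = poly q y + poly (pderiv p) y * u"
      for p q p2 q2
      using that by (force simp: v_def)
    show "dual_graph (v u ` dual_polys G)"
      unfolding dual_graph_def dual_subring_def
    proof (intro conjI allI impI)
      show "(1, 0) \<in> v u ` dual_polys G"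
        by (rule in1[OF P(3)[OF R(1)]]) auto
      show "w = 0" if "(0, w) \<in> v u ` dual_polys G" for w
        using that star by (auto simp: v_def)
    next
      fix a a' b b' assume "(a, a') \<in> v u ` dual_polys G \<and> (b, b') \<in> v u ` dual_polys G"
      then obtain p q p2 q2 where p: "(p, q) \<in> dual_polys G" "(a, a') = v u (p, q)"
        and p2: "(p2, q2) \<in> dual_polys G" "(b, b') = v u (p2, q2)" by auto
      show "(a - b, a' - b') \<in> v u ` dual_polys G"
        using p(2) p2(2) by (intro in1[OF P(1)[OF p(1) p2(1)]]) (auto simp: v_def pderiv_diff algebra_simps)
      show "(a * b, a * b' + a' * b) \<in> v u ` dual_polys G"
        using p(2) p2(2) by (intro in1[OF P(2)[OF p(1) p2(1)]]) (auto simp: v_def pderiv_mult algebra_simps)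
    qed
    show "G \<subseteq> v u ` dual_polys G"
    proof
      fix g assume "g \<in> G"
      then show "g \<in> v u ` dual_polys G"
        using in1[OF P(3), of "fst g" "snd g" "fst g" "snd g"] by simp
    qed
    show "(y, u) \<in> v u ` dual_polys G"
      by (rule in1[OF P(4)[of 1]]) (auto simp: poly_monom pderiv_monom)
  qed
  show trans: "\<exists>G'. dual_graph G' \<and> G \<subseteq> G' \<and> (y, u0) \<in> G'"
    if "\<not> (\<exists>(p, q)\<in>dual_polys G. p \<noteq> 0 \<and> poly p y = 0)" for u0
  proof (rule ext)
    fix p q assume "(p, q) \<in> dual_polys G" "poly p y = 0"
    then show "poly q y + poly (pderiv p) y * u0 = 0"
      using that p0 by force
  qed
  show "\<exists>u G'. dual_graph G' \<and> G \<subseteq> G' \<and> (y, u) \<in> G'"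
  proof (cases "\<exists>(p, q)\<in>dual_polys G. p \<noteq> 0 \<and> poly p y = 0")
    case False
    then show ?thesis using trans by blast
  next
    case True
    define A where "A = {(p, q)\<in>dual_polys G. p \<noteq> 0 \<and> poly p y = 0}"
    obtain z0 where "z0 \<in> A" using True by (auto simp: A_def)
    then have "\<exists>z. z \<in> A \<and> (\<forall>z'. z' \<in> A \<longrightarrow> degree (fst z) \<le> degree (fst z'))"
      by (rule ex_has_least_nat)
    then obtain p0' q0 where "(p0', q0) \<in> A"
      and min: "\<And>z'. z' \<in> A \<Longrightarrow> degree p0' \<le> degree (fst z')" by force
    then have pA: "(p0', q0) \<in> dual_polys G" "p0' \<noteq> 0" "poly p0' y = 0" by (auto simp: A_def)
    have deg: "degree p0' > 0"
    proof (rule ccontr)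
      assume "\<not> degree p0' > 0"
      then obtain a where "p0' = [:a:]" using degree_eq_zeroE by blast
      then show False using pA(2,3) by simp
    qed
    have d: "poly (pderiv p0') y \<noteq> 0"
      using min[of "(pderiv p0', pderiv q0)"] pderiv_nonzero[OF char deg] P(5)[OF pA(1)]
      by (force simp: A_def)
    define u where "u = - poly q0 y / poly (pderiv p0') y"
    have u0: "poly q0 y + poly (pderiv p0') y * u = 0" using d by (simp add: u_def)
    have "poly q y + poly (pderiv p) y * u = 0"
      if "(p, q) \<in> dual_polys G" "poly p y = 0" for p q
      using that
    proof (induction "degree p" arbitrary: p q rule: less_induct)
      case less
      show ?case
      proof (cases "p = 0")
        case True
        then show ?thesis using p0[of q] less.prems by simp
      next
        case False
        then have le: "degree p0' \<le> degree p"
          using min[of "(p, q)"] less.prems by (auto simp: A_def)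
        define n where "n = degree p - degree p0'"
        define c c' l l' where "c = lead_coeff p0'" "c' = coeff q0 (degree p0')"
          "l = lead_coeff p" "l' = coeff q (degree p)"
        note cl = this
        have "(c, c') \<in> G" "(l, l') \<in> G" using pA(1) less.prems(1) by (auto simp: dual_polys_def cl)
        note M = P(2)[OF P(3)[OF this(1)] less.prems(1)]
          P(2)[OF P(3)[OF this(2)] P(2)[OF P(4)[of n] pA(1)]]
        note D = P(1)[OF M]
        (* cancels the leading term of p without leaving the polynomials over the subring *)
        define p1 where "p1 = [:c:] * p - [:l:] * (monom 1 n * p0')"
        have "degree p1 < degree p"
        proof (rule degree_lessI)
          show "p1 \<noteq> 0 \<or> 0 < degree p" using deg le by auto
          show "\<forall>k\<ge>degree p. coeff p1 k = 0"
          proof (intro allI impI)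
            fix k assume k: "degree p \<le> k"
            have "coeff p1 k = c * coeff p k - l * coeff p0' (k - n)"
              using k by (simp add: p1_def coeff_monom_mult n_def)
            also have "\<dots> = 0"
            proof (cases "k = degree p")
              case True then show ?thesis using le by (simp add: cl n_def)
            next
              case False
              then have "k > degree p" "k - n > degree p0'" using k le by (auto simp: n_def)
              then show ?thesis by (simp add: coeff_eq_0)
            qed
            finally show "coeff p1 k = 0" .
          qed
        qed
        from less.hyps[OF this D[folded p1_def]]
        have "c * (poly q y + poly (pderiv p) y * u) =
           l * (y ^ n) * (poly q0 y + poly (pderiv p0') y * u)"
          using less.prems(2) pA(3)
          by (simp add: p1_def pderiv_diff pderiv_mult poly_monom algebra_simps pderiv_smult)
        then show ?thesis using u0 pA(2) by (simp add: cl)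
      qed
    qed
    then show ?thesis using ext by blast
  qed
qed

lemma subfield_set_rules:
  assumes "subfield_set E"
  shows "0 \<in> E" "1 \<in> E" "a \<in> E \<Longrightarrow> b \<in> E \<Longrightarrow> a - b \<in> E" "a \<in> E \<Longrightarrow> b \<in> E \<Longrightarrow> a + b \<in> E"
    "a \<in> E \<Longrightarrow> - a \<in> E" "a \<in> E \<Longrightarrow> b \<in> E \<Longrightarrow> a * b \<in> E" "a \<in> E \<Longrightarrow> inverse a \<in> E"
    "a \<in> E \<Longrightarrow> b \<in> E \<Longrightarrow> a / b \<in> E" "of_nat n \<in> E" "a \<in> E \<Longrightarrow> a ^ n \<in> E"
    "(\<And>i. i \<in> I \<Longrightarrow> h i \<in> E) \<Longrightarrow> sum h I \<in> E"
proof -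
  show 1: "1 \<in> E" and d: "\<And>a b. a \<in> E \<Longrightarrow> b \<in> E \<Longrightarrow> a - b \<in> E"
    and m: "\<And>a b. a \<in> E \<Longrightarrow> b \<in> E \<Longrightarrow> a * b \<in> E" and i: "\<And>a. a \<in> E \<Longrightarrow> inverse a \<in> E"
    using assms unfolding subfield_set_def by blast+
  show z: "0 \<in> E" using d[OF 1 1] by simp
  show n: "- a \<in> E" if "a \<in> E" for a using d[OF z that] by simp
  show p: "a + b \<in> E" if "a \<in> E" "b \<in> E" for a b using d[OF that(1) n[OF that(2)]] by simp
  show "a / b \<in> E" if "a \<in> E" "b \<in> E" using m[OF that(1) i[OF that(2)]] by (simp add: divide_inverse)
  show "of_nat n \<in> E" by (induction n) (auto intro: z p 1)
  show "a ^ n \<in> E" if "a \<in> E" by (induction n) (auto intro: 1 m that)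
  show "sum h I \<in> E" if "\<And>i. i \<in> I \<Longrightarrow> h i \<in> E"
    using that by (induction I rule: infinite_finite_induct) (auto intro: z p)
qed

lemma poly_in_subfield:
  assumes "subfield_set E" "p \<in> polys_over E" "x \<in> E"
  shows "poly p x \<in> E"
  using assms(2,3) unfolding poly_altdef polys_over_def
  by (auto intro!: subfield_set_rules[OF assms(1)])

lemma polys_over_rules:
  assumes E: "subfield_set E"
  shows "p \<in> polys_over E \<Longrightarrow> q \<in> polys_over E \<Longrightarrow> p + q \<in> polys_over E"
    "p \<in> polys_over E \<Longrightarrow> q \<in> polys_over E \<Longrightarrow> p - q \<in> polys_over E"
    "p \<in> polys_over E \<Longrightarrow> q \<in> polys_over E \<Longrightarrow> p * q \<in> polys_over E"
    "a \<in> E \<Longrightarrow> p \<in> polys_over E \<Longrightarrow> Polynomial.smult a p \<in> polys_over E"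
    "a \<in> E \<Longrightarrow> p \<in> polys_over E \<Longrightarrow> pCons a p \<in> polys_over E"
    "0 \<in> polys_over E" "1 \<in> polys_over E"
    "p \<in> polys_over E \<Longrightarrow> pderiv p \<in> polys_over E"
proof -
  note R = subfield_set_rules[OF E]
  show "p \<in> polys_over E \<Longrightarrow> pderiv p \<in> polys_over E"
    by (auto simp: polys_over_def coeff_pderiv intro!: R(6) R(9) simp del: of_nat_Suc)
  show "p \<in> polys_over E \<Longrightarrow> q \<in> polys_over E \<Longrightarrow> p * q \<in> polys_over E"
    by (auto simp: polys_over_def coeff_mult intro!: R)
qed (auto simp: polys_over_def coeff_pCons subfield_set_rules[OF E] split: nat.split)

lemma derivation_rules:
  assumes "derivation D"
  shows "D (a + b) = D a + D b" "D (a * b) = a * D b + D a * b" "D 0 = 0" "D 1 = 0"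
    "D (- a) = - D a" "D (a - b) = D a - D b" "D (of_nat n) = 0"
    "D (sum h I) = (\<Sum>i\<in>I. D (h i))"
    "D (a ^ Suc n) = of_nat (Suc n) * a ^ n * D a"
    "b \<noteq> 0 \<Longrightarrow> D (inverse b) = - D b / b\<^sup>2"
    "b \<noteq> 0 \<Longrightarrow> D (a / b) = (D a * b - a * D b) / b\<^sup>2"
proof -
  show add: "D (a + b) = D a + D b" and mult: "D (a * b) = a * D b + D a * b" for a b
    using assms unfolding derivation_def by blast+
  show z: "D 0 = 0" using add[of 0 0] by (simp only: add_0_right add_cancel_right_right)
  show one: "D 1 = 0" using mult[of 1 1] by (simp only: mult_1_left mult_1_right add_cancel_right_right)
  show neg: "D (- a) = - D a" for a using add[of a "- a"] z by (simp add: eq_neg_iff_add_eq_0 add.commute)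
  show "D (a - b) = D a - D b" using add[of a "- b"] neg by simp
  show "D (of_nat n) = 0" by (induction n) (auto simp: add z one)
  show "D (sum h I) = (\<Sum>i\<in>I. D (h i))"
    by (induction I rule: infinite_finite_induct) (auto simp: add z)
  show "D (a ^ Suc n) = of_nat (Suc n) * a ^ n * D a"
  proof (induction n)
    case (Suc n)
    have "D (a ^ Suc (Suc n)) = a * D (a ^ Suc n) + D a * a ^ Suc n" using mult[of a "a ^ Suc n"] by simp
    then show ?case unfolding Suc.IH by (simp add: algebra_simps)
  qed (simp add: one)
  show inv: "D (inverse b) = - D b / b\<^sup>2" if "b \<noteq> 0" for b
  proof -
    have "b * D (inverse b) + D b * inverse b = 0" using mult[of b "inverse b"] that one by simp
    then have "b * D (inverse b) = - D b * inverse b" by (simp add: eq_neg_iff_add_eq_0)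
    then have "D (inverse b) = - D b * inverse b * inverse b" using that by (simp add: field_simps)
    then show ?thesis using that by (simp add: field_simps power2_eq_square)
  qed
  show "D (a / b) = (D a * b - a * D b) / b\<^sup>2" if "b \<noteq> 0"
  proof -
    have "D (a / b) = D (a * inverse b)" by (simp only: divide_inverse)
    also have "\<dots> = a * (- D b / b\<^sup>2) + D a * inverse b" by (simp only: mult inv[OF that])
    also have "\<dots> = (D a * b - a * D b) / b\<^sup>2" using that by (simp add: field_simps power2_eq_square)
    finally show ?thesis .
  qed
qed

lemma coeff_map_derivation [simp]:
  "derivation D \<Longrightarrow> coeff (map_poly D p) i = D (coeff p i)"
  by (simp add: coeff_map_poly derivation_rules)

lemma derivation_poly:
  assumes "derivation D"
  shows "D (poly p x) = poly (map_poly D p) x + poly (pderiv p) x * D x"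
proof (induction p)
  case (pCons a p)
  have "map_poly D (pCons a p) = pCons (D a) (map_poly D p)"
    by (rule poly_eqI) (simp add: assms coeff_pCons split: nat.split)
  then show ?case
    using pCons.IH by (simp add: derivation_rules[OF assms] pderiv_pCons algebra_simps)
qed (simp add: derivation_rules[OF assms])

lemma minimal_polynomial_over:
  fixes E :: "'k::field set"
  assumes E: "subfield_set E" and "algebraic_over E x"
  obtains p where "p \<in> polys_over E" "lead_coeff p = 1" "degree p > 0" "poly p x = 0"
    "\<And>q. q \<in> polys_over E \<Longrightarrow> poly q x = 0 \<Longrightarrow> degree q < degree p \<Longrightarrow> q = 0"
proof -
  define A where "A = {p\<in>polys_over E. p \<noteq> 0 \<and> poly p x = 0}"
  obtain p0 where "p0 \<in> A" using assms(2) by (auto simp: algebraic_over_def A_def)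
  then have "\<exists>p. p \<in> A \<and> (\<forall>q. q \<in> A \<longrightarrow> degree p \<le> degree q)" by (rule ex_has_least_nat)
  then obtain p where p: "p \<in> polys_over E" "p \<noteq> 0" "poly p x = 0"
    and min: "\<And>q. q \<in> A \<Longrightarrow> degree p \<le> degree q" by (auto simp: A_def)
  define r where "r = Polynomial.smult (inverse (lead_coeff p)) p"
  have "degree p > 0"
  proof (rule ccontr)
    assume "\<not> degree p > 0"
    then obtain a where "p = [:a:]" using degree_eq_zeroE by blast
    then show False using p(2,3) by simp
  qed
  show ?thesis
  proof
    show "r \<in> polys_over E"
      using p(1) by (auto simp: r_def polys_over_def intro!: subfield_set_rules[OF E])
    show "lead_coeff r = 1" "poly r x = 0" "degree r > 0" using p \<open>degree p > 0\<close> by (auto simp: r_def)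
    show "q = 0" if "q \<in> polys_over E" "poly q x = 0" "degree q < degree r" for q
      using min[of q] that by (auto simp: A_def r_def split: if_splits)
  qed
qed

lemma derivation_algebraic_eq_0:
  fixes E :: "'k::field set"
  assumes char: "char_zero_field TYPE('k)" and E: "subfield_set E" and D: "derivation D"
    and "\<And>c. c \<in> E \<Longrightarrow> D c = 0" and "algebraic_over E x"
  shows "D x = 0"
proof -
  obtain p where p: "p \<in> polys_over E" "degree p > 0" "poly p x = 0"
    and min: "\<And>q. q \<in> polys_over E \<Longrightarrow> poly q x = 0 \<Longrightarrow> degree q < degree p \<Longrightarrow> q = 0"
    using minimal_polynomial_over[OF E assms(5)] by metis
  have "map_poly D p = 0" using p(1) assms(4) D by (auto simp: poly_eq_iff polys_over_def)
  then have "poly (pderiv p) x * D x = 0"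
    using derivation_poly[OF D, of p x] p(3) by (simp add: derivation_rules[OF D])
  moreover have "poly (pderiv p) x \<noteq> 0"
    using min[of "pderiv p"] pderiv_nonzero[OF char p(2)] polys_over_rules(8)[OF E p(1)] by blast
  ultimately show ?thesis by simp
qed

text \<open>
  Differentiate the minimal polynomial \<open>x\<^sup>k + a x\<^sup>k\<^sup>-\<^sup>1 + \<dots>\<close> of \<open>x\<close>: the result has degree below
  \<open>k\<close> and vanishes at \<open>x\<close>, so its leading coefficient \<open>k D x + D a\<close> is zero. Thus
  \<open>r = - a / k\<close> works.
\<close>

lemma derivative_attained_in_subfield:
  fixes E :: "'k::field set"
  assumes char: "char_zero_field TYPE('k)" and E: "subfield_set E" and D: "derivation D"
    and stable: "\<And>c. c \<in> E \<Longrightarrow> D c \<in> E" and "algebraic_over E x" and "D x \<in> E"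
  shows "\<exists>r\<in>E. D r = D x"
proof -
  obtain p where p: "p \<in> polys_over E" "lead_coeff p = 1" "degree p > 0" "poly p x = 0"
    and min: "\<And>q. q \<in> polys_over E \<Longrightarrow> poly q x = 0 \<Longrightarrow> degree q < degree p \<Longrightarrow> q = 0"
    using minimal_polynomial_over[OF E assms(5)] by metis
  obtain n where n: "degree p = Suc n" using p(3) by (cases "degree p") auto
  define q where "q = map_poly D p + Polynomial.smult (D x) (pderiv p)"
  have q: "q \<in> polys_over E"
    unfolding q_def using p(1) stable
    by (intro polys_over_rules[OF E] assms(6)) (auto simp: polys_over_def D)
  have "poly q x = 0"
    using derivation_poly[OF D, of p x] p(4) by (simp add: q_def derivation_rules[OF D] algebra_simps)
  moreover have "degree q \<le> n"
  proof (intro degree_le allI impI)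
    fix i assume "n < i"
    then consider "i = Suc n" | "i > Suc n" by linarith
    then show "coeff q i = 0"
      by cases (use p(2) n D in \<open>auto simp: q_def coeff_pderiv coeff_eq_0 derivation_rules simp del: of_nat_Suc\<close>)
  qed
  ultimately have "q = 0" using min[OF q] n by simp
  then have "coeff q n = 0" by simp
  then have eq: "D (coeff p n) + D x * of_nat (Suc n) = 0"
    using p(2) n by (simp add: q_def coeff_pderiv D del: of_nat_Suc)
  then have eq: "D (coeff p n) = - (D x * of_nat (Suc n))"
    by (simp only: eq_neg_iff_add_eq_0)
  have N: "of_nat (Suc n) \<noteq> (0::'k)" using char by blast
  define r where "r = - coeff p n / of_nat (Suc n)"
  have "D r = (D x * of_nat (Suc n) * of_nat (Suc n)) / (of_nat (Suc n))\<^sup>2"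
    unfolding r_def derivation_rules(11)[OF D N] derivation_rules(5,7)[OF D] eq by simp
  also have "\<dots> = D x" using N by (simp add: power2_eq_square del: of_nat_Suc)
  finally have "D r = D x" .
  moreover have "r \<in> E"
    unfolding r_def using p(1) by (intro subfield_set_rules[OF E]) (auto simp: polys_over_def)
  ultimately show ?thesis by blast
qed

text \<open>
  Start with \<open>d/dx\<close> on \<open>E[x]\<close> and take a maximal extension, by Zorn's lemma. By
  \<open>dual_graph_adjoin\<close> it is defined on all of the field.
\<close>

lemma exists_derivation_over:
  fixes E :: "'k::field set"
  assumes char: "char_zero_field TYPE('k)" and E: "subfield_set E" and x: "\<not> algebraic_over E x"
  shows "\<exists>D. derivation D \<and> (\<forall>c\<in>E. D c = 0) \<and> D x = 1"
proof -
  note R = subfield_set_rules[OF E]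
  define G0 where "G0 = {(c, 0::'k) | c. c \<in> E}"
  have "dual_graph G0"
    unfolding dual_graph_def dual_subring_def by (auto simp: G0_def R)
  moreover have "\<not> (\<exists>(p, q)\<in>dual_polys G0. p \<noteq> 0 \<and> poly p x = 0)"
    using x by (auto simp: dual_polys_def G0_def algebraic_over_def polys_over_def)
  ultimately obtain G1 where G1: "dual_graph G1" "G0 \<subseteq> G1" "(x, 1) \<in> G1"
    using dual_graph_adjoin(2)[OF char, of G0 x 1] by blast
  define \<A> where "\<A> = {G. dual_graph G \<and> G1 \<subseteq> G}"
  have "\<exists>M\<in>\<A>. \<forall>X\<in>\<A>. M \<subseteq> X \<longrightarrow> X = M"
  proof (rule subset_Zorn_nonempty)
    show "\<A> \<noteq> {}" using G1 by (auto simp: \<A>_def)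
    fix \<C> assume ne: "\<C> \<noteq> {}" and chain: "subset.chain \<A> \<C>"
    have common: "\<exists>C\<in>\<C>. g \<in> C \<and> h \<in> C" if "g \<in> \<Union>\<C>" "h \<in> \<Union>\<C>" for g h
      using that chain unfolding subset.chain_def by blast
    have sub: "dual_graph C" "dual_subring C" "G1 \<subseteq> C" if "C \<in> \<C>" for C
      using that chain unfolding subset.chain_def \<A>_def dual_graph_def by auto
    have "dual_graph (\<Union>\<C>)"
      unfolding dual_graph_def dual_subring_def
    proof (intro conjI allI impI)
      show "(1, 0) \<in> \<Union>\<C>" using ne sub dual_subring_rules(1) by blast
      show "u = 0" if "(0, u) \<in> \<Union>\<C>" for u using that sub(1) unfolding dual_graph_def by blast
      fix a a' b b' assume ab: "(a, a') \<in> \<Union>\<C> \<and> (b, b') \<in> \<Union>\<C>"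
      then obtain C where "C \<in> \<C>" "(a, a') \<in> C" "(b, b') \<in> C" using common by meson
      then show "(a - b, a' - b') \<in> \<Union>\<C>" "(a * b, a * b' + a' * b) \<in> \<Union>\<C>"
        using dual_subring_rules(3,5)[OF sub(2)] by blast+
    qed
    then show "\<Union>\<C> \<in> \<A>" using ne sub(3) by (auto simp: \<A>_def)
  qed
  then obtain M where M: "dual_graph M" "G1 \<subseteq> M"
    and max: "\<And>X. dual_graph X \<Longrightarrow> M \<subseteq> X \<Longrightarrow> X = M" by (auto simp: \<A>_def)
  have Ms: "dual_subring M" and Mf: "\<And>u. (0, u) \<in> M \<Longrightarrow> u = 0" using M(1) by (auto simp: dual_graph_def)
  note RM = dual_subring_rules[OF Ms]
  have total: "\<exists>u. (y, u) \<in> M" for y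
    using dual_graph_adjoin(1)[OF char M(1), of y] max by blast
  define D where "D y = (SOME u. (y, u) \<in> M)" for y
  have DM: "(y, D y) \<in> M" for y unfolding D_def using total by (rule someI_ex)
  have D_eq: "D y = u" if "(y, u) \<in> M" for y u
    using Mf[of "D y - u"] RM(3)[OF DM[of y] that] by simp
  have "derivation D"
    unfolding derivation_def
    using D_eq[OF RM(4)[OF DM DM]] D_eq[OF RM(5)[OF DM DM]] by blast
  moreover have "D c = 0" if "c \<in> E" for c
    using that G1(2) M(2) by (intro D_eq) (auto simp: G0_def)
  moreover have "D x = 1" using G1(3) M(2) by (intro D_eq) auto
  ultimately show ?thesis by blast
qed

section \<open>Coordinates for the derivations over a subfield\<close>

definition derivations_over :: "'k::field set \<Rightarrow> ('k \<Rightarrow> 'k) set" where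
  "derivations_over F = {D. derivation D \<and> (\<forall>c\<in>F. D c = 0)}"

text \<open>
  The differential of \<open>x\<close> is the function \<open>D \<mapsto> D x\<close> on the derivations over \<open>F\<close>. Choose \<open>B\<close>
  such that the differentials of its elements form a basis of the \<open>K\<close>-space spanned by all
  differentials. A linear functional with prescribed values on the basis, composed with the
  differential, is a derivation over \<open>F\<close>. The second property holds since the differential of \<open>h\<close> is a
  finite combination of basis elements.
\<close>

lemma derivation_basis_exists:
  fixes F :: "'k::field set"
  shows "\<exists>B. (\<forall>v. \<exists>D\<in>derivations_over F. \<forall>b\<in>B. D b = v b) \<and>
    (\<forall>h. \<exists>S. finite S \<and> S \<subseteq> B \<and> (\<forall>D\<in>derivations_over F. (\<forall>b\<in>S. D b = 0) \<longrightarrow> D h = 0))"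
proof -
  define sc :: "'k \<Rightarrow> (('k \<Rightarrow> 'k) \<Rightarrow> 'k) \<Rightarrow> (('k \<Rightarrow> 'k) \<Rightarrow> 'k)" where "sc a f = (\<lambda>D. a * f D)" for a f
  interpret vector_space sc
    by standard (auto simp: sc_def fun_eq_iff algebra_simps)
  interpret K: vector_space "(*) :: 'k \<Rightarrow> 'k \<Rightarrow> 'k"
    by standard (auto simp: algebra_simps)
  interpret VP: vector_space_pair sc "(*) :: 'k \<Rightarrow> 'k \<Rightarrow> 'k" ..
  define d :: "'k \<Rightarrow> (('k \<Rightarrow> 'k) \<Rightarrow> 'k)" where
    "d x = (\<lambda>D. if D \<in> derivations_over F then D x else 0)" for x
  obtain B' where B': "B' \<subseteq> range d" "independent B'" "range d \<subseteq> span B'"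
    using maximal_independent_subset[of "range d"] by auto
  define s where "s = inv_into UNIV d"
  have ds: "d (s b) = b" if "b \<in> B'" for b
    unfolding s_def by (rule f_inv_into_f) (use that B'(1) in auto)
  show ?thesis
  proof (rule exI[of _ "s ` B'"], intro conjI allI)
    fix v :: "'k \<Rightarrow> 'k"
    obtain g where g: "Vector_Spaces.linear sc (*) g" "\<And>b. b \<in> B' \<Longrightarrow> g b = v (s b)"
      using VP.linear_independent_extend[OF B'(2), of "\<lambda>b. v (s b)"] by blast
    interpret g: Vector_Spaces.linear sc "(*)" g by (rule g(1))
    have "d (a + b) = d a + d b" "d (a * b) = sc a (d b) + sc b (d a)" for a b
      by (auto simp: d_def sc_def fun_eq_iff derivations_over_def derivation_rules)
    then have "derivation (\<lambda>x. g (d x))"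
      by (auto simp: derivation_def g.add g.scale algebra_simps)
    moreover have "d c = 0" if "c \<in> F" for c
      using that by (auto simp: d_def fun_eq_iff derivations_over_def)
    ultimately have "(\<lambda>x. g (d x)) \<in> derivations_over F" by (auto simp: derivations_over_def)
    then show "\<exists>D\<in>derivations_over F. \<forall>b\<in>s ` B'. D b = v b"
      using g(2) ds by (intro bexI[of _ "\<lambda>x. g (d x)"]) auto
  next
    fix h :: 'k
    have "d h \<in> span B'" using B'(3) by auto
    then obtain t r where t: "finite t" "t \<subseteq> B'" "d h = (\<Sum>a\<in>t. sc (r a) a)"
      unfolding span_explicit by blast
    have "D h = 0" if D: "D \<in> derivations_over F" and z: "\<forall>b\<in>s ` t. D b = 0" for D
    proof -
      have a: "a D = 0" if "a \<in> t" for a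
      proof -
        have "a D = d (s a) D" using ds that t(2) by auto
        then show ?thesis using z that D by (auto simp: d_def)
      qed
      have "(\<Sum>a\<in>t. sc (r a) a) D = (\<Sum>a\<in>t. sc (r a) a D)"
        using t(1) by (induction t rule: finite_induct) auto
      also have "\<dots> = 0" by (rule sum.neutral) (simp add: sc_def a)
      finally have "d h D = 0" by (simp add: t(3))
      then show ?thesis using D by (simp add: d_def)
    qed
    then show "\<exists>S. finite S \<and> S \<subseteq> s ` B' \<and>
        (\<forall>D\<in>derivations_over F. (\<forall>b\<in>S. D b = 0) \<longrightarrow> D h = 0)"
      using t(1,2) by (intro exI[of _ "s ` t"]) auto
  qed
qed

lemma derivation_commutator:
  assumes "derivation D" "derivation E"
  shows "derivation (\<lambda>x. D (E x) - E (D x))"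
  by (auto simp: derivation_def derivation_rules[OF assms(1)] derivation_rules[OF assms(2)] algebra_simps)

lemma subfield_constants:
  assumes "derivation D"
  shows "subfield_set (constants D)"
proof -
  have "D (inverse a) = 0" if "D a = 0" for a
    using that by (cases "a = 0") (simp_all add: derivation_rules[OF assms])
  then show ?thesis
    by (auto simp: subfield_set_def constants_def derivation_rules[OF assms])
qed

lemma subfield_INT: "(\<And>i. i \<in> I \<Longrightarrow> subfield_set (E i)) \<Longrightarrow> subfield_set (\<Inter>i\<in>I. E i)"
  unfolding subfield_set_def by blast

text \<open>
  The field generated by \<open>x\<close> over \<open>E\<close>. A zero denominator contributes only \<open>0\<close>.
\<close>

definition simple_extension :: "'k::field set \<Rightarrow> 'k \<Rightarrow> 'k set" where
  "simple_extension E x = {poly p x / poly q x | p q. p \<in> polys_over E \<and> q \<in> polys_over E}"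

lemma simple_extension_rules:
  assumes E: "subfield_set E"
  shows "subfield_set (simple_extension E x)" "E \<subseteq> simple_extension E x" "x \<in> simple_extension E x"
proof -
  note R = subfield_set_rules[OF E] and P = polys_over_rules[OF E]
  have in1: "y \<in> simple_extension E x"
    if "p \<in> polys_over E" "q \<in> polys_over E" "y = poly p x / poly q x" for p q y
    using that by (auto simp: simple_extension_def)
  show "E \<subseteq> simple_extension E x"
    by (auto intro!: in1[of "[:_:]" 1] P)
  show "x \<in> simple_extension E x"
    by (rule in1[of "[:0, 1:]" 1]) (auto intro!: P R)
  show "subfield_set (simple_extension E x)"
    unfolding subfield_set_def
  proof (intro conjI ballI)
    show "1 \<in> simple_extension E x" by (rule in1[of 1 1]) (auto intro!: P)
    fix a assume "a \<in> simple_extension E x"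
    then obtain p q where p: "p \<in> polys_over E" "q \<in> polys_over E" "a = poly p x / poly q x"
      by (auto simp: simple_extension_def)
    show "inverse a \<in> simple_extension E x" by (rule in1[of q p]) (auto simp: p)
    fix b assume "b \<in> simple_extension E x"
    then obtain r s where r: "r \<in> polys_over E" "s \<in> polys_over E" "b = poly r x / poly s x"
      by (auto simp: simple_extension_def)
    show "a * b \<in> simple_extension E x"
      by (rule in1[of "p * r" "q * s"]) (auto simp: p r intro: P)
    show "a - b \<in> simple_extension E x"
    proof (cases "poly q x = 0 \<or> poly s x = 0")
      case True
      have "- r \<in> polys_over E" using P(2)[OF P(6) r(1)] by simp
      then show ?thesis
        using True in1[OF p(1,2), of "a - b"] in1[OF _ r(2), of "- r" "a - b"] by (auto simp: p(3) r(3))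
    next
      case False
      then show ?thesis
        by (intro in1[of "p * s - r * q" "q * s"]) (auto simp: p r field_simps intro!: P)
    qed
  qed
qed

lemma simple_extension_stable:
  assumes E: "subfield_set E" and D: "derivation D"
    and stable: "\<And>c. c \<in> E \<Longrightarrow> D c \<in> E" and x: "D x \<in> E" and y: "y \<in> simple_extension E x"
  shows "D y \<in> simple_extension E x"
proof -
  note S = simple_extension_rules[OF E, of x] and R = subfield_set_rules[OF simple_extension_rules(1)[OF E, of x]]
  have pol: "poly p x \<in> simple_extension E x" if "p \<in> polys_over E" for p
  proof -
    have "poly p x = poly p x / poly 1 x" by simp
    then show ?thesis unfolding simple_extension_def using that polys_over_rules(7)[OF E] by blast
  qed
  have Dpol: "D (poly p x) \<in> simple_extension E x" if "p \<in> polys_over E" for p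
    unfolding derivation_poly[OF D]
    by (intro R pol polys_over_rules[OF E] that subsetD[OF S(2)] x)
       (use that stable D in \<open>auto simp: polys_over_def\<close>)
  obtain p q where p: "p \<in> polys_over E" "q \<in> polys_over E" "y = poly p x / poly q x"
    using y by (auto simp: simple_extension_def)
  show ?thesis
  proof (cases "poly q x = 0")
    case True
    then show ?thesis using p R(1) derivation_rules(3)[OF D] by simp
  next
    case False
    then show ?thesis unfolding p(3) derivation_rules(11)[OF D False] power2_eq_square
      using p by (intro R pol Dpol) auto
  qed
qed

text \<open>
  The equation would say that \<open>(p / q)' = 1 / Y + Z / W\<close> with \<open>Y = X - e\<close>, so that \<open>(p / q)'\<close> has a
  simple pole at \<open>e\<close>. But if \<open>p / q\<close> has order \<open>k \<noteq> 0\<close> at \<open>e\<close>, its derivative has order \<open>k - 1\<close>,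
  and otherwise the derivative has no pole there. The proof compares powers of \<open>Y\<close>.
\<close>

lemma no_simple_pole_in_rational_derivative:
  fixes p q W Z :: "'k::field poly"
  assumes char: "char_zero_field TYPE('k)" and q: "q \<noteq> 0" and W: "poly W e \<noteq> 0"
  shows "(pderiv p * q - p * pderiv q) * ([:-e, 1:] * W) \<noteq> q\<^sup>2 * (W + [:-e, 1:] * Z)"
proof
  assume eq: "(pderiv p * q - p * pderiv q) * ([:-e, 1:] * W) = q\<^sup>2 * (W + [:-e, 1:] * Z)"
  define Y where "Y = [:-e, 1:]"
  have Y: "Y \<noteq> 0" "poly Y e = 0" by (auto simp: Y_def)
  have Ypow: "Y * pderiv (Y ^ a) = of_nat a * Y ^ a" for a
  proof (cases a)
    case (Suc n)
    have "pderiv Y = 1" by (simp add: Y_def pderiv_pCons one_pCons)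
    then have "pderiv (Y ^ Suc n) = Polynomial.smult (of_nat (Suc n)) (Y ^ n)"
      by (simp only: pderiv_power_Suc mult_1_right)
    then show ?thesis unfolding Suc by (simp add: of_nat_poly del: of_nat_Suc)
  qed simp
  have "p \<noteq> 0"
  proof
    assume "p = 0"
    then have "W + [:-e, 1:] * Z = 0" using eq q by simp
    then have "poly (W + [:-e, 1:] * Z) e = 0" by simp
    then show False using W by simp
  qed
  have "\<exists>n f1. f = Y ^ n * f1 \<and> \<not> Y dvd f1" if "f \<noteq> 0" for f
    using order_decomp[OF that, of e] unfolding Y_def by blast
  then obtain a q1 c p1 where q1: "q = Y ^ a * q1" "\<not> Y dvd q1" and p1: "p = Y ^ c * p1" "\<not> Y dvd p1"
    using q \<open>p \<noteq> 0\<close> by meson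
  have nz: "poly q1 e \<noteq> 0" "poly p1 e \<noteq> 0" using q1(2) p1(2) by (auto simp: Y_def poly_eq_0_iff_dvd)
  have Yd: "Y * pderiv (Y ^ n * f) = Y ^ n * (Y * pderiv f + of_nat n * f)" for n f
  proof -
    have "Y * pderiv (Y ^ n * f) = Y ^ n * (Y * pderiv f) + (Y * pderiv (Y ^ n)) * f"
      by (simp add: pderiv_mult algebra_simps)
    then show ?thesis unfolding Ypow by (simp add: algebra_simps)
  qed
  define V where "V = W * ((of_nat c - of_nat a) * (p1 * q1) + Y * (pderiv p1 * q1 - p1 * pderiv q1))"
  have "(pderiv p * q - p * pderiv q) * (Y * W) = ((Y * pderiv p) * q - p * (Y * pderiv q)) * W"
    by (simp add: algebra_simps)
  also have "\<dots> = ((Y ^ c * (Y * pderiv p1 + of_nat c * p1)) * (Y ^ a * q1)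
      - (Y ^ c * p1) * (Y ^ a * (Y * pderiv q1 + of_nat a * q1))) * W"
    unfolding q1(1) p1(1) Yd ..
  also have "\<dots> = Y ^ a * (Y ^ c * V)" by (simp add: V_def algebra_simps)
  finally have "Y ^ a * (Y ^ c * V) = (Y ^ a * q1)\<^sup>2 * (W + Y * Z)" using eq by (simp only: q1(1) Y_def)
  then have "Y ^ a * (Y ^ c * V) = Y ^ a * (Y ^ a * (q1\<^sup>2 * (W + Y * Z)))" by (simp add: power2_eq_square algebra_simps)
  then have main: "Y ^ c * V = Y ^ a * (q1\<^sup>2 * (W + Y * Z))" using Y(1) by simp
  have ev: "poly V e = poly W e * ((of_nat c - of_nat a) * (poly p1 e * poly q1 e))"
    "poly (q1\<^sup>2 * (W + Y * Z)) e = (poly q1 e)\<^sup>2 * poly W e" using Y(2) by (simp_all add: V_def)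
  have inj: "of_nat c \<noteq> (of_nat a :: 'k)" if "c < a" for c a
  proof -
    have "of_nat a - of_nat c = (of_nat (Suc (a - c - 1)) :: 'k)" using that by (simp add: of_nat_diff)
    then show ?thesis using char by (metis right_minus_eq)
  qed
  consider "c < a" | "c = a" | "a < c" by linarith
  then show False
  proof cases
    case 1
    then have "Y ^ a = Y ^ c * Y ^ (a - c)" by (simp flip: power_add)
    then have "V = Y ^ (a - c) * (q1\<^sup>2 * (W + Y * Z))" using main Y(1) by (simp add: mult.assoc)
    then have "poly V e = 0" using Y(2) 1 by (simp add: zero_power)
    then show False using ev(1) W nz inj[OF 1] by simp
  next
    case 2
    then have "V = q1\<^sup>2 * (W + Y * Z)" using main Y(1) by simp
    then have "poly V e = (poly q1 e)\<^sup>2 * poly W e" using ev(2) by simp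
    then show False using ev(1) 2 W nz by simp
  next
    case 3
    then have "Y ^ c = Y ^ a * Y ^ (c - a)" by (simp flip: power_add)
    then have "Y ^ (c - a) * V = q1\<^sup>2 * (W + Y * Z)" using main Y(1) by (simp add: mult.assoc)
    then have "poly (Y ^ (c - a) * V) e = (poly q1 e)\<^sup>2 * poly W e" using ev(2) by simp
    then show False using Y(2) 3 W nz by (simp add: zero_power)
  qed
qed

section \<open>A derivation with prescribed constants\<close>

text \<open>
  The set \<open>B\<close> plays the role of a transcendence basis of \<open>K\<close> over \<open>F\<close>.
\<close>

locale derivation_basis =
  fixes F B :: "'k::field set"
  assumes char: "char_zero_field TYPE('k)"
    and F: "subfield_set F"
    and closed: "\<And>x. algebraic_over F x \<Longrightarrow> x \<in> F"
    and values_ex: "\<And>v. \<exists>D\<in>derivations_over F. \<forall>b\<in>B. D b = v b"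
    and support_ex: "\<And>h. \<exists>S. finite S \<and> S \<subseteq> B \<and>
      (\<forall>D\<in>derivations_over F. (\<forall>b\<in>S. D b = 0) \<longrightarrow> D h = 0)"
begin

lemma overD: "D \<in> derivations_over F \<Longrightarrow> derivation D"
  "D \<in> derivations_over F \<Longrightarrow> c \<in> F \<Longrightarrow> D c = 0"
  by (auto simp: derivations_over_def)

lemma combination_over:
  assumes "\<And>b. b \<in> S \<Longrightarrow> E b \<in> derivations_over F"
  shows "(\<lambda>h. \<Sum>b\<in>S. a b * E b h) \<in> derivations_over F"
proof -
  have "derivation (\<lambda>h. \<Sum>b\<in>S. a b * E b h)"
    unfolding derivation_def
  proof (intro conjI allI)
    fix g h
    show "(\<Sum>b\<in>S. a b * E b (g + h)) = (\<Sum>b\<in>S. a b * E b g) + (\<Sum>b\<in>S. a b * E b h)"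
      unfolding sum.distrib[symmetric]
      by (rule sum.cong) (auto simp: derivation_rules(1)[OF overD(1)[OF assms]] algebra_simps)
    show "(\<Sum>b\<in>S. a b * E b (g * h)) = g * (\<Sum>b\<in>S. a b * E b h) + (\<Sum>b\<in>S. a b * E b g) * h"
      unfolding sum_distrib_left sum_distrib_right sum.distrib[symmetric]
      by (rule sum.cong) (auto simp: derivation_rules(2)[OF overD(1)[OF assms]] algebra_simps)
  qed
  then show ?thesis using overD(2)[OF assms] by (auto simp: derivations_over_def)
qed

lemma diff_over:
  "D \<in> derivations_over F \<Longrightarrow> E \<in> derivations_over F \<Longrightarrow> (\<lambda>h. D h - E h) \<in> derivations_over F"
  by (auto simp: derivations_over_def derivation_def algebra_simps)

lemma commutator_over:
  "D \<in> derivations_over F \<Longrightarrow> E \<in> derivations_over F \<Longrightarrow> (\<lambda>h. D (E h) - E (D h)) \<in> derivations_over F"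
  using derivation_commutator[of D E] by (auto simp: derivations_over_def derivation_rules(3))

lemma eq_if_eq_on_basis:
  assumes "D \<in> derivations_over F" "E \<in> derivations_over F" "\<And>b. b \<in> B \<Longrightarrow> D b = E b"
  shows "D h = E h"
  using support_ex[of h] diff_over[OF assms(1,2)] assms(3) by (metis (no_types, lifting) right_minus_eq subset_eq)

definition partial :: "'k \<Rightarrow> 'k \<Rightarrow> 'k" where
  "partial b = (SOME D. D \<in> derivations_over F \<and> (\<forall>c\<in>B. D c = of_bool (c = b)))"

lemma partial: "partial b \<in> derivations_over F" "c \<in> B \<Longrightarrow> partial b c = of_bool (c = b)"
proof -
  have "\<exists>D. D \<in> derivations_over F \<and> (\<forall>c\<in>B. D c = of_bool (c = b))"
    using values_ex[of "\<lambda>c. of_bool (c = b)"] by auto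
  from someI_ex[OF this] show "partial b \<in> derivations_over F" "c \<in> B \<Longrightarrow> partial b c = of_bool (c = b)"
    by (auto simp: partial_def)
qed

lemma partial_expansion:
  obtains S where "finite S" "S \<subseteq> B" "\<And>b. b \<in> B - S \<Longrightarrow> partial b h = 0"
    "\<And>D. D \<in> derivations_over F \<Longrightarrow> D h = (\<Sum>b\<in>S. D b * partial b h)"
proof -
  obtain S where S: "finite S" "S \<subseteq> B"
    "\<And>D. D \<in> derivations_over F \<Longrightarrow> (\<And>b. b \<in> S \<Longrightarrow> D b = 0) \<Longrightarrow> D h = 0"
    using support_ex[of h] by metis
  have exp: "D h = (\<Sum>b\<in>S. D b * partial b h)" if D: "D \<in> derivations_over F" for D
  proof -
    let ?E = "\<lambda>g. D g - (\<Sum>b\<in>S. D b * partial b g)"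
    have "?E \<in> derivations_over F" by (intro diff_over D combination_over partial)
    moreover have "?E c = 0" if "c \<in> S" for c
    proof -
      have "(\<Sum>b\<in>S. D b * partial b c) = (\<Sum>b\<in>S. if b = c then D b else 0)"
        by (rule sum.cong) (use that S(2) in \<open>auto simp: partial(2) subset_eq\<close>)
      then show ?thesis using that S(1) by simp
    qed
    ultimately have "?E h = 0" by (rule S(3))
    then show ?thesis by simp
  qed
  moreover have "partial b h = 0" if "b \<in> B - S" for b
    using that S(2) by (intro S(3)[OF partial(1)]) (auto simp: partial(2) subset_eq)
  ultimately show ?thesis using that S(1,2) by blast
qed

text \<open>
  The partial derivatives of \<open>h\<close> determine every derivation over \<open>F\<close> at \<open>h\<close>. If they vanish,
  \<open>h\<close> is algebraic over \<open>F\<close>, by \<open>exists_derivation_over\<close>.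
\<close>

lemma in_base_field: "(\<And>b. b \<in> B \<Longrightarrow> partial b h = 0) \<Longrightarrow> h \<in> F"
proof -
  assume z: "\<And>b. b \<in> B \<Longrightarrow> partial b h = 0"
  obtain S where S: "S \<subseteq> B" "\<And>D. D \<in> derivations_over F \<Longrightarrow> D h = (\<Sum>b\<in>S. D b * partial b h)"
    using partial_expansion[of h] by metis
  have "D h = 0" if "D \<in> derivations_over F" for D
    unfolding S(2)[OF that] using z S(1) by (intro sum.neutral) auto
  moreover have "\<exists>D\<in>derivations_over F. D h = 1" if "h \<notin> F"
    using exists_derivation_over[OF char F, of h] closed[of h] that by (auto simp: derivations_over_def)
  ultimately show "h \<in> F" by fastforce
qed

text \<open>
  Split \<open>B\<close> into chains indexed by \<open>\<nat>\<close> and let \<open>\<delta>\<close> send each \<open>b \<in> B\<close> to its successor \<open>b'\<close>. The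
  commutator of \<open>\<partial>/\<partial>b'\<close> and \<open>\<delta>\<close> is \<open>\<partial>/\<partial>b\<close>. If \<open>\<delta> h = 0\<close> and \<open>h\<close> depends on \<open>b\<close> but not on
  \<open>b'\<close>, then applying the commutator to \<open>h\<close> gives \<open>\<partial>h/\<partial>b = 0\<close>, a contradiction.
\<close>

lemma infinite_basis_case:
  assumes "infinite B"
  shows "\<exists>\<delta>. derivation \<delta> \<and> constants \<delta> = F"
proof -
  have "(card_of (B \<times> (UNIV::nat set)), card_of B) \<in> ordIso"
    using card_of_Times_infinite[OF assms, of "UNIV::nat set"] assms
    by (simp add: infinite_iff_card_of_nat)
  then obtain g where g: "bij_betw g (B \<times> (UNIV::nat set)) B" using card_of_ordIso by blast
  define k where "k = inv_into (B \<times> (UNIV::nat set)) g"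
  define nxt where "nxt b = g (fst (k b), Suc (snd (k b)))" for b
  have k: "k b \<in> B \<times> UNIV" "g (k b) = b" if "b \<in> B" for b
    using that g unfolding k_def
    by (metis bij_betw_def inv_into_into, metis bij_betw_inv_into_right)
  have gB: "g (c, n) \<in> B" "k (g (c, n)) = (c, n)" if "c \<in> B" for c n
    using that g unfolding k_def by (auto simp: bij_betw_def inv_into_f_f)
  have kfst: "fst (k b) \<in> B" if "b \<in> B" for b using k(1)[OF that] by (auto simp: mem_Times_iff)
  have nB: "nxt b \<in> B" if "b \<in> B" for b unfolding nxt_def by (rule gB[OF kfst[OF that]])
  have kn: "k (nxt b) = (fst (k b), Suc (snd (k b)))" if "b \<in> B" for b
    unfolding nxt_def by (rule gB(2)[OF kfst[OF that]])
  have inj: "nxt c = nxt b \<longleftrightarrow> c = b" if "b \<in> B" "c \<in> B" for b c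
    using kn[OF that(1)] kn[OF that(2)] k(2)[OF that(1)] k(2)[OF that(2)]
    by (metis old.nat.inject prod.collapse prod.inject)
  obtain \<delta> where \<delta>: "\<delta> \<in> derivations_over F" "\<And>b. b \<in> B \<Longrightarrow> \<delta> b = nxt b"
    using values_ex[of nxt] by auto
  have comm: "partial (nxt b) (\<delta> h) - \<delta> (partial (nxt b) h) = partial b h" if b: "b \<in> B" for b h
  proof (rule eq_if_eq_on_basis[OF commutator_over[OF partial(1) \<delta>(1)] partial(1)])
    fix c assume c: "c \<in> B"
    have "\<delta> (of_bool P) = 0" for P by (simp add: derivation_rules[OF overD(1)[OF \<delta>(1)]])
    then show "partial (nxt b) (\<delta> c) - \<delta> (partial (nxt b) c) = partial b c"
      using b c by (simp add: \<delta>(2) partial(2) nB inj)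
  qed
  have "h \<in> F" if h: "\<delta> h = 0" for h
  proof (rule in_base_field, rule ccontr)
    fix b0 assume b0: "b0 \<in> B" "partial b0 h \<noteq> 0"
    obtain S where "finite S" "\<And>b. b \<in> B - S \<Longrightarrow> partial b h = 0"
      using partial_expansion[of h] by metis
    then have fin: "finite {b\<in>B. partial b h \<noteq> 0}" by (auto intro: finite_subset[of _ S])
    have "{b\<in>B. partial b h \<noteq> 0} \<noteq> {}" using b0 by auto
    then obtain b where b: "b \<in> B" "partial b h \<noteq> 0"
      and max: "\<And>c. c \<in> B \<Longrightarrow> partial c h \<noteq> 0 \<Longrightarrow> snd (k c) \<le> snd (k b)"
      using fin obtains_MAX[OF fin, of "\<lambda>c. snd (k c)"]
      by (metis (mono_tags, lifting) Max_ge finite_imageI imageI mem_Collect_eq)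
    have "partial (nxt b) h = 0" using max[OF nB[OF b(1)]] kn[OF b(1)] by fastforce
    then have "partial b h = 0"
      using comm[OF b(1), of h] h by (simp add: derivation_rules[OF overD(1)] partial(1) \<delta>(1))
    then show False using b(2) by simp
  qed
  then have "constants \<delta> = F" using overD(2)[OF \<delta>(1)] by (auto simp: constants_def)
  then show ?thesis using overD(1)[OF \<delta>(1)] by blast
qed

lemma of_nat_eq_iff_of_char_zero: "of_nat i = (of_nat j :: 'k) \<longleftrightarrow> i = j"
proof -
  have "of_nat i \<noteq> (of_nat j :: 'k)" if "i < j" for i j
  proof -
    have "of_nat j - of_nat i = (of_nat (Suc (j - i - 1)) :: 'k)" using that by (simp add: of_nat_diff)
    then show ?thesis using char by (metis right_minus_eq)
  qed
  then show ?thesis by (metis linorder_neqE_nat)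
qed

lemma specialise_at_integer:
  assumes "(q :: 'k poly) \<noteq> 0"
  obtains N :: nat where "poly q (of_nat N) \<noteq> 0"
proof -
  have "inj (of_nat :: nat \<Rightarrow> 'k)" by (auto simp: inj_def of_nat_eq_iff_of_char_zero)
  then have "infinite (range (of_nat :: nat \<Rightarrow> 'k))" by (simp add: finite_image_iff)
  moreover have "finite {x. poly q x = 0}" using assms by (rule poly_roots_finite)
  ultimately have "\<not> range (of_nat :: nat \<Rightarrow> 'k) \<subseteq> {x. poly q x = 0}" using finite_subset by blast
  then show ?thesis using that by auto
qed

text \<open>
  A primitive \<open>p(h) / q(h)\<close> of \<open>v\<close> that involves a transcendental constant \<open>h\<close> satisfies a polynomial
  identity in \<open>h\<close> over \<open>L\<close>. Hence \<open>h\<close> may be replaced by any constant of \<open>L\<close> that is not a root of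
  \<open>q\<close>, for instance by an integer.
\<close>

lemma primitive_in_coefficient_field:
  fixes L :: "'k set"
  assumes L: "subfield_set L" and D: "derivation D" and stable: "\<And>c. c \<in> L \<Longrightarrow> D c \<in> L"
    and h: "\<not> algebraic_over L h" "D h = 0" and v: "v \<in> L"
    and r: "r \<in> simple_extension L h" "D r = v"
  shows "\<exists>r'\<in>L. D r' = v"
proof -
  note P = polys_over_rules[OF L]
  obtain p q where p: "p \<in> polys_over L" "q \<in> polys_over L" "r = poly p h / poly q h"
    using r(1) by (auto simp: simple_extension_def)
  show ?thesis
  proof (cases "poly q h = 0")
    case True
    then have "v = 0" using r(2) p(3) derivation_rules(3)[OF D] by simp
    then show ?thesis using subfield_set_rules(1)[OF L] derivation_rules(3)[OF D] by auto
  next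
    case False
    have Dp: "D (poly f h) = poly (map_poly D f) h" for f using derivation_poly[OF D] h(2) by simp
    define w where "w = map_poly D p * q - p * map_poly D q - Polynomial.smult v (q * q)"
    have "poly w h = 0"
      using r(2) False unfolding p(3) derivation_rules(11)[OF D False] Dp
      by (simp add: w_def field_simps power2_eq_square)
    moreover have "map_poly D f \<in> polys_over L" if "f \<in> polys_over L" for f
      using that stable D by (auto simp: polys_over_def)
    then have "w \<in> polys_over L" unfolding w_def using p v by (intro P) auto
    ultimately have w: "w = 0" using h(1) by (auto simp: algebraic_over_def)
    (* the integer N replaces h; it is a constant like h *)
    obtain N :: nat where N: "poly q (of_nat N) \<noteq> 0"
      using specialise_at_integer[of q] False by (metis poly_0)
    have Dp: "D (poly f (of_nat N)) = poly (map_poly D f) (of_nat N)" for f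
      using derivation_poly[OF D] by (simp add: derivation_rules[OF D])
    have "poly w (of_nat N) = 0" by (simp add: w)
    then have "D (poly p (of_nat N) / poly q (of_nat N)) = v"
      unfolding derivation_rules(11)[OF D N] Dp using N
      by (simp add: w_def field_simps power2_eq_square)
    moreover have "poly p (of_nat N) / poly q (of_nat N) \<in> L"
      using p by (intro subfield_set_rules[OF L] poly_in_subfield[OF L])
    ultimately show ?thesis by blast
  qed
qed

text \<open>
  The derivative of a rational function in \<open>t\<close> has no simple pole, whereas the sum has one at
  \<open>t = - k\<close>, with residue \<open>c k = 1\<close>.
\<close>

lemma simple_fractions_not_derivative:
  assumes D: "derivation D" "\<And>c. c \<in> F \<Longrightarrow> D c = 0" and t: "D t = 1" "t \<notin> F"
    and c: "\<And>l. l \<in> {1..k} \<Longrightarrow> c l \<in> F" "c k = 1" and k: "k \<ge> (1::nat)"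
    and r: "r \<in> simple_extension F t"
  shows "D r \<noteq> (\<Sum>l=1..k. c l / (t + of_nat l))"
proof
  assume eq: "D r = (\<Sum>l=1..k. c l / (t + of_nat l))"
  note P = polys_over_rules[OF F]
  obtain p q where p: "p \<in> polys_over F" "q \<in> polys_over F" "r = poly p t / poly q t"
    using r by (auto simp: simple_extension_def)
  define Y where "Y l = [:of_nat l, 1 :: 'k:]" for l :: nat
  have YF: "Y l \<in> polys_over F" for l unfolding Y_def by (intro P subfield_set_rules[OF F])
  define Z where "Z l = (\<Prod>j\<in>{1..<k}-{l}. Y j)" for l
  define W where "W = (\<Prod>j\<in>{1..<k}. Y j)"
  have prodF: "(\<Prod>j\<in>J. Y j) \<in> polys_over F" for J
    by (induction J rule: infinite_finite_induct) (auto intro: P YF)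
  have sumF: "(\<Sum>l\<in>J. Polynomial.smult (c l) (Z l)) \<in> polys_over F" if "J \<subseteq> {1..k}" for J
    using that
    by (induction J rule: infinite_finite_induct) (auto intro!: P prodF c(1) simp: Z_def)
  have Yp: "poly (Y l) t = t + of_nat l" for l by (simp add: Y_def add.commute)
  have Yt: "poly (Y l) t \<noteq> 0" for l
  proof
    assume "poly (Y l) t = 0"
    then have "t = - of_nat l" by (simp add: Y_def eq_neg_iff_add_eq_0 add.commute)
    then show False using t(2) subfield_set_rules(5)[OF F subfield_set_rules(9)[OF F, of l]] by simp
  qed
  have Wt: "poly W t \<noteq> 0" using Yt by (simp add: W_def poly_prod)
  have q0: "poly q t \<noteq> 0" if "q \<noteq> 0" "q \<in> polys_over F" for q
    using that t(2) closed[of t] by (auto simp: algebraic_over_def)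
  define T where "T = (\<Sum>l\<in>{1..<k}. Polynomial.smult (c l) (Z l))"
  have ZW: "poly (Z l) t = poly W t / (t + of_nat l)" if "l \<in> {1..<k}" for l
  proof -
    have "poly W t = poly (Y l) t * poly (Z l) t"
      using that by (simp add: W_def Z_def prod.remove[of _ l] del: poly_prod flip: poly_mult)
    then show ?thesis using Yt[of l] by (simp add: Yp)
  qed
  have Tt: "poly T t = poly W t * (\<Sum>l\<in>{1..<k}. c l / (t + of_nat l))"
    unfolding T_def poly_sum sum_distrib_left by (rule sum.cong) (auto simp: ZW)
  have split: "(\<Sum>l=1..k. c l / (t + of_nat l)) = (\<Sum>l\<in>{1..<k}. c l / (t + of_nat l)) + 1 / (t + of_nat k)"
    using k c(2) by (simp add: sum.last_plus add.commute atLeastLessThanSuc_atLeastAtMost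
        flip: atLeastLessThanSuc_atLeastAtMost) 
  have rhs: "D r * (poly W t * poly (Y k) t) = poly W t + poly (Y k) t * poly T t"
    unfolding eq split Tt using Yt[of k] by (simp add: Y_def field_simps)
  have Dp: "D (poly f t) = poly (pderiv f) t" if "f \<in> polys_over F" for f
  proof -
    have "map_poly D f = 0" using that D by (auto simp: poly_eq_iff polys_over_def)
    then show ?thesis using derivation_poly[OF D(1), of f t] t(1) by simp
  qed
  have qn: "q \<noteq> 0"
  proof
    assume "q = 0"
    then have "D r = 0" using p(3) derivation_rules(3)[OF D(1)] by simp
    then have "poly (W + Y k * T) t = 0" using rhs by simp
    moreover have "W + Y k * T \<in> polys_over F" by (auto simp: W_def T_def intro!: P YF prodF sumF)
    ultimately have "W + Y k * T = 0" using q0 by blast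
    then have "poly (W + Y k * T) (- of_nat k) = 0" by simp
    then have "poly W (- of_nat k) = 0" by (simp add: Y_def)
    then show False by (auto simp: W_def poly_prod Y_def of_nat_eq_iff_of_char_zero)
  qed
  define w where "w = (pderiv p * q - p * pderiv q) * (Y k * W) - q\<^sup>2 * (W + Y k * T)"
  have "poly w t = 0"
  proof -
    have Dr: "D r * (poly q t)\<^sup>2 = poly (pderiv p) t * poly q t - poly p t * poly (pderiv q) t"
      using q0[OF qn p(2)] unfolding p(3) derivation_rules(11)[OF D(1) q0[OF qn p(2)]]
      by (simp add: Dp p)
    have "poly w t = (D r * (poly q t)\<^sup>2) * (poly (Y k) t * poly W t) - (poly q t)\<^sup>2 * (poly W t + poly (Y k) t * poly T t)"
      unfolding Dr by (simp add: w_def)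
    then show ?thesis unfolding rhs[symmetric] by (simp add: algebra_simps)
  qed
  moreover have "w \<in> polys_over F"
    unfolding w_def power2_eq_square W_def T_def by (intro P YF prodF sumF p) auto
  ultimately have "w = 0" using q0 by blast
  moreover have "poly W (- of_nat k) \<noteq> 0" by (auto simp: W_def poly_prod Y_def of_nat_eq_iff_of_char_zero)
  ultimately show False
    using no_simple_pole_in_rational_derivative[OF char qn, of W "- of_nat k" p T]
    by (simp add: w_def Y_def)
qed

text \<open>
  Put \<open>\<delta> x\<^sub>0 = 1\<close> and \<open>\<delta> x\<^sub>l = 1 / (x\<^sub>0 + l)\<close>. Let \<open>L i\<close> be the field of the elements that depend
  only on \<open>x\<^sub>0, \<dots>, x\<^sub>i\<^sub>-\<^sub>1\<close>. By induction on \<open>i\<close> the constants in \<open>L i\<close> lie in \<open>F\<close>. Suppose that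
  \<open>h\<close> is a constant that depends on \<open>x\<^sub>k\<close> but not on later variables. Then \<open>x\<^sub>k\<close> is algebraic over
  \<open>L k (h)\<close>, so \<open>1 / (x\<^sub>0 + k)\<close> has a primitive \<open>r\<close> in this field, and by specialising \<open>h\<close> one in
  \<open>L k\<close>. The derivatives \<open>\<partial>r/\<partial>x\<^sub>l\<close> for \<open>l \<ge> 1\<close> are constants, hence in \<open>F\<close>; subtracting
  \<open>\<Sum> (\<partial>r/\<partial>x\<^sub>l) x\<^sub>l\<close> leaves an element that is algebraic over \<open>F(x\<^sub>0)\<close> and whose derivative is a
  combination of simple fractions. This is impossible.
\<close>

lemma finite_basis_case:
  assumes fin: "finite B" and ne: "B \<noteq> {}"
  shows "\<exists>\<delta>. derivation \<delta> \<and> constants \<delta> = F"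
proof -
  define n where "n = card B"
  obtain x where x: "bij_betw x {0..<n} B" using ex_bij_betw_nat_finite[OF fin] by (auto simp: n_def)
  have n0: "n > 0" using fin ne by (simp add: n_def card_gt_0_iff)
  have xB: "x i \<in> B" if "i < n" for i using x that by (auto simp: bij_betw_def)
  have xinj: "x i = x j \<longleftrightarrow> i = j" if "i < n" "j < n" for i j
    using x that by (auto simp: bij_betw_def inj_on_def)
  have Bx: "\<exists>i<n. b = x i" if "b \<in> B" for b using x that by (auto simp: bij_betw_def)
  define P where "P i = partial (x i)" for i
  have P: "P i \<in> derivations_over F" for i by (simp add: P_def partial)
  have Px: "P i (x j) = of_bool (i = j)" if "i < n" "j < n" for i j
    using that by (auto simp: P_def partial(2) xB xinj)
  note PD = derivation_rules[OF overD(1)[OF P]]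
  have expand: "D h = (\<Sum>i<n. D (x i) * P i h)" if D: "D \<in> derivations_over F" for D h
  proof -
    obtain S where S: "finite S" "S \<subseteq> B" "\<And>b. b \<in> B - S \<Longrightarrow> partial b h = 0"
      "D h = (\<Sum>b\<in>S. D b * partial b h)" using partial_expansion[of h] D by metis
    have "D h = (\<Sum>b\<in>B. D b * partial b h)"
      unfolding S(4) by (rule sum.mono_neutral_left[OF fin S(2)]) (use S(3) in auto)
    also have "\<dots> = (\<Sum>i\<in>{0..<n}. D (x i) * P i h)"
      unfolding P_def by (rule sum.reindex_bij_betw[OF x, symmetric])
    finally show ?thesis by (simp add: lessThan_atLeast0)
  qed
  have eqI: "D h = E h" if "D \<in> derivations_over F" "E \<in> derivations_over F"
    "\<And>i. i < n \<Longrightarrow> D (x i) = E (x i)" for D E h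
    using eq_if_eq_on_basis[OF that(1,2)] that(3) Bx by blast
  define t where "t = x 0"
  have t: "t \<notin> F" "P 0 t = 1" "\<And>l. 1 \<le> l \<Longrightarrow> l < n \<Longrightarrow> P l t = 0"
    using Px[of 0 0] Px[of _ 0] n0 overD(2)[OF P, of t 0] by (auto simp: t_def)
  have tl: "t + of_nat l \<noteq> 0" for l
  proof
    assume "t + of_nat l = 0"
    then have "t = - of_nat l" by (simp add: eq_neg_iff_add_eq_0)
    then show False using t(1) subfield_set_rules(5)[OF F subfield_set_rules(9)[OF F, of l]] by simp
  qed
  define v where "v l = (if l = 0 then 1 else 1 / (t + of_nat l))" for l :: nat
  obtain \<delta> where \<delta>: "\<delta> \<in> derivations_over F" "\<And>l. l < n \<Longrightarrow> \<delta> (x l) = v l"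
  proof -
    obtain \<delta> where "\<delta> \<in> derivations_over F" "\<forall>b\<in>B. \<delta> b = v (inv_into {0..<n} x b)"
      using values_ex[of "\<lambda>b. v (inv_into {0..<n} x b)"] by blast
    moreover have "inv_into {0..<n} x (x l) = l" if "l < n" for l
      using x that by (auto simp: bij_betw_def intro: inv_into_f_f)
    ultimately show ?thesis using that xB by auto
  qed
  note dD = derivation_rules[OF overD(1)[OF \<delta>(1)]]
  have Pv: "P l (v j) = 0" if "1 \<le> l" "l < n" for l j
    using t(3)[OF that] tl[of j] by (auto simp: v_def PD)
  have bool0: "D (of_bool Q) = 0" if "D \<in> derivations_over F" for D Q
    by (simp add: derivation_rules[OF overD(1)[OF that]])
  have comm: "P l (\<delta> h) = \<delta> (P l h)" if l: "1 \<le> l" "l < n" for l h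
  proof -
    have "P l (\<delta> h) - \<delta> (P l h) = (\<lambda>h. 0) h"
      by (rule eqI[OF commutator_over[OF P \<delta>(1)]])
         (use l in \<open>auto simp: derivations_over_def derivation_def \<delta>(2) Px Pv bool0[OF \<delta>(1)]\<close>)
    then show ?thesis by simp
  qed
  have Pcomm: "P l (P j h) = P j (P l h)" if l: "l < n" "j < n" for l j h
  proof -
    have "P l (P j h) - P j (P l h) = (\<lambda>h. 0) h"
      by (rule eqI[OF commutator_over[OF P P]])
         (use l in \<open>auto simp: derivations_over_def derivation_def Px bool0[OF P]\<close>)
    then show ?thesis by simp
  qed
  define L where "L i = {h. \<forall>j. i \<le> j \<and> j < n \<longrightarrow> P j h = 0}" for i
  have L: "subfield_set (L i)" for i
  proof -
    have "L i = (\<Inter>j\<in>{i..<n}. constants (P j))" by (auto simp: L_def constants_def)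
    then show ?thesis using subfield_INT[of "{i..<n}" "\<lambda>j. constants (P j)"] subfield_constants[OF overD(1)[OF P]] by simp
  qed
  have FL: "F \<subseteq> L i" for i using overD(2)[OF P] by (auto simp: L_def)
  have xL: "x j \<in> L i" if "j < i" "j < n" for i j using that by (auto simp: L_def Px)
  have dL: "\<delta> h \<in> L i" if "h \<in> L i" "1 \<le> i" for h i
    using that by (auto simp: L_def comm dD(3))
  have inF: "h \<in> F" if "\<And>i. i < n \<Longrightarrow> P i h = 0" for h
    by (rule in_base_field) (use that Bx in \<open>fastforce simp: P_def\<close>)
  have d1: "\<delta> h = P 0 h" if "h \<in> L 1" for h
  proof -
    have "\<delta> h = (\<Sum>i<n. \<delta> (x i) * P i h)" by (rule expand[OF \<delta>(1)])
    also have "\<dots> = (\<Sum>i\<in>{0}. \<delta> (x i) * P i h)"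
      by (rule sum.mono_neutral_right) (use n0 that in \<open>auto simp: L_def\<close>)
    finally show ?thesis using n0 by (simp add: \<delta>(2) v_def)
  qed
  have main: "\<forall>h\<in>L (Suc i). \<delta> h = 0 \<longrightarrow> h \<in> F" if "i < n" for i
    using that
  proof (induction i)
    case 0
    show ?case
    proof (intro ballI impI)
      fix h assume h: "h \<in> L (Suc 0)" "\<delta> h = 0"
      show "h \<in> F"
      proof (rule inF)
        fix i assume "i < n"
        then show "P i h = 0" using h d1[of h] by (cases i) (auto simp: L_def)
      qed
    qed
  next
    case (Suc i)
    define k where "k = Suc i"
    have k: "1 \<le> k" "k < n" using Suc.prems by (auto simp: k_def)
    have IH: "h \<in> F" if "h \<in> L k" "\<delta> h = 0" for h using Suc that by (auto simp: k_def)
    show ?case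
    proof (intro ballI impI, rule ccontr)
      fix h assume h: "h \<in> L (Suc (Suc i))" "\<delta> h = 0" "h \<notin> F"
      then have "h \<notin> L k" using IH by blast
      then have Pkh: "P k h \<noteq> 0" using h(1) by (auto simp: L_def k_def) (metis Suc_leI le_neq_implies_less)
      have trans: "\<not> algebraic_over (L k) h"
        using derivation_algebraic_eq_0[OF char L[of k] overD(1)[OF P[of k]], of h] Pkh k(2) by (auto simp: L_def)
      define E where "E = simple_extension (L k) h"
      note E = simple_extension_rules[OF L[of k], of h, folded E_def]
      (* a derivation over L k (h) kills the variables before x k as well as h, and h depends on x k *)
      have xk: "algebraic_over E (x k)"
      proof (rule ccontr)
        assume "\<not> algebraic_over E (x k)"
        then obtain D where D: "derivation D" "\<And>c. c \<in> E \<Longrightarrow> D c = 0" "D (x k) = 1"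
          using exists_derivation_over[OF char E(1)] by blast
        then have DF: "D \<in> derivations_over F" using FL[of k] E(2) by (auto simp: derivations_over_def)
        have "D h = (\<Sum>l<n. D (x l) * P l h)" by (rule expand[OF DF])
        also have "\<dots> = (\<Sum>l\<in>{k}. D (x l) * P l h)"
        proof (rule sum.mono_neutral_right)
          show "\<forall>l\<in>{..<n} - {k}. D (x l) * P l h = 0"
          proof
            fix l assume l: "l \<in> {..<n} - {k}"
            show "D (x l) * P l h = 0"
            proof (cases "l < k")
              case True
              then show ?thesis using D(2) E(2) xL[of l k] l by auto
            next
              case False
              then show ?thesis using h(1) l by (auto simp: L_def k_def)
            qed
          qed
        qed (use k in auto)
        finally have "D h = P k h" using D(3) by simp
        then show False using D(2)[OF E(3)] Pkh by simp
      qed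
      have vk: "v k \<in> L k"
        unfolding v_def t_def using xL[of 0 k] k n0
        by (auto intro!: subfield_set_rules[OF L])
      have dE: "\<delta> c \<in> E" if "c \<in> E" for c
        unfolding E_def
        by (rule simple_extension_stable[OF L overD(1)[OF \<delta>(1)]])
           (use dL k h(2) that subfield_set_rules(1)[OF L] in \<open>auto simp: E_def\<close>)
      have "\<exists>r\<in>E. \<delta> r = \<delta> (x k)"
        by (rule derivative_attained_in_subfield[OF char E(1) overD(1)[OF \<delta>(1)] dE xk])
           (use vk E(2) \<delta>(2)[OF k(2)] in auto)
      then obtain r0 where r0: "r0 \<in> E" "\<delta> r0 = v k" using \<delta>(2)[OF k(2)] by auto
      obtain r where r: "r \<in> L k" "\<delta> r = v k"
        using primitive_in_coefficient_field[OF L overD(1)[OF \<delta>(1)] _ trans h(2) vk r0(1)[unfolded E_def] r0(2)]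
          dL k by blast
      define c where "c l = (if l = k then 1 else - P l r)" for l
      have cF: "P l r \<in> F" if "1 \<le> l" "l < k" for l
      proof (rule IH)
        show "P l r \<in> L k" using r(1) that k(2) by (auto simp: L_def Pcomm[of _ l] PD(3))
        show "\<delta> (P l r) = 0" using comm[of l r, symmetric] that k(2) by (simp add: r(2) Pv)
      qed
      define Y where "Y = r - (\<Sum>l\<in>{1..<k}. P l r * x l)"
      have PY: "P j Y = P j r - (\<Sum>l\<in>{1..<k}. P l r * P j (x l))" for j
        unfolding Y_def PD using overD(2)[OF P cF] by (simp add: PD)
      have YL: "Y \<in> L 1"
        unfolding L_def
      proof (intro CollectI allI impI)
        fix j assume j: "1 \<le> j \<and> j < n"
        have "(\<Sum>l\<in>{1..<k}. P l r * P j (x l)) = (\<Sum>l\<in>{1..<k}. if l = j then P l r else 0)"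
          by (rule sum.cong) (use j k in \<open>auto simp: Px\<close>)
        also have "\<dots> = P j r" using j r(1) by (auto simp: L_def)
        finally show "P j Y = 0" by (simp add: PY)
      qed
      have "\<delta> Y = v k - (\<Sum>l\<in>{1..<k}. P l r * v l)"
        unfolding Y_def dD r(2) using k overD(2)[OF \<delta>(1) cF] by (simp add: dD \<delta>(2))
      also have "\<dots> = (\<Sum>l=1..k. c l / (t + of_nat l))"
      proof -
        have "(\<Sum>l=1..k. c l / (t + of_nat l)) = (\<Sum>l\<in>insert k {1..<k}. c l / (t + of_nat l))"
          by (rule sum.cong) (use k in auto)
        also have "\<dots> = v k - (\<Sum>l\<in>{1..<k}. P l r * v l)"
          using k by (simp add: c_def v_def sum_negf[symmetric])
        finally show ?thesis by simp
      qed
      finally have P0Y: "P 0 Y = (\<Sum>l=1..k. c l / (t + of_nat l))" using d1[OF YL] by simp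
      define E0 where "E0 = simple_extension F t"
      note E0 = simple_extension_rules[OF F, of t, folded E0_def]
      (* Y depends on no variable other than t *)
      have Yalg: "algebraic_over E0 Y"
      proof (rule ccontr)
        assume "\<not> algebraic_over E0 Y"
        then obtain D where D: "derivation D" "\<And>c. c \<in> E0 \<Longrightarrow> D c = 0" "D Y = 1"
          using exists_derivation_over[OF char E0(1)] by blast
        then have DF: "D \<in> derivations_over F" using E0(2) by (auto simp: derivations_over_def)
        have "D (x i) * P i Y = 0" if "i < n" for i
          using YL that D(2)[OF E0(3)] by (cases i) (auto simp: L_def t_def)
        then have "(\<Sum>i<n. D (x i) * P i Y) = 0" by (intro sum.neutral) auto
        then show False using expand[OF DF, of Y] D(3) by simp
      qed
      have P0E: "P 0 c \<in> E0" if "c \<in> E0" for c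
        unfolding E0_def
        by (rule simple_extension_stable[OF F overD(1)[OF P]])
           (use that t(2) overD(2)[OF P] subfield_set_rules[OF F] in \<open>auto simp: E0_def\<close>)
      have cF': "c l \<in> F" if "l \<in> {1..k}" for l
        using that cF[of l] by (auto simp: c_def intro!: subfield_set_rules[OF F])
      have "P 0 Y \<in> E0"
        unfolding P0Y using cF' E0(2,3) by (intro subfield_set_rules[OF E0(1)]) auto
      then obtain r' where "r' \<in> E0" "P 0 r' = P 0 Y"
        using derivative_attained_in_subfield[OF char E0(1) overD(1)[OF P] P0E Yalg] by blast
      moreover have "c k = 1" by (simp add: c_def)
      ultimately show False
        using simple_fractions_not_derivative[OF overD(1)[OF P] overD(2)[OF P] t(2,1) _ _ k(1), of c r'] cF' P0Y
        by (simp add: E0_def)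
    qed
  qed
  have "h \<in> F" if "\<delta> h = 0" for h
    using main[of "n - 1"] that n0 by (auto simp: L_def)
  then have "constants \<delta> = F" using overD(2)[OF \<delta>(1)] by (auto simp: constants_def)
  then show ?thesis using overD(1)[OF \<delta>(1)] by blast
qed

end

theorem exists_derivation_with_constants:
  fixes F :: "'k::field set"
  assumes char: "char_zero_field TYPE('k)" and F: "subfield_set F"
    and closed: "\<And>x. algebraic_over F x \<Longrightarrow> x \<in> F" and proper: "F \<noteq> UNIV"
  shows "\<exists>\<delta>. derivation \<delta> \<and> constants \<delta> = F"
proof -
  obtain B where B: "\<forall>v. \<exists>D\<in>derivations_over F. \<forall>b\<in>B. D b = v b"
    "\<forall>h. \<exists>S. finite S \<and> S \<subseteq> B \<and> (\<forall>D\<in>derivations_over F. (\<forall>b\<in>S. D b = 0) \<longrightarrow> D h = 0)"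
    using derivation_basis_exists[of F] by blast
  interpret derivation_basis F B
    by (rule derivation_basis.intro[OF char F closed B[rule_format]])
  have "B \<noteq> {}" using in_base_field proper by blast
  then show ?thesis using infinite_basis_case finite_basis_case by blast
qed

section \<open>Modules over differential polynomial rings\<close>

text \<open>
  A module \<open>V\<close> over \<open>K[t;\<delta>]\<close>: the indeterminate \<open>t\<close> acts as \<open>nabla\<close>, and \<open>act\<close> is the action of
  a polynomial. The carrier is a subspace, because it will be a space of rows whose length is a
  natural number.
\<close>

locale differential_module = vector_space scale
  for scale :: "'k::field \<Rightarrow> 'v::ab_group_add \<Rightarrow> 'v" (infixr \<open>*v\<close> 75) +
  fixes \<delta> :: "'k \<Rightarrow> 'k" and V :: "'v set" and nabla :: "'v \<Rightarrow> 'v"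
  assumes derivation: "derivation \<delta>" and subspace_V: "subspace V"
    and nabla_closed: "v \<in> V \<Longrightarrow> nabla v \<in> V"
    and nabla_add: "u \<in> V \<Longrightarrow> v \<in> V \<Longrightarrow> nabla (u + v) = nabla u + nabla v"
    and nabla_scale: "v \<in> V \<Longrightarrow> nabla (a *v v) = a *v nabla v + \<delta> a *v v"
begin

definition act :: "'k poly \<Rightarrow> 'v \<Rightarrow> 'v" where
  "act g v = (\<Sum>i\<le>degree g. coeff g i *v (nabla ^^ i) v)"

lemma act_upto: "(\<And>i. i > n \<Longrightarrow> coeff g i = 0) \<Longrightarrow> act g v = (\<Sum>i\<le>n. coeff g i *v (nabla ^^ i) v)"
proof -
  assume a: "\<And>i. i > n \<Longrightarrow> coeff g i = 0"
  then have "degree g \<le> n" by (intro degree_le) auto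
  then show ?thesis unfolding act_def by (intro sum.mono_neutral_left) (auto simp: coeff_eq_0)
qed

lemma pow_closed: "v \<in> V \<Longrightarrow> (nabla ^^ i) v \<in> V"
  by (induction i) (auto intro: nabla_closed)

lemma pow_add: "u \<in> V \<Longrightarrow> v \<in> V \<Longrightarrow> (nabla ^^ i) (u + v) = (nabla ^^ i) u + (nabla ^^ i) v"
  by (induction i) (auto simp: nabla_add pow_closed)

lemma act_closed: "v \<in> V \<Longrightarrow> act g v \<in> V"
  unfolding act_def using subspace_V by (intro subspace_sum subspace_scale pow_closed)

lemma act_0 [simp]: "act 0 v = 0"
  by (simp add: act_def)

lemma act_add: "act (g + h) v = act g v + act h v"
proof -
  define n where "n = max (degree g) (degree h)"
  have "act (g + h) v = (\<Sum>i\<le>n. coeff (g + h) i *v (nabla ^^ i) v)"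
    "act g v = (\<Sum>i\<le>n. coeff g i *v (nabla ^^ i) v)" "act h v = (\<Sum>i\<le>n. coeff h i *v (nabla ^^ i) v)"
    by (rule act_upto; simp add: n_def coeff_eq_0)+
  then show ?thesis by (simp add: scale_left_distrib sum.distrib)
qed

lemma act_smult: "act (Polynomial.smult a g) v = a *v act g v"
proof -
  have "act (Polynomial.smult a g) v = (\<Sum>i\<le>degree g. coeff (Polynomial.smult a g) i *v (nabla ^^ i) v)"
    by (rule act_upto) (simp add: coeff_eq_0)
  then show ?thesis by (simp add: act_def scale_sum_right)
qed

lemma act_minus: "act (- g) v = - act g v"
  using act_smult[of "-1" g v] by simp

lemma act_diff: "act (g - h) v = act g v - act h v"
  using act_add[of g "- h" v] by (simp add: act_minus)

lemma act_sum: "act (\<Sum>i\<in>I. g i) v = (\<Sum>i\<in>I. act (g i) v)"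
  by (induction I rule: infinite_finite_induct) (auto simp: act_add)

lemma act_add_right: "u \<in> V \<Longrightarrow> v \<in> V \<Longrightarrow> act g (u + v) = act g u + act g v"
  by (simp add: act_def pow_add scale_right_distrib sum.distrib)

lemma act_pCons: "act (pCons a p) v = a *v v + act p (nabla v)"
proof -
  have "act (pCons a p) v = (\<Sum>i\<le>Suc (degree p). coeff (pCons a p) i *v (nabla ^^ i) v)"
    by (rule act_upto) (simp add: coeff_eq_0 coeff_pCons split: nat.split)
  also have "\<dots> = a *v v + act p (nabla v)"
    by (subst sum.atMost_Suc_shift) (simp add: act_def funpow_swap1)
  finally show ?thesis .
qed

lemma act_const: "act [:a:] v = a *v v"
  by (simp add: act_pCons)

lemma act_monom: "act (monom 1 i) v = (nabla ^^ i) v"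
  by (induction i arbitrary: v) (simp_all add: monom_0 monom_Suc act_pCons funpow_swap1)

lemma act_zero_right: "act g 0 = 0"
  using act_add_right[OF subspace_0[OF subspace_V] subspace_0[OF subspace_V], of g] by simp

lemma act_t_mult: "v \<in> V \<Longrightarrow> act (t_mult \<delta> g) v = nabla (act g v)"
proof (induction g arbitrary: v)
  case 0
  have "nabla 0 = 0" using nabla_add[of 0 0] subspace_0[OF subspace_V] by simp
  then show ?case by (simp add: t_mult_def)
next
  case (pCons a p)
  have "map_poly \<delta> (pCons a p) = pCons (\<delta> a) (map_poly \<delta> p)"
    by (rule poly_eqI) (simp add: derivation coeff_pCons split: nat.split)
  then have "act (t_mult \<delta> (pCons a p)) v =
      a *v nabla v + \<delta> a *v v + (act (pCons 0 p) (nabla v) + act (map_poly \<delta> p) (nabla v))"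
    by (simp add: t_mult_def act_add act_pCons)
  also have "\<dots> = nabla (a *v v) + nabla (act p (nabla v))"
    using pCons.IH[OF nabla_closed[OF pCons.prems]]
    by (simp add: t_mult_def act_add nabla_scale[OF pCons.prems])
  also have "\<dots> = nabla (act (pCons a p) v)"
    unfolding act_pCons
    by (rule nabla_add[symmetric]) (auto intro!: subspace_scale[OF subspace_V] act_closed nabla_closed pCons.prems)
  finally show ?case .
qed

lemma act_t_mult_pow: "v \<in> V \<Longrightarrow> act ((t_mult \<delta> ^^ i) g) v = (nabla ^^ i) (act g v)"
  by (induction i) (simp_all add: act_t_mult)

theorem act_diff_mult: "v \<in> V \<Longrightarrow> act (diff_mult \<delta> g h) v = act g (act h v)"
  by (simp add: diff_mult_def act_sum act_smult act_t_mult_pow) (simp add: act_def)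

end

lemma coeff_t_mult: "derivation \<delta> \<Longrightarrow>
    coeff (t_mult \<delta> g) i = (case i of 0 \<Rightarrow> 0 | Suc j \<Rightarrow> coeff g j) + \<delta> (coeff g i)"
  by (simp add: t_mult_def coeff_pCons)

text \<open>
  The ring \<open>K[t;\<delta>]\<close> as a module over itself; here \<open>act\<close> is the multiplication of the ring.
\<close>

lemma differential_module_poly:
  fixes \<delta> :: "'k::field \<Rightarrow> 'k"
  assumes "derivation \<delta>"
  shows "differential_module Polynomial.smult \<delta> UNIV (t_mult \<delta>)"
proof -
  interpret vector_space "Polynomial.smult :: 'k \<Rightarrow> 'k poly \<Rightarrow> 'k poly"
    by standard (auto simp: smult_add_right smult_add_left)
  show ?thesis
  proof
    show "t_mult \<delta> (u + v) = t_mult \<delta> u + t_mult \<delta> v" for u v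
      by (rule poly_eqI) (auto simp: coeff_t_mult assms derivation_rules(1)[OF assms] split: nat.split)
    show "t_mult \<delta> (Polynomial.smult a v) = Polynomial.smult a (t_mult \<delta> v) + Polynomial.smult (\<delta> a) v" for a v
      by (rule poly_eqI) (auto simp: coeff_t_mult assms derivation_rules(2)[OF assms] algebra_simps split: nat.split)
  qed (auto simp: assms)
qed

lemma coeff_t_mult_pow_top:
  assumes "derivation \<delta>" and "degree h \<le> n"
  shows "degree ((t_mult \<delta> ^^ i) h) \<le> n + i" "coeff ((t_mult \<delta> ^^ i) h) (n + i) = coeff h n"
proof -
  have "degree ((t_mult \<delta> ^^ i) h) \<le> n + i \<and> coeff ((t_mult \<delta> ^^ i) h) (n + i) = coeff h n"
  proof (induction i)
    case (Suc i)
    then have z: "coeff ((t_mult \<delta> ^^ i) h) j = 0" if "j > n + i" for j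
      using that by (intro coeff_eq_0) simp
    show ?case
      using Suc assms(1)
      by (auto intro!: degree_le simp: coeff_t_mult z derivation_rules(3)[OF assms(1)] split: nat.split)
  qed (use assms(2) in auto)
  then show "degree ((t_mult \<delta> ^^ i) h) \<le> n + i" "coeff ((t_mult \<delta> ^^ i) h) (n + i) = coeff h n" by auto
qed

lemma coeff_t_mult_pow_const:
  assumes "derivation \<delta>"
  shows "coeff ((t_mult \<delta> ^^ Suc i) [:a:]) i = of_nat (Suc i) * \<delta> a"
proof (induction i)
  case 0
  show ?case using assms by (simp add: coeff_t_mult)
next
  case (Suc i)
  have top: "coeff ((t_mult \<delta> ^^ Suc i) [:a:]) (Suc i) = a"
    using coeff_t_mult_pow_top(2)[OF assms, of "[:a:]" 0 "Suc i"] by simp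
  have "coeff ((t_mult \<delta> ^^ Suc (Suc i)) [:a:]) (Suc i) =
      coeff ((t_mult \<delta> ^^ Suc i) [:a:]) i + \<delta> (coeff ((t_mult \<delta> ^^ Suc i) [:a:]) (Suc i))"
    by (subst funpow.simps(2)) (simp add: coeff_t_mult[OF assms] del: funpow.simps)
  then show ?case unfolding Suc.IH top by (simp add: algebra_simps)
qed

lemma degree_diff_mult:
  assumes "derivation \<delta>" "degree g \<le> n" "degree h \<le> k"
  shows "degree (diff_mult \<delta> g h) \<le> n + k" "coeff (diff_mult \<delta> g h) (n + k) = coeff g n * coeff h k"
proof -
  have c: "coeff (diff_mult \<delta> g h) j = (\<Sum>i\<le>n. coeff g i * coeff ((t_mult \<delta> ^^ i) h) j)" for j
  proof -
    have "diff_mult \<delta> g h = (\<Sum>i\<le>n. Polynomial.smult (coeff g i) ((t_mult \<delta> ^^ i) h))"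
      unfolding diff_mult_def using assms(2) by (intro sum.mono_neutral_left) (auto simp: coeff_eq_0)
    then show ?thesis by (simp add: coeff_sum)
  qed
  have z: "coeff ((t_mult \<delta> ^^ i) h) j = 0" if "j > k + i" for i j
    using coeff_t_mult_pow_top(1)[OF assms(1,3), of i] that by (intro coeff_eq_0) simp
  show "degree (diff_mult \<delta> g h) \<le> n + k"
    by (rule degree_le) (auto simp: c z)
  have "coeff (diff_mult \<delta> g h) (n + k) = (\<Sum>i\<in>{n}. coeff g i * coeff ((t_mult \<delta> ^^ i) h) (n + k))"
    unfolding c by (rule sum.mono_neutral_right) (auto simp: z)
  then show "coeff (diff_mult \<delta> g h) (n + k) = coeff g n * coeff h k"
    using coeff_t_mult_pow_top(2)[OF assms(1,3), of n] by (simp add: add.commute)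
qed

text \<open>
  From \<open>t\<^sup>n a = a t\<^sup>n + n \<delta>(a) t\<^sup>n\<^sup>-\<^sup>1 + \<dots>\<close>: the commutator of \<open>g\<close> and \<open>a\<close> loses the leading
  term of \<open>g\<close>, and its next coefficient is \<open>n \<delta>(a)\<close> times the leading coefficient. This is the reason
  why \<open>K[t;\<delta>]\<close> is simple.
\<close>

lemma commutator_with_constant:
  fixes \<delta> :: "'k::field \<Rightarrow> 'k"
  assumes char: "char_zero_field TYPE('k)" and \<delta>: "derivation \<delta>" and a: "\<delta> a \<noteq> 0" and g: "degree g > 0"
  defines "g' \<equiv> diff_mult \<delta> g [:a:] - Polynomial.smult a g"
  shows "g' \<noteq> 0" "degree g' < degree g"
proof -
  obtain n where n: "degree g = Suc n" using g by (cases "degree g") auto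
  have D: "degree (diff_mult \<delta> g [:a:]) \<le> Suc n" "coeff (diff_mult \<delta> g [:a:]) (Suc n) = lead_coeff g * a"
    using degree_diff_mult[OF \<delta>, of g "Suc n" "[:a:]" 0] n by auto
  show "degree g' < degree g"
  proof (rule degree_lessI)
    show "\<forall>k\<ge>degree g. coeff g' k = 0"
    proof (intro allI impI)
      fix k assume "degree g \<le> k"
      then consider "k = Suc n" | "k > Suc n" using n by linarith
      then show "coeff g' k = 0"
        by cases (use D n in \<open>auto simp: g'_def coeff_eq_0\<close>)
    qed
  qed (use g in simp)
  have "coeff (diff_mult \<delta> g [:a:]) n = (\<Sum>i\<le>Suc n. coeff g i * coeff ((t_mult \<delta> ^^ i) [:a:]) n)"
    by (simp add: diff_mult_def coeff_sum n del: funpow.simps)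
  also have "\<dots> = (\<Sum>i\<in>{n, Suc n}. coeff g i * coeff ((t_mult \<delta> ^^ i) [:a:]) n)"
  proof (rule sum.mono_neutral_right)
    show "\<forall>i\<in>{..Suc n} - {n, Suc n}. coeff g i * coeff ((t_mult \<delta> ^^ i) [:a:]) n = 0"
    proof
      fix i assume "i \<in> {..Suc n} - {n, Suc n}"
      then have "degree ((t_mult \<delta> ^^ i) [:a:]) < n"
        using coeff_t_mult_pow_top(1)[OF \<delta>, of "[:a:]" 0 i] by simp
      then show "coeff g i * coeff ((t_mult \<delta> ^^ i) [:a:]) n = 0" by (simp add: coeff_eq_0)
    qed
  qed auto
  also have "\<dots> = coeff g n * a + lead_coeff g * (of_nat (Suc n) * \<delta> a)"
    using coeff_t_mult_pow_top(2)[OF \<delta>, of "[:a:]" 0 n]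
    by (simp add: coeff_t_mult_pow_const[OF \<delta>] n del: funpow.simps of_nat_Suc)
  finally have "coeff g' n = lead_coeff g * (of_nat (Suc n) * \<delta> a)" by (simp add: g'_def)
  moreover have "lead_coeff g \<noteq> 0" using g by auto
  ultimately have "coeff g' n \<noteq> 0" using char a by (metis mult_eq_0_iff)
  then show "g' \<noteq> 0" by auto
qed

section \<open>Cyclic vectors\<close>

context vector_space
begin

lemma finite_basis_in:
  assumes "B \<subseteq> V" "independent B" "V \<subseteq> span N" "finite N"
  shows "\<exists>C. B \<subseteq> C \<and> C \<subseteq> V \<and> independent C \<and> V \<subseteq> span C \<and> finite C \<and> card C = dim V"
proof -
  obtain C where C: "B \<subseteq> C" "C \<subseteq> V" "independent C" "V \<subseteq> span C"
    using maximal_independent_subset_extend[OF assms(1,2)] by blast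
  moreover have "finite C" using independent_span_bound[OF assms(4) C(3)] C(2) assms(3) by blast
  moreover have "card C = dim V" by (rule basis_card_eq_dim) (use C in auto)
  ultimately show ?thesis by blast
qed

lemma dim_strict_mono:
  assumes "subspace S" "S \<subset> T" "T \<subseteq> span N" "finite N"
  shows "dim S < dim T"
proof -
  have "S \<subseteq> span N" using assms by blast
  then obtain B where B: "B \<subseteq> S" "independent B" "S \<subseteq> span B" "card B = dim S" "finite B"
    using finite_basis_in[OF empty_subsetI independent_empty _ assms(4), of S] by blast
  obtain x where x: "x \<in> T" "x \<notin> S" using assms(2) by blast
  have "span B = S" using B(1,3) assms(1) by (simp add: span_subspace)
  then have "independent (insert x B)" using independent_insertI[of x B] x(2) B(2) by simp
  have "x \<notin> B" using x(2) B(1) by blast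
  have "insert x B \<subseteq> T" using x(1) B(1) assms(2) by blast
  then obtain C where "insert x B \<subseteq> C" "card C = dim T" "finite C"
    using finite_basis_in[OF _ \<open>independent (insert x B)\<close> assms(3,4)] by blast
  then show ?thesis using card_mono[of C "insert x B"] \<open>x \<notin> B\<close> B(4,5) by simp
qed

end

context differential_module
begin

definition stable :: "'v set \<Rightarrow> bool" where
  "stable U \<longleftrightarrow> subspace U \<and> U \<subseteq> V \<and> (\<forall>u\<in>U. nabla u \<in> U)"

lemma act_stable: "stable U \<Longrightarrow> u \<in> U \<Longrightarrow> act g u \<in> U"
proof -
  assume U: "stable U" and u: "u \<in> U"
  have "(nabla ^^ i) u \<in> U" for i using U u by (induction i) (auto simp: stable_def)
  then show ?thesis using U unfolding act_def stable_def by (auto intro!: subspace_sum subspace_scale)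
qed

lemma stable_V: "stable V"
  by (simp add: stable_def subspace_V nabla_closed)

text \<open>
  The polynomials \<open>g\<close> with \<open>g (K u) \<subseteq> U\<close> are stable under commutators with elements of \<open>K\<close>. If there
  is a nonzero one, taking commutators lowers its degree until it is a nonzero constant.
\<close>

lemma annihilated_mod_stable:
  assumes char: "char_zero_field TYPE('k)" and a0: "\<delta> a0 \<noteq> 0" and U: "stable U"
    and "g \<noteq> 0" "u \<in> V" "\<And>a. act g (a *v u) \<in> U"
  shows "u \<in> U"
  using assms(4,6)
proof (induction "degree g" arbitrary: g rule: less_induct)
  case less
  have U': "subspace U" using U by (simp add: stable_def)
  have aV: "a *v u \<in> V" for a using assms(5) subspace_V by (rule subspace_scale[rotated])
  show ?case
  proof (cases "degree g = 0")
    case True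
    then obtain c where c: "g = [:c:]" using degree_eq_zeroE by blast
    then have "c *v u \<in> U" using less.prems(2)[of 1] by (simp add: act_const)
    then have "inverse c *v c *v u \<in> U" using U' by (rule subspace_scale[rotated])
    then show ?thesis using less.prems(1) c by simp
  next
    case False
    define g' where "g' = diff_mult \<delta> g [:a0:] - Polynomial.smult a0 g"
    have g': "g' \<noteq> 0" "degree g' < degree g"
      using commutator_with_constant[OF char derivation a0] False by (auto simp: g'_def)
    have "act g' (a *v u) \<in> U" for a
    proof -
      have "act g' (a *v u) = act g ((a0 * a) *v u) - a0 *v act g (a *v u)"
        by (simp add: g'_def act_diff act_diff_mult aV act_const act_smult)
      then show ?thesis using less.prems(2) U' by (simp add: subspace_diff subspace_scale)
    qed
    then show ?thesis using less.hyps[OF g'(2,1)] by blast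
  qed
qed

abbreviation iterates :: "'v \<Rightarrow> nat \<Rightarrow> 'v set" where
  "iterates v n \<equiv> (\<lambda>i. (nabla ^^ i) v) ` {..<n}"

lemma pow_span_iff:
  "x \<in> span (iterates v n) \<longleftrightarrow> (\<exists>g. (\<forall>i\<ge>n. coeff g i = 0) \<and> x = act g v)"
proof
  let ?A = "{x. \<exists>g. (\<forall>i\<ge>n. coeff g i = 0) \<and> x = act g v}"
  assume "x \<in> span (iterates v n)"
  moreover have "span (iterates v n) \<subseteq> ?A"
  proof (rule span_minimal)
    show "iterates v n \<subseteq> ?A"
    proof
      fix y assume "y \<in> iterates v n"
      then obtain i where "i < n" "y = (nabla ^^ i) v" by auto
      then show "y \<in> ?A"
        by (intro CollectI exI[of _ "monom 1 i"]) (auto simp: act_monom)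
    qed
    show "subspace ?A"
    proof (rule subspaceI)
      show "0 \<in> ?A"
        by (intro CollectI exI[of _ 0]) simp
    next
      fix x y assume "x \<in> ?A" "y \<in> ?A"
      then obtain g h where "\<forall>i\<ge>n. coeff g i = 0" "x = act g v" "\<forall>i\<ge>n. coeff h i = 0" "y = act h v" by auto
      then show "x + y \<in> ?A"
        by (intro CollectI exI[of _ "g + h"]) (simp add: act_add)
    next
      fix c x assume "x \<in> ?A"
      then obtain g where "\<forall>i\<ge>n. coeff g i = 0" "x = act g v" by auto
      then show "c *v x \<in> ?A"
        by (intro CollectI exI[of _ "Polynomial.smult c g"]) (simp add: act_smult)
    qed
  qed
  ultimately show "\<exists>g. (\<forall>i\<ge>n. coeff g i = 0) \<and> x = act g v" by blast
next
  assume "\<exists>g. (\<forall>i\<ge>n. coeff g i = 0) \<and> x = act g v"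
  then obtain g where g: "\<forall>i\<ge>n. coeff g i = 0" "x = act g v" by blast
  have "coeff g i *v (nabla ^^ i) v \<in> span (iterates v n)" for i
  proof (cases "i < n")
    case True
    then show ?thesis by (intro span_scale span_base imageI) auto
  next
    case False
    then show ?thesis using g(1) by (simp add: span_zero)
  qed
  then show "x \<in> span (iterates v n)" unfolding g(2) act_def by (intro span_sum)
qed

lemma first_dependency:
  assumes v: "v \<in> V" and N: "finite N" "V \<subseteq> span N"
  obtains n where "(nabla ^^ n) v \<in> span (iterates v n)"
    "\<And>k. k < n \<Longrightarrow> (nabla ^^ k) v \<notin> span (iterates v k)"
    "independent (iterates v n)" "card (iterates v n) = n"
proof -
  let ?P = "\<lambda>n. (nabla ^^ n) v \<in> span (iterates v n)"
  have ind: "independent (iterates v n) \<and> card (iterates v n) = n"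
    if "\<And>k. k < n \<Longrightarrow> \<not> ?P k" for n
    using that
  proof (induction n)
    case (Suc n)
    let ?A = "iterates v n"
    have new: "(nabla ^^ n) v \<notin> span ?A" using Suc.prems[of n] by simp
    then have "(nabla ^^ n) v \<notin> ?A" using span_base by metis
    moreover have IH: "independent ?A" "card ?A = n" using Suc.IH Suc.prems less_Suc_eq by metis+
    moreover have "iterates v (Suc n) = insert ((nabla ^^ n) v) ?A"
      by (simp only: lessThan_Suc image_insert)
    ultimately show ?case
      using independent_insertI[OF new IH(1)] by (simp only: card_insert_disjoint finite_imageI finite_lessThan simp_thms)
  qed (simp add: independent_empty)
  have ex: "\<exists>n. ?P n"
  proof (rule ccontr)
    assume "\<nexists>n. ?P n"
    then have S: "independent (iterates v (Suc (card N)))" "card (iterates v (Suc (card N))) = Suc (card N)"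
      using ind[of "Suc (card N)"] by simp_all
    have "iterates v (Suc (card N)) \<subseteq> span N" using pow_closed[OF v] N(2) by auto
    from independent_span_bound[OF N(1) S(1) this] S(2) show False by simp
  qed
  have P: "?P (LEAST n. ?P n)" by (rule LeastI_ex[OF ex])
  have least: "\<not> ?P k" if "k < (LEAST n. ?P n)" for k by (rule not_less_Least[OF that])
  show ?thesis
    by (rule that[OF P least]) (use ind[OF least] in auto)
qed

lemma annihilator_exists:
  assumes v: "v \<in> V" and N: "finite N" "V \<subseteq> span N"
  shows "\<exists>f. f \<noteq> 0 \<and> act f v = 0"
proof -
  obtain n where "(nabla ^^ n) v \<in> span (iterates v n)"
    using first_dependency[OF assms] by blast
  then obtain g where g: "\<forall>i\<ge>n. coeff g i = 0" "(nabla ^^ n) v = act g v" unfolding pow_span_iff by blast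
  have "coeff (monom 1 n - g) n = 1" using g(1) by simp
  then have "monom 1 n - g \<noteq> 0" by (metis coeff_0 zero_neq_one)
  then show ?thesis using g(2) by (intro exI[of _ "monom 1 n - g"]) (simp add: act_diff act_monom)
qed

text \<open>
  This is \<open>(R v + M) \<inter> U\<close> for the ring \<open>R = K[t;\<delta>]\<close>.
\<close>

lemma stable_reachable:
  assumes U: "stable U" and M: "stable M" and v: "v \<in> V"
  shows "stable {x \<in> U. \<exists>g. x - act g v \<in> M}" (is "stable ?R")
proof -
  have UV: "U \<subseteq> V" "subspace U" "\<And>u. u \<in> U \<Longrightarrow> nabla u \<in> U" using U by (auto simp: stable_def)
  have Ms: "stable M" "subspace M" "M \<subseteq> V" using M by (auto simp: stable_def)
  show ?thesis
    unfolding stable_def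
  proof (intro conjI)
    show "subspace ?R"
    proof (rule subspaceI)
      show "0 \<in> ?R"
        using subspace_0[OF UV(2)] subspace_0[OF Ms(2)] by (auto intro!: exI[of _ 0])
    next
      fix x y assume "x \<in> ?R" "y \<in> ?R"
      then obtain g h where *: "x \<in> U" "y \<in> U" "x - act g v \<in> M" "y - act h v \<in> M" by auto
      have "x + y - act (g + h) v = (x - act g v) + (y - act h v)" by (simp add: act_add)
      then have "x + y - act (g + h) v \<in> M" using * subspace_add[OF Ms(2)] by metis
      then show "x + y \<in> ?R" using * subspace_add[OF UV(2)] by blast
    next
      fix c x assume "x \<in> ?R"
      then obtain g where *: "x \<in> U" "x - act g v \<in> M" by auto
      have "c *v x - act (Polynomial.smult c g) v = c *v (x - act g v)"
        by (simp add: act_smult scale_right_diff_distrib)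
      then have "c *v x - act (Polynomial.smult c g) v \<in> M" using * subspace_scale[OF Ms(2)] by metis
      then show "c *v x \<in> ?R" using * subspace_scale[OF UV(2)] by blast
    qed
    show "?R \<subseteq> V" using UV by auto
    show "\<forall>u\<in>?R. nabla u \<in> ?R"
    proof
      fix x assume "x \<in> ?R"
      then obtain g where *: "x \<in> U" "x - act g v \<in> M" by auto
      have "nabla ((x - act g v) + act g v) = nabla (x - act g v) + nabla (act g v)"
        using * UV(1) Ms(3) act_closed[OF v] by (intro nabla_add) auto
      then have "nabla x - act (t_mult \<delta> g) v = nabla (x - act g v)" by (simp add: act_t_mult[OF v])
      then have "nabla x - act (t_mult \<delta> g) v \<in> M" using *(2) Ms(1) by (simp add: stable_def)
      then show "nabla x \<in> ?R" using * UV(3) by blast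
    qed
  qed
qed

definition generates_mod :: "'v set \<Rightarrow> 'v \<Rightarrow> bool" where
  "generates_mod U v \<longleftrightarrow> v \<in> V \<and> (\<forall>x\<in>V. \<exists>g. x - act g v \<in> U)"

text \<open>
  Write \<open>R = K[t;\<delta>]\<close> and choose a stable subspace \<open>U\<close> of least dimension such that
  \<open>R v + U = V\<close> for some \<open>v\<close>. If \<open>U \<noteq> 0\<close>, let \<open>M\<close> be a maximal stable proper subspace of \<open>U\<close>, let
  \<open>u \<in> U - M\<close> and let \<open>f \<noteq> 0\<close> annihilate \<open>v\<close>. By \<open>annihilated_mod_stable\<close> there is \<open>a\<close> with
  \<open>f (a u) \<notin> M\<close>. Put \<open>v' = v + a u\<close>. Then \<open>f v' = f (a u)\<close>, so \<open>(R v' + M) \<inter> U\<close> is strictly larger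
  than \<open>M\<close>, hence equal to \<open>U\<close>. So \<open>R v' + M\<close> contains \<open>U\<close>, and therefore \<open>V\<close>, against the choice
  of \<open>U\<close>.
\<close>

theorem cyclic_vector:
  assumes char: "char_zero_field TYPE('k)" and a0: "\<delta> a0 \<noteq> 0" and N: "finite N" "V \<subseteq> span N"
  shows "\<exists>w\<in>V. \<forall>x\<in>V. \<exists>g. x = act g w"
proof -
  define \<G> where "\<G> = {U. stable U \<and> (\<exists>v. generates_mod U v)}"
  have "generates_mod V 0"
    using subspace_V by (simp add: generates_mod_def act_zero_right subspace_0)
  then have "V \<in> \<G>" using stable_V by (auto simp: \<G>_def)
  then have "\<exists>U. U \<in> \<G> \<and> (\<forall>U'. U' \<in> \<G> \<longrightarrow> dim U \<le> dim U')" by (rule ex_has_least_nat)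
  then obtain U where U: "stable U" "\<exists>v. generates_mod U v" and min: "\<And>U'. U' \<in> \<G> \<Longrightarrow> dim U \<le> dim U'"
    by (auto simp: \<G>_def)
  have "U = {0}"
  proof (rule ccontr)
    assume "U \<noteq> {0}"
    define \<M> where "\<M> = {M. stable M \<and> M \<subset> U}"
    have dimU: "dim M < dim U" if "M \<in> \<M>" for M
      using that U(1) N by (intro dim_strict_mono[of _ _ N]) (auto simp: \<M>_def stable_def)
    have "{0} \<in> \<M>"
    proof -
      have "nabla 0 = 0" using nabla_add[of 0 0] subspace_0[OF subspace_V] by simp
      then show ?thesis using U(1) \<open>U \<noteq> {0}\<close> subspace_0[OF subspace_V]
        by (auto simp: \<M>_def stable_def dest: subspace_0)
    qed
    then have "\<exists>M. M \<in> \<M> \<and> (\<forall>M'. M' \<in> \<M> \<longrightarrow> dim M' \<le> dim M)"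
      using dimU by (intro ex_has_greatest_nat[of _ _ _ "dim U"]) (auto intro: less_imp_le)
    then obtain M where M: "M \<in> \<M>" and max: "\<And>M'. M' \<in> \<M> \<Longrightarrow> dim M' \<le> dim M" by blast
    have Ms: "stable M" "subspace M" "M \<subset> U" "M \<subseteq> V" using M by (auto simp: \<M>_def stable_def)
    have simple: "X = U" if "stable X" "M \<subset> X" "X \<subseteq> U" for X
    proof (rule ccontr)
      assume "X \<noteq> U"
      then have "X \<in> \<M>" using that by (auto simp: \<M>_def)
      moreover have "dim M < dim X"
        using that N Ms by (intro dim_strict_mono[of _ _ N]) (auto simp: stable_def)
      ultimately show False using max by fastforce
    qed
    have good: "M \<in> \<G>" if v: "v \<in> V" and gen: "\<And>x. x \<in> V \<Longrightarrow> \<exists>g. \<exists>y\<in>U. x = act g v + y"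
      and big: "y \<in> U" "y - act h v \<in> M" "y \<notin> M" for v y h
    proof -
      let ?R = "{x \<in> U. \<exists>g. x - act g v \<in> M}"
      have "?R = U"
      proof (rule simple[OF stable_reachable[OF U(1) Ms(1) v]])
        have "M \<subseteq> ?R" using Ms(3) by (auto intro!: exI[of _ 0])
        then show "M \<subset> ?R" using big by blast
      qed auto
      then have U_sub: "\<exists>g. x - act g v \<in> M" if "x \<in> U" for x using that by blast
      have "\<exists>g. x - act g v \<in> M" if xV: "x \<in> V" for x
      proof -
        obtain g y where "y \<in> U" "x = act g v + y" using gen[OF xV] by blast
        moreover obtain h where "y - act h v \<in> M" using U_sub \<open>y \<in> U\<close> by blast
        ultimately have "x - act (g + h) v \<in> M" by (simp add: act_add)
        then show ?thesis by blast
      qed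
      then show ?thesis using v Ms(1) by (auto simp: \<G>_def generates_mod_def)
    qed
    obtain v where v: "v \<in> V" "\<And>x. x \<in> V \<Longrightarrow> \<exists>g. x - act g v \<in> U"
      using U(2) by (auto simp: generates_mod_def)
    have gen: "\<exists>g. \<exists>y\<in>U. x = act g v + y" if "x \<in> V" for x
      using v(2)[OF that] by (metis add_diff_cancel_left' diff_add_cancel add.commute)
    have UV: "U \<subseteq> V" "subspace U" using U(1) by (auto simp: stable_def)
    obtain u where u: "u \<in> U" "u \<notin> M" using Ms(3) by blast
    obtain f where f: "f \<noteq> 0" "act f v = 0" using annihilator_exists[OF v(1) N] by blast
    obtain a where a: "act f (a *v u) \<notin> M"
      using annihilated_mod_stable[OF char a0 Ms(1) f(1), of u] u UV by blast
    have au: "a *v u \<in> U" "a *v u \<in> V" using u(1) UV subspace_scale[OF UV(2)] by auto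
    define v' where "v' = v + a *v u"
    have v': "v' \<in> V" using v(1) au(2) subspace_V by (simp add: v'_def subspace_add)
    have fv': "act f v' = act f (a *v u)" by (simp add: v'_def act_add_right[OF v(1) au(2)] f(2))
    have "M \<in> \<G>"
    proof (rule good[OF v'])
      show "act f (a *v u) \<in> U" using act_stable[OF U(1) au(1)] .
      show "act f (a *v u) - act f v' \<in> M" using fv' subspace_0[OF Ms(2)] by simp
      show "act f (a *v u) \<notin> M" by (rule a)
      fix x assume "x \<in> V"
      then obtain g y where g: "y \<in> U" "x = act g v + y" using gen by blast
      have "act g v' = act g v + act g (a *v u)" by (simp add: v'_def act_add_right[OF v(1) au(2)])
      then have "x = act g v' + (y - act g (a *v u))" using g(2) by simp
      moreover have "y - act g (a *v u) \<in> U" using g(1) act_stable[OF U(1) au(1)] UV(2) by (simp add: subspace_diff)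
      ultimately show "\<exists>g. \<exists>y\<in>U. x = act g v' + y" by blast
    qed
    then show False using min dimU[OF M] by fastforce
  qed
  then show ?thesis using U(2) by (auto simp: generates_mod_def)
qed

text \<open>
  The first iterate \<open>nabla\<^sup>n w\<close> that depends on the earlier ones gives both the annihilator and the
  basis \<open>w, nabla w, \<dots>\<close>, so that \<open>n\<close> is the dimension of \<open>V\<close>.
\<close>

lemma cyclic_presentation:
  assumes w: "w \<in> V" "\<And>x. x \<in> V \<Longrightarrow> \<exists>g. x = act g w" and N: "finite N" "V \<subseteq> span N"
    and m: "dim V = m" "m > 0"
  shows "\<exists>f. degree f = m \<and> lead_coeff f = 1 \<and> act f w = 0"
    and "bij_betw (\<lambda>g. act g w) {g. degree g < m} V"
proof -
  obtain n where n: "(nabla ^^ n) w \<in> span (iterates w n)"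
    "\<And>k. k < n \<Longrightarrow> (nabla ^^ k) w \<notin> span (iterates w k)"
    "independent (iterates w n)" "card (iterates w n) = n"
    using first_dependency[OF w(1) N] by blast
  let ?S = "span (iterates w n)"
  have pow: "(nabla ^^ i) w \<in> ?S" for i
  proof (induction i)
    case 0
    show ?case
    proof (cases "n = 0")
      case True
      then show ?thesis using n(1) by simp
    next
      case False
      then show ?thesis by (intro span_base imageI) simp
    qed
  next
    case (Suc i)
    then obtain g where g: "\<forall>i\<ge>n. coeff g i = 0" "(nabla ^^ i) w = act g w" unfolding pow_span_iff by blast
    have eq: "(nabla ^^ Suc i) w = act (t_mult \<delta> g) w" using g(2) act_t_mult[OF w(1)] by simp
    have z: "coeff (t_mult \<delta> g) j = 0" if "j > n" for j
      using that g(1) by (auto simp: coeff_t_mult[OF derivation] derivation_rules(3)[OF derivation] split: nat.split)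
    have "coeff (t_mult \<delta> g) j *v (nabla ^^ j) w \<in> ?S" if "j \<le> n" for j
    proof (cases "j = n")
      case True
      then show ?thesis using n(1) by (simp add: span_scale)
    next
      case False
      then show ?thesis using that by (intro span_scale span_base imageI) simp
    qed
    then have "(\<Sum>j\<le>n. coeff (t_mult \<delta> g) j *v (nabla ^^ j) w) \<in> ?S"
      by (intro span_sum) simp
    then show ?case
      unfolding eq using act_upto[of n "t_mult \<delta> g" w, OF z] by simp
  qed
  have VS: "V \<subseteq> ?S"
  proof
    fix x assume "x \<in> V"
    then obtain g where "x = act g w" using w(2) by blast
    then show "x \<in> ?S" unfolding act_def using pow by (auto intro!: span_sum span_scale)
  qed
  have "card (iterates w n) = dim V"
    using pow_closed[OF w(1)] VS n(3) by (intro basis_card_eq_dim) auto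
  then have nm: "n = m" using n(4) m(1) by simp
  obtain g where g: "\<forall>i\<ge>m. coeff g i = 0" "(nabla ^^ m) w = act g w"
    using n(1) unfolding nm pow_span_iff by blast
  have "degree (monom 1 m - g) = m"
    by (rule antisym[OF degree_le le_degree]) (use g(1) in auto)
  then show "\<exists>f. degree f = m \<and> lead_coeff f = 1 \<and> act f w = 0"
    using g by (intro exI[of _ "monom 1 m - g"]) (simp add: act_diff act_monom)
  have inj0: "g = 0" if "degree g < m" "act g w = 0" for g
  proof (rule ccontr)
    assume "g \<noteq> 0"
    define d c where "d = degree g" and "c = lead_coeff g"
    have c: "c \<noteq> 0" using \<open>g \<noteq> 0\<close> by (simp add: c_def)
    define h where "h = Polynomial.smult (- inverse c) (g - monom c d)"
    have "(nabla ^^ d) w = act h w"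
      using that(2) c act_smult[of c "monom 1 d" w] by (simp add: h_def act_smult act_diff act_minus smult_monom act_monom)
    moreover have "\<forall>i\<ge>d. coeff h i = 0"
      by (auto simp: h_def d_def c_def coeff_eq_0 le_less)
    ultimately have "(nabla ^^ d) w \<in> span (iterates w d)" unfolding pow_span_iff by blast
    then show False using n(2)[of d] that(1) nm by (simp add: d_def)
  qed
  show "bij_betw (\<lambda>g. act g w) {g. degree g < m} V"
    unfolding bij_betw_def
  proof
    show "inj_on (\<lambda>g. act g w) {g. degree g < m}"
    proof (rule inj_onI)
      fix g h assume "g \<in> {g. degree g < m}" "h \<in> {g. degree g < m}" "act g w = act h w"
      then have "g - h = 0" by (intro inj0) (auto simp: act_diff intro: degree_diff_less)
      then show "g = h" by simp
    qed
    have "x \<in> (\<lambda>g. act g w) ` {g. degree g < m}" if xV: "x \<in> V" for x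
    proof -
      have "x \<in> span (iterates w m)" using VS xV nm by blast
      then obtain g where g: "\<forall>i\<ge>m. coeff g i = 0" "x = act g w" unfolding pow_span_iff by blast
      have "degree g < m" by (rule degree_lessI) (use g(1) m(2) in auto)
      then show ?thesis using g(2) by blast
    qed
    then show "(\<lambda>g. act g w) ` {g. degree g < m} = V" using act_closed[OF w(1)] by auto
  qed
qed

end

section \<open>Petit algebras of cyclic differential modules\<close>

lemma diff_mult_eq_act:
  "derivation \<delta> \<Longrightarrow> diff_mult \<delta> g h = differential_module.act Polynomial.smult (t_mult \<delta>) g h"
  by (simp add: diff_mult_def differential_module.act_def[OF differential_module_poly])

lemma diff_mult_add_left: "derivation \<delta> \<Longrightarrow> diff_mult \<delta> (g + h) k = diff_mult \<delta> g k + diff_mult \<delta> h k"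
  by (simp add: diff_mult_eq_act differential_module.act_add[OF differential_module_poly])

context differential_module
begin

lemma right_division:
  assumes f: "degree f = m" "lead_coeff f = 1" and m: "m > 0"
  shows "\<exists>q r. degree r < m \<and> g = diff_mult \<delta> q f + r"
proof (induction "degree g" arbitrary: g rule: less_induct)
  case less
  show ?case
  proof (cases "degree g < m")
    case True
    then show ?thesis by (intro exI[of _ 0] exI[of _ g]) (simp add: diff_mult_def)
  next
    case False
    define q where "q = monom (lead_coeff g) (degree g - m)"
    have q: "degree q \<le> degree g - m" "coeff q (degree g - m) = lead_coeff g"
      by (auto simp: q_def degree_monom_le)
    have D: "degree (diff_mult \<delta> q f) \<le> degree g" "coeff (diff_mult \<delta> q f) (degree g) = lead_coeff g"
      using degree_diff_mult[OF derivation q(1), of f m] f q(2) False by auto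
    have "degree (g - diff_mult \<delta> q f) < degree g"
    proof (rule degree_lessI)
      show "\<forall>k\<ge>degree g. coeff (g - diff_mult \<delta> q f) k = 0"
        using D by (auto simp: le_less coeff_eq_0)
    qed (use m False in auto)
    from less[OF this] obtain q' r where "degree r < m" "g - diff_mult \<delta> q f = diff_mult \<delta> q' f + r"
      by blast
    then have "degree r < m \<and> g = diff_mult \<delta> (q + q') f + r"
      by (simp add: diff_mult_add_left[OF derivation] algebra_simps)
    then show ?thesis by blast
  qed
qed

end

text \<open>
  A cyclic module \<open>V = R w \<cong> R / R f\<close> for \<open>R = K[t;\<delta>]\<close>. The map \<open>g \<mapsto> g w\<close> identifies the
  carrier of \<open>S\<^sub>f\<close> with \<open>V\<close>, and computations in \<open>S\<^sub>f\<close> are carried out in \<open>V\<close>.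
\<close>

locale petit_presentation = differential_module scale \<delta> V nabla
  for scale :: "'k::field \<Rightarrow> 'v::ab_group_add \<Rightarrow> 'v" (infixr \<open>*v\<close> 75)
    and \<delta> :: "'k \<Rightarrow> 'k" and V :: "'v set" and nabla :: "'v \<Rightarrow> 'v" +
  fixes w :: 'v and f :: "'k poly" and m :: nat and \<iota> :: "'f::field \<Rightarrow> 'k"
  assumes char: "char_zero_field TYPE('k)" and nontrivial: "\<exists>a. \<delta> a \<noteq> 0"
    and w: "w \<in> V" and degree_f: "degree f = m" and monic_f: "lead_coeff f = 1"
    and act_f: "act f w = 0"
    and bij: "bij_betw (\<lambda>g. act g w) {g. degree g < m} V" and m: "m \<ge> 2"
begin

abbreviation S where "S \<equiv> petit_algebra \<iota> \<delta> f"

lemma eval_inj: "degree g < m \<Longrightarrow> degree h < m \<Longrightarrow> act g w = act h w \<Longrightarrow> g = h"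
  using bij by (auto simp: bij_betw_def inj_on_def)

lemma eval_surj: "v \<in> V \<Longrightarrow> \<exists>g. degree g < m \<and> act g w = v"
  using bij by (auto simp: bij_betw_def)

lemma mod_right_eqI:
  assumes "degree r < m" "g = diff_mult \<delta> q f + r"
  shows "mod_right \<delta> g f = r"
  unfolding mod_right_def
proof (rule the_equality)
  show "degree r < degree f \<and> (\<exists>q. g = diff_mult \<delta> q f + r)" using assms degree_f by blast
  fix r' assume "degree r' < degree f \<and> (\<exists>q. g = diff_mult \<delta> q f + r')"
  then obtain q' where r': "degree r' < m" "diff_mult \<delta> q f + r = diff_mult \<delta> q' f + r'"
    using degree_f assms(2) by auto
  have "act (diff_mult \<delta> q f + r) w = act (diff_mult \<delta> q' f + r') w" using r'(2) by simp
  then have "act r w = act r' w" by (simp add: act_add act_diff_mult w act_f act_zero_right)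
  then show "r' = r" using eval_inj assms(1) r'(1) by metis
qed

lemma mod_right_exists:
  obtains q where "degree (mod_right \<delta> g f) < m" "g = diff_mult \<delta> q f + mod_right \<delta> g f"
proof -
  obtain q r where "degree r < m" "g = diff_mult \<delta> q f + r"
    using right_division[OF degree_f monic_f, of g] m by auto
  then show ?thesis using that mod_right_eqI by metis
qed

lemma carrier_S: "x \<in> carrier S \<longleftrightarrow> degree x < m"
  by (simp add: petit_algebra_def degree_f)

lemma mult_S: "x \<otimes>\<^bsub>S\<^esub> y = mod_right \<delta> (diff_mult \<delta> x y) f"
  by (simp add: petit_algebra_def)

lemma mult_closed_S: "degree (x \<otimes>\<^bsub>S\<^esub> y) < m"
  by (metis mult_S mod_right_exists)

lemma eval_mult_S: "act (x \<otimes>\<^bsub>S\<^esub> y) w = act x (act y w)"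
proof -
  obtain q where "diff_mult \<delta> x y = diff_mult \<delta> q f + x \<otimes>\<^bsub>S\<^esub> y"
    unfolding mult_S by (rule mod_right_exists)
  then have "act (diff_mult \<delta> x y) w = act (diff_mult \<delta> q f + x \<otimes>\<^bsub>S\<^esub> y) w" by simp
  then show ?thesis by (simp add: act_add act_diff_mult w act_f act_zero_right)
qed

lemma minus_S: "degree y < m \<Longrightarrow> x \<ominus>\<^bsub>S\<^esub> y = x - y"
proof -
  assume y: "degree y < m"
  have "\<ominus>\<^bsub>S\<^esub> y = - y"
    unfolding a_inv_def m_inv_def
    by (rule the_equality) (use y in \<open>auto simp: petit_algebra_def degree_f eq_neg_iff_add_eq_0 add.commute\<close>)
  then show ?thesis by (simp add: a_minus_def petit_algebra_def)
qed

lemma zero_S: "\<zero>\<^bsub>S\<^esub> = 0"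
  by (simp add: petit_algebra_def)

lemma associator_S: "associator S x y z = (x \<otimes>\<^bsub>S\<^esub> y) \<otimes>\<^bsub>S\<^esub> z - x \<otimes>\<^bsub>S\<^esub> (y \<otimes>\<^bsub>S\<^esub> z)"
  by (simp add: associator_def minus_S mult_closed_S)

text \<open>
  The two products \<open>(x y) z\<close> and \<open>x (y z)\<close> in \<open>S\<^sub>f\<close> correspond to \<open>r (z w)\<close> and to
  \<open>x (y (z w)) = (q f + r) (z w)\<close>.
\<close>

lemma associator_eq_0_iff:
  assumes "diff_mult \<delta> x y = diff_mult \<delta> q f + r" "degree r < m"
  shows "associator S x y z = \<zero>\<^bsub>S\<^esub> \<longleftrightarrow> act q (act f (act z w)) = 0"
proof -
  have z: "act z w \<in> V" by (rule act_closed[OF w])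
  have r: "x \<otimes>\<^bsub>S\<^esub> y = r" unfolding mult_S by (rule mod_right_eqI[OF assms(2,1)])
  have "act ((x \<otimes>\<^bsub>S\<^esub> y) \<otimes>\<^bsub>S\<^esub> z) w = act r (act z w)" by (simp add: eval_mult_S r)
  moreover have "act (x \<otimes>\<^bsub>S\<^esub> (y \<otimes>\<^bsub>S\<^esub> z)) w = act q (act f (act z w)) + act r (act z w)"
    using arg_cong[OF assms(1), of "\<lambda>g. act g (act z w)"] z by (simp add: eval_mult_S act_add act_diff_mult)
  moreover have "associator S x y z = \<zero>\<^bsub>S\<^esub> \<longleftrightarrow> act ((x \<otimes>\<^bsub>S\<^esub> y) \<otimes>\<^bsub>S\<^esub> z) w = act (x \<otimes>\<^bsub>S\<^esub> (y \<otimes>\<^bsub>S\<^esub> z)) w"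
    unfolding associator_S zero_S using eval_inj mult_closed_S by (metis right_minus_eq)
  ultimately show ?thesis by auto
qed

lemma associator_constant:
  assumes "degree x + degree y < m"
  shows "associator S x y z = \<zero>\<^bsub>S\<^esub>"
  using degree_diff_mult(1)[OF derivation order_refl order_refl, of x y] assms
  by (subst associator_eq_0_iff[of _ _ 0 "diff_mult \<delta> x y"]) (auto simp: diff_mult_def)

text \<open>
  In this case the quotient of \<open>x y\<close> by \<open>f\<close> is a nonzero constant.
\<close>

lemma associator_critical:
  assumes "degree x + degree y = m" "x \<noteq> 0" "y \<noteq> 0"
  shows "associator S x y z = \<zero>\<^bsub>S\<^esub> \<longleftrightarrow> act f (act z w) = 0"
proof -
  define c where "c = lead_coeff x * lead_coeff y"
  have c: "c \<noteq> 0" using assms(2,3) by (simp add: c_def)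
  have D: "degree (diff_mult \<delta> x y) \<le> m" "coeff (diff_mult \<delta> x y) m = c"
    using degree_diff_mult[OF derivation order_refl order_refl, of x y] assms(1) by (auto simp: c_def)
  have cf: "diff_mult \<delta> [:c:] f = Polynomial.smult c f" by (simp add: diff_mult_def)
  define r where "r = diff_mult \<delta> x y - Polynomial.smult c f"
  have "degree r < m"
  proof (rule degree_lessI)
    show "\<forall>k\<ge>m. coeff r k = 0"
      using D degree_f monic_f by (auto simp: r_def le_less coeff_eq_0)
  qed (use m in auto)
  moreover have "diff_mult \<delta> x y = diff_mult \<delta> [:c:] f + r" by (simp add: cf r_def)
  ultimately have "associator S x y z = \<zero>\<^bsub>S\<^esub> \<longleftrightarrow> act [:c:] (act f (act z w)) = 0"
    by (intro associator_eq_0_iff)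
  then show ?thesis using c by (simp add: act_const)
qed

text \<open>
  Otherwise \<open>f\<close> annihilates \<open>V\<close>, which \<open>annihilated_mod_stable\<close> excludes for \<open>U = 0\<close>. In other
  words, \<open>S\<^sub>f\<close> is not associative.
\<close>

lemma f_acts_nontrivially: "\<exists>z. degree z < m \<and> act f (act z w) \<noteq> 0"
proof (rule ccontr)
  assume contra: "\<nexists>z. degree z < m \<and> act f (act z w) \<noteq> 0"
  have all: "act f v = 0" if "v \<in> V" for v using eval_surj[OF that] contra by auto
  obtain a0 where a0: "\<delta> a0 \<noteq> 0" using nontrivial by blast
  have "nabla 0 = 0" using nabla_add[of 0 0] subspace_0[OF subspace_V] by simp
  then have "stable {0}" using subspace_0[OF subspace_V] by (simp add: stable_def)
  moreover have "f \<noteq> 0" using monic_f by auto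
  ultimately have "w \<in> {0}"
    using annihilated_mod_stable[OF char a0, of "{0}" f w] w all subspace_scale[OF subspace_V w] by blast
  then have "act 1 w = act 0 w" by (simp add: act_zero_right)
  then have "(1 :: 'k poly) = 0" using m by (intro eval_inj) auto
  then show False by simp
qed

text \<open>
  The product of \<open>t\<close> and \<open>t\<^sup>m\<^sup>-\<^sup>1\<close> has quotient \<open>1\<close> by \<open>f\<close>, which gives one inclusion.
\<close>

lemma nuc_right_S: "nuc_right S = {z. degree z < m \<and> act f (act z w) = 0}"
proof (intro equalityI subsetI)
  fix z assume z: "z \<in> nuc_right S"
  have dx: "degree (monom 1 1 :: 'k poly) = 1" "degree (monom 1 (m - 1) :: 'k poly) = m - 1"
    by (simp_all add: degree_monom_eq)
  have "associator S (monom 1 1) (monom 1 (m - 1)) z = \<zero>\<^bsub>S\<^esub>"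
    using z m dx by (auto simp: nuc_right_def carrier_S)
  then have "act f (act z w) = 0"
    using m dx by (subst (asm) associator_critical) auto
  then show "z \<in> {z. degree z < m \<and> act f (act z w) = 0}" using z by (simp add: nuc_right_def carrier_S)
next
  fix z assume z: "z \<in> {z. degree z < m \<and> act f (act z w) = 0}"
  have "associator S x y z = \<zero>\<^bsub>S\<^esub>" for x y
  proof -
    obtain q where "degree (mod_right \<delta> (diff_mult \<delta> x y) f) < m"
      "diff_mult \<delta> x y = diff_mult \<delta> q f + mod_right \<delta> (diff_mult \<delta> x y) f"
      by (rule mod_right_exists)
    then show ?thesis using associator_eq_0_iff z by (simp add: act_zero_right)
  qed
  then show "z \<in> nuc_right S" using z by (simp add: nuc_right_def carrier_S)
qed

lemma constants_set: "range (\<lambda>a. [:a:]) = {x :: 'k poly. degree x = 0}"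
  by (auto elim: degree_eq_zeroE)

text \<open>
  An element of positive degree \<open>d\<close> multiplies with \<open>t\<^sup>m\<^sup>-\<^sup>d\<close>, on either side, to a polynomial of
  degree \<open>m\<close>, and \<open>f\<close> acts nontrivially.
\<close>

lemma constant_if_associates:
  assumes "degree x < m"
    and "\<And>y z. degree y < m \<Longrightarrow> degree z < m \<Longrightarrow> associator S x y z = \<zero>\<^bsub>S\<^esub> \<or> associator S y x z = \<zero>\<^bsub>S\<^esub>"
  shows "degree x = 0"
proof (rule ccontr)
  assume d: "degree x \<noteq> 0"
  obtain z where z: "degree z < m" "act f (act z w) \<noteq> 0" using f_acts_nontrivially by blast
  define y where "y = (monom 1 (m - degree x) :: 'k poly)"
  have y: "degree y = m - degree x" "y \<noteq> 0" by (simp_all add: y_def degree_monom_eq)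
  have "x \<noteq> 0" using d by auto
  then have "\<not> (associator S x y z = \<zero>\<^bsub>S\<^esub> \<or> associator S y x z = \<zero>\<^bsub>S\<^esub>)"
    using associator_critical[of x y z] associator_critical[of y x z] y assms(1) z(2) by simp
  then show False using assms(2)[of y z] y(1) z(1) d assms(1) by simp
qed

lemma nuc_left_S: "nuc_left S = range (\<lambda>a. [:a:])"
  and nuc_middle_S: "nuc_middle S = range (\<lambda>a. [:a:])"
  unfolding constants_set nuc_left_def nuc_middle_def carrier_S
  using m by (auto simp: carrier_S associator_constant intro: constant_if_associates)

lemma automorphism_add:
  "algebra_iso S S H \<Longrightarrow> degree x < m \<Longrightarrow> degree y < m \<Longrightarrow> H (x + y) = H x + H y"
  by (auto simp: algebra_iso_def petit_algebra_def degree_f)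

lemma automorphism_preserves_associator:
  assumes H: "algebra_iso S S H" and "x \<in> carrier S" "y \<in> carrier S" "z \<in> carrier S"
  shows "associator S (H x) (H y) (H z) = H (associator S x y z)"
proof -
  note add = automorphism_add[OF H]
  have mult: "H (x \<otimes>\<^bsub>S\<^esub> y) = H x \<otimes>\<^bsub>S\<^esub> H y" if "degree x < m" "degree y < m" for x y
    using H that carrier_S unfolding algebra_iso_def by blast
  have sub: "H (x - y) = H x - H y" if "degree x < m" "degree y < m" for x y
    using add[of "x - y" y] that by (simp add: degree_diff_less)
  show ?thesis
    unfolding associator_S using assms(2-4) by (simp add: carrier_S sub mult mult_closed_S)
qed

lemma automorphism_image_nuc_right:
  assumes H: "algebra_iso S S H"
  shows "H ` nuc_right S = nuc_right S"
proof -
  have bijH: "bij_betw H (carrier S) (carrier S)" using H by (simp add: algebra_iso_def)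
  then have Hc: "H x \<in> carrier S" if "x \<in> carrier S" for x using that by (auto simp: bij_betw_def)
  have "H (0 + 0) = H 0 + H 0" using m by (intro automorphism_add[OF H]) auto
  then have H0: "H 0 = 0" by (simp only: add_0_right add_cancel_right_right)
  have zero: "H x = 0 \<longleftrightarrow> x = 0" if "x \<in> carrier S" for x
    using bijH that H0 m unfolding bij_betw_def inj_on_def by (metis carrier_S degree_0 gr0I not_numeral_le_zero)
  have assoc_carrier: "associator S x y z \<in> carrier S" for x y z
    unfolding associator_S carrier_S by (simp add: degree_diff_less mult_closed_S)
  have onto: "\<exists>x'\<in>carrier S. x = H x'" if "x \<in> carrier S" for x
    using bijH that unfolding bij_betw_def by blast
  have "H z \<in> nuc_right S \<longleftrightarrow> z \<in> nuc_right S" if z: "z \<in> carrier S" for z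
  proof
    assume "H z \<in> nuc_right S"
    then have "associator S x y z = \<zero>\<^bsub>S\<^esub>" if "x \<in> carrier S" "y \<in> carrier S" for x y
      using automorphism_preserves_associator[OF H that z] zero[OF assoc_carrier] Hc that
      by (auto simp: nuc_right_def zero_S)
    then show "z \<in> nuc_right S" using z by (simp add: nuc_right_def)
  next
    assume zn: "z \<in> nuc_right S"
    have "associator S x y (H z) = \<zero>\<^bsub>S\<^esub>" if xy: "x \<in> carrier S" "y \<in> carrier S" for x y
    proof -
      obtain x' y' where "x' \<in> carrier S" "x = H x'" "y' \<in> carrier S" "y = H y'" using onto xy by metis
      then show ?thesis using automorphism_preserves_associator[OF H _ _ z, of x' y'] zn H0
        by (auto simp: nuc_right_def zero_S)
    qed
    then show "H z \<in> nuc_right S" using Hc[OF z] by (simp add: nuc_right_def)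
  qed
  moreover have "nuc_right S \<subseteq> carrier S" by (auto simp: nuc_right_def)
  ultimately show ?thesis using onto by blast
qed

end

section \<open>Connections and automorphisms of a split algebra\<close>

text \<open>
  An \<open>F\<close>-algebra \<open>B\<close> with basis \<open>E\<close> that acts from the right on the \<open>K\<close>-space \<open>V\<close> in such a way that
  \<open>B \<otimes> K\<close> becomes the algebra of all \<open>K\<close>-linear operators on \<open>V\<close>: the operators \<open>\<rho> e\<close> for
  \<open>e \<in> E\<close> form a \<open>K\<close>-basis of it.
\<close>

locale split_algebra =
  K: vector_space scale + B: vector_space s + \<iota>: field_hom \<iota>
  for scale :: "'k::field \<Rightarrow> 'v::ab_group_add \<Rightarrow> 'v" (infixr \<open>*v\<close> 75)
    and s :: "'f::field \<Rightarrow> 'b::ring_1 \<Rightarrow> 'b" and \<iota> :: "'f \<Rightarrow> 'k" +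
  fixes V :: "'v set" and E :: "'b set" and \<rho> :: "'b \<Rightarrow> 'v \<Rightarrow> 'v"
  assumes s_mult: "s c (x * y) = s c x * y" "s c (x * y) = x * s c y"
    and V: "K.subspace V" and V_nonzero: "V \<noteq> {0}"
    and E: "finite E" "B.independent E" "B.span E = UNIV"
    and \<rho>_closed: "v \<in> V \<Longrightarrow> \<rho> x v \<in> V"
    and \<rho>_add_right: "u \<in> V \<Longrightarrow> v \<in> V \<Longrightarrow> \<rho> x (u + v) = \<rho> x u + \<rho> x v"
    and \<rho>_scale_right: "v \<in> V \<Longrightarrow> \<rho> x (a *v v) = a *v \<rho> x v"
    and \<rho>_add: "v \<in> V \<Longrightarrow> \<rho> (x + y) v = \<rho> x v + \<rho> y v"
    and \<rho>_scale: "v \<in> V \<Longrightarrow> \<rho> (s c x) v = \<iota> c *v \<rho> x v"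
    and \<rho>_mult: "v \<in> V \<Longrightarrow> \<rho> (x * y) v = \<rho> y (\<rho> x v)"
    and \<rho>_one: "v \<in> V \<Longrightarrow> \<rho> 1 v = v"
    and \<rho>_full: "(\<And>v. v \<in> V \<Longrightarrow> T v \<in> V) \<Longrightarrow> (\<And>u v. u \<in> V \<Longrightarrow> v \<in> V \<Longrightarrow> T (u + v) = T u + T v) \<Longrightarrow>
      (\<And>a v. v \<in> V \<Longrightarrow> T (a *v v) = a *v T v) \<Longrightarrow> \<exists>k. \<forall>v\<in>V. T v = (\<Sum>e\<in>E. k e *v \<rho> e v)"
    and \<rho>_independent: "(\<And>v. v \<in> V \<Longrightarrow> (\<Sum>e\<in>E. k e *v \<rho> e v) = 0) \<Longrightarrow> e \<in> E \<Longrightarrow> k e = 0"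
begin

definition coord :: "'b \<Rightarrow> 'b \<Rightarrow> 'f" where "coord x e = B.representation E x e"

lemma coord_sum: "(\<Sum>e\<in>E. s (coord x e) e) = x"
  unfolding coord_def by (rule B.sum_representation_eq) (use E in auto)

lemma coord_add: "coord (x + y) e = coord x e + coord y e"
  and coord_scale: "coord (s c x) e = c * coord x e"
  using E by (simp_all add: coord_def B.representation_add B.representation_scale)

lemma coord_zero: "coord 0 e = 0"
  using coord_scale[of 0 0 e] by simp

lemma coord_eq_0: "(\<And>e. e \<in> E \<Longrightarrow> coord x e = 0) \<Longrightarrow> x = 0"
  using coord_sum[of x] by simp

lemma coord_setsum: "coord (\<Sum>i\<in>I. g i) e = (\<Sum>i\<in>I. coord (g i) e)"
  by (induction I rule: infinite_finite_induct) (auto simp: coord_add coord_zero)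

lemma coord_basis: "e \<in> E \<Longrightarrow> coord e e' = (if e' = e then 1 else 0)"
  using E by (simp add: coord_def B.representation_basis)

lemma coord_combination: "e' \<in> E \<Longrightarrow> coord (\<Sum>e\<in>E. s (r e) e) e' = r e'"
proof -
  assume e': "e' \<in> E"
  have "(\<Sum>e\<in>E. coord (s (r e) e) e') = (\<Sum>e\<in>E. if e = e' then r e else 0)"
    by (rule sum.cong) (use E in \<open>auto simp: coord_scale coord_basis\<close>)
  then show ?thesis using e' E(1) by (simp add: coord_setsum)
qed

lemma \<rho>_zero: "v \<in> V \<Longrightarrow> \<rho> 0 v = 0"
  using \<rho>_scale[of v 0 0] by simp

lemma \<rho>_diff: "v \<in> V \<Longrightarrow> \<rho> (x - y) v = \<rho> x v - \<rho> y v"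
  using \<rho>_add[of v "x - y" y] by simp

lemma \<rho>_setsum: "v \<in> V \<Longrightarrow> \<rho> (\<Sum>i\<in>I. g i) v = (\<Sum>i\<in>I. \<rho> (g i) v)"
  by (induction I rule: infinite_finite_induct) (auto simp: \<rho>_add \<rho>_zero)

lemma scale_closed: "v \<in> V \<Longrightarrow> a *v v \<in> V"
  using V by (rule K.subspace_scale)

lemma zero_closed: "0 \<in> V"
  using V by (rule K.subspace_0)

lemma sum_closed: "(\<And>i. i \<in> I \<Longrightarrow> g i \<in> V) \<Longrightarrow> sum g I \<in> V"
  using V by (rule K.subspace_sum)

lemma \<rho>_zero_right: "\<rho> x 0 = 0"
  using \<rho>_scale_right[OF zero_closed, of x 0] by simp

lemma \<rho>_setsum_right: "(\<And>i. i \<in> I \<Longrightarrow> g i \<in> V) \<Longrightarrow> \<rho> x (\<Sum>i\<in>I. g i) = (\<Sum>i\<in>I. \<rho> x (g i))"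
  by (induction I rule: infinite_finite_induct) (auto simp: \<rho>_zero_right \<rho>_add_right sum_closed)

lemma \<rho>_expand: "v \<in> V \<Longrightarrow> \<rho> x v = (\<Sum>e\<in>E. \<iota> (coord x e) *v \<rho> e v)"
  using \<rho>_setsum[of v "\<lambda>e. s (coord x e) e" E] by (simp add: coord_sum \<rho>_scale)

lemma faithful: "(\<And>v. v \<in> V \<Longrightarrow> \<rho> x v = 0) \<Longrightarrow> x = 0"
proof -
  assume z: "\<And>v. v \<in> V \<Longrightarrow> \<rho> x v = 0"
  have "\<iota> (coord x e) = 0" if "e \<in> E" for e
    by (rule \<rho>_independent[of "\<lambda>e. \<iota> (coord x e)", OF _ that]) (simp only: \<rho>_expand[symmetric] z)
  then show "x = 0" using coord_eq_0 by simp
qed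

text \<open>
  Linear relations over \<open>K\<close> between elements of \<open>B\<close>, expressed in \<open>F\<close>-coordinates. Relations can
  therefore be transported along \<open>F\<close>-linear maps, on the side of \<open>B\<close> and on the side of \<open>K\<close>.
\<close>

lemma relation_iff:
  assumes "finite I"
  shows "(\<forall>v\<in>V. (\<Sum>i\<in>I. k i *v \<rho> (x i) v) = 0) \<longleftrightarrow> (\<forall>e\<in>E. (\<Sum>i\<in>I. k i * \<iota> (coord (x i) e)) = 0)"
proof -
  have eq: "(\<Sum>i\<in>I. k i *v \<rho> (x i) v) = (\<Sum>e\<in>E. (\<Sum>i\<in>I. k i * \<iota> (coord (x i) e)) *v \<rho> e v)" if "v \<in> V" for v
  proof -
    have "(\<Sum>i\<in>I. k i *v \<rho> (x i) v) = (\<Sum>i\<in>I. \<Sum>e\<in>E. (k i * \<iota> (coord (x i) e)) *v \<rho> e v)"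
      by (rule sum.cong[OF refl]) (subst \<rho>_expand[OF that], simp add: K.scale_sum_right)
    also have "\<dots> = (\<Sum>e\<in>E. (\<Sum>i\<in>I. k i * \<iota> (coord (x i) e)) *v \<rho> e v)"
      by (subst sum.swap) (simp add: K.scale_sum_left)
    finally show ?thesis .
  qed
  show ?thesis
    using \<rho>_independent[of "\<lambda>e. \<Sum>i\<in>I. k i * \<iota> (coord (x i) e)"] by (auto simp: eq)
qed

lemma functional_ex: "\<exists>l w. w \<in> V \<and> l w = (1::'k) \<and> (\<forall>u v. l (u + v) = l u + l v) \<and> (\<forall>a v. l (a *v v) = a * l v)"
proof -
  obtain w where w: "w \<in> V" "w \<noteq> 0" using V_nonzero zero_closed by blast
  interpret F: vector_space "(*) :: 'k \<Rightarrow> 'k \<Rightarrow> 'k" by standard (auto simp: algebra_simps)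
  interpret P: vector_space_pair scale "(*) :: 'k \<Rightarrow> 'k \<Rightarrow> 'k" ..
  have "K.independent {w}" using w(2) by simp
  then obtain g where g: "Vector_Spaces.linear scale (*) g" "g w = 1"
    using P.linear_independent_extend[of "{w}" "\<lambda>_. 1"] by auto
  interpret g: Vector_Spaces.linear scale "(*)" g by (rule g(1))
  show ?thesis using w(1) g(2) g.add g.scale by blast
qed

text \<open>
  An arbitrary nonzero linear functional on \<open>V\<close>, used to form operators of rank one.
\<close>

definition functional :: "'v \<Rightarrow> 'k" where
  "functional = (SOME l. \<exists>w. w \<in> V \<and> l w = 1 \<and> (\<forall>u v. l (u + v) = l u + l v) \<and> (\<forall>a v. l (a *v v) = a * l v))"

lemma functional: "\<exists>w\<in>V. functional w = 1" "functional (u + v) = functional u + functional v"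
  "functional (a *v v) = a * functional v"
  using someI_ex[OF functional_ex, folded functional_def] by blast+

text \<open>
  The coordinates of the operator \<open>u \<mapsto> functional u *v v\<close> with respect to the basis \<open>\<rho> e\<close>.
\<close>

definition rank_one_coord :: "'v \<Rightarrow> 'b \<Rightarrow> 'k" where
  "rank_one_coord v = (SOME k. \<forall>u\<in>V. functional u *v v = (\<Sum>e\<in>E. k e *v \<rho> e u))"

lemma rank_one_coord:
  assumes v: "v \<in> V" and u: "u \<in> V"
  shows "(\<Sum>e\<in>E. rank_one_coord v e *v \<rho> e u) = functional u *v v"
proof -
  have "\<exists>k. \<forall>u\<in>V. functional u *v v = (\<Sum>e\<in>E. k e *v \<rho> e u)"
    by (rule \<rho>_full) (auto simp: functional scale_closed v K.scale_left_distrib)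
  from someI_ex[OF this] u show ?thesis by (simp add: rank_one_coord_def)
qed

lemma rank_one_coord_unique:
  assumes "v \<in> V" "\<And>u. u \<in> V \<Longrightarrow> (\<Sum>e\<in>E. k e *v \<rho> e u) = functional u *v v" "e \<in> E"
  shows "rank_one_coord v e = k e"
proof -
  have "rank_one_coord v e - k e = 0"
    by (rule \<rho>_independent[OF _ assms(3)])
       (simp add: K.scale_left_diff_distrib sum_subtractf rank_one_coord assms(1,2))
  then show ?thesis by simp
qed

lemma rank_one_coord_add:
  "u \<in> V \<Longrightarrow> v \<in> V \<Longrightarrow> e \<in> E \<Longrightarrow> rank_one_coord (u + v) e = rank_one_coord u e + rank_one_coord v e"
  by (rule rank_one_coord_unique)
     (auto simp: K.scale_left_distrib sum.distrib rank_one_coord K.scale_right_distrib K.subspace_add[OF V])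

lemma rank_one_coord_scale:
  "v \<in> V \<Longrightarrow> e \<in> E \<Longrightarrow> rank_one_coord (a *v v) e = a * rank_one_coord v e"
proof (rule rank_one_coord_unique)
  fix u assume "v \<in> V" "u \<in> V"
  then have "(\<Sum>e\<in>E. (a * rank_one_coord v e) *v \<rho> e u) = a *v functional u *v v"
    using K.scale_sum_right[of a "\<lambda>e. rank_one_coord v e *v \<rho> e u" E] by (simp add: rank_one_coord)
  then show "(\<Sum>e\<in>E. (a * rank_one_coord v e) *v \<rho> e u) = functional u *v a *v v"
    by (simp add: mult.commute)
qed (auto simp: scale_closed)

lemma rank_one_coord_\<rho>:
  assumes "v \<in> V" "e' \<in> E"
  shows "rank_one_coord (\<rho> x v) e' = (\<Sum>e\<in>E. \<iota> (coord (e * x) e') * rank_one_coord v e)"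
proof (rule rank_one_coord_unique[OF \<rho>_closed[OF assms(1)] _ assms(2)])
  fix u assume u: "u \<in> V"
  have "functional u *v \<rho> x v = \<rho> x (functional u *v v)" using assms(1) by (simp add: \<rho>_scale_right)
  also have "\<dots> = \<rho> x (\<Sum>e\<in>E. rank_one_coord v e *v \<rho> e u)" using assms(1) u by (simp add: rank_one_coord)
  also have "\<dots> = (\<Sum>e\<in>E. rank_one_coord v e *v \<rho> (e * x) u)"
    using u by (simp add: \<rho>_setsum_right scale_closed \<rho>_closed \<rho>_scale_right \<rho>_mult)
  also have "\<dots> = (\<Sum>e\<in>E. \<Sum>e'\<in>E. (\<iota> (coord (e * x) e') * rank_one_coord v e) *v \<rho> e' u)"
    by (rule sum.cong[OF refl]) (subst \<rho>_expand[OF u], simp add: K.scale_sum_right mult.commute)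
  also have "\<dots> = (\<Sum>e'\<in>E. (\<Sum>e\<in>E. \<iota> (coord (e * x) e') * rank_one_coord v e) *v \<rho> e' u)"
    by (subst sum.swap) (simp add: K.scale_sum_left)
  finally show "(\<Sum>e'\<in>E. (\<Sum>e\<in>E. \<iota> (coord (e * x) e') * rank_one_coord v e) *v \<rho> e' u) = functional u *v \<rho> x v"
    by simp
qed

text \<open>
  The semilinear map that sends \<open>\<Sum> k\<^sub>e \<rho>(e)\<close> to \<open>\<Sum> \<sigma>(k\<^sub>e) \<rho>(\<phi>(e))\<close> acts on the algebra of
  operators. This is its effect on the operator of rank one that belongs to \<open>v\<close>, evaluated at \<open>w\<close>.
  The case \<open>\<sigma> = \<delta>\<close>, \<open>\<phi> = id\<close> yields a connection on \<open>V\<close>; the case \<open>\<sigma> = id\<close> with an automorphism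
  \<open>\<phi>\<close> yields the operator needed for the theorem of Skolem and Noether.
\<close>

definition twist :: "('k \<Rightarrow> 'k) \<Rightarrow> ('b \<Rightarrow> 'b) \<Rightarrow> 'v \<Rightarrow> 'v \<Rightarrow> 'v" where
  "twist \<sigma> \<phi> w v = (\<Sum>e\<in>E. \<sigma> (rank_one_coord v e) *v \<rho> (\<phi> e) w)"

lemma twist_closed: "w \<in> V \<Longrightarrow> twist \<sigma> \<phi> w v \<in> V"
  unfolding twist_def by (intro sum_closed scale_closed \<rho>_closed)

lemma twist_add:
  assumes "\<And>a b. \<sigma> (a + b) = \<sigma> a + \<sigma> b" "u \<in> V" "v \<in> V"
  shows "twist \<sigma> \<phi> w (u + v) = twist \<sigma> \<phi> w u + twist \<sigma> \<phi> w v"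
  unfolding twist_def sum.distrib[symmetric]
  by (rule sum.cong) (auto simp: rank_one_coord_add assms K.scale_left_distrib)

text \<open>
  Composing the operator of rank one of \<open>v\<close> with \<open>\<rho> x\<close> gives the one of \<open>\<rho> x v\<close>, and the
  semilinear map on operators turns the composition with \<open>\<rho> x\<close> into the one with \<open>\<rho> (\<phi> x)\<close>.
\<close>

lemma twist_semilinear:
  assumes \<sigma>: "\<And>a b. \<sigma> (a + b) = \<sigma> a + \<sigma> b" "\<And>c a. \<sigma> (\<iota> c * a) = \<iota> c * \<sigma> a"
    and \<phi>: "\<And>x y. \<phi> (x + y) = \<phi> x + \<phi> y" "\<And>c x. \<phi> (s c x) = s c (\<phi> x)" "\<And>x y. \<phi> (x * y) = \<phi> x * \<phi> y"
    and v: "v \<in> V" and w: "w \<in> V"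
  shows "twist \<sigma> \<phi> w (\<rho> x v) = \<rho> (\<phi> x) (twist \<sigma> \<phi> w v)"
proof -
  have \<sigma>sum: "\<sigma> (sum g I) = (\<Sum>i\<in>I. \<sigma> (g i))" for g and I :: "'b set"
  proof -
    have "\<sigma> 0 = 0" using \<sigma>(1)[of 0 0] by (simp only: add_0_right add_cancel_right_right)
    then show ?thesis by (induction I rule: infinite_finite_induct) (auto simp: \<sigma>(1))
  qed
  have \<phi>sum: "\<phi> (sum g I) = (\<Sum>i\<in>I. \<phi> (g i))" for g and I :: "'b set"
  proof -
    have "\<phi> 0 = 0" using \<phi>(1)[of 0 0] by simp
    then show ?thesis by (induction I rule: infinite_finite_induct) (auto simp: \<phi>(1))
  qed
  have \<phi>e: "\<rho> (\<phi> y) w = (\<Sum>e'\<in>E. \<iota> (coord y e') *v \<rho> (\<phi> e') w)" for y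
    using \<rho>_setsum[OF w, of "\<lambda>e'. s (coord y e') (\<phi> e')" E] \<phi>sum[of "\<lambda>e'. s (coord y e') e'" E]
    by (simp add: coord_sum \<phi>(2) \<rho>_scale[OF w])
  have "twist \<sigma> \<phi> w (\<rho> x v) =
      (\<Sum>e'\<in>E. \<Sum>e\<in>E. (\<iota> (coord (e * x) e') * \<sigma> (rank_one_coord v e)) *v \<rho> (\<phi> e') w)"
    unfolding twist_def
    by (rule sum.cong) (auto simp: rank_one_coord_\<rho>[OF v] \<sigma>sum \<sigma>(2) K.scale_sum_left)
  also have "\<dots> = (\<Sum>e\<in>E. \<sigma> (rank_one_coord v e) *v (\<Sum>e'\<in>E. \<iota> (coord (e * x) e') *v \<rho> (\<phi> e') w))"
    by (subst sum.swap) (simp add: K.scale_sum_right mult.commute)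
  also have "\<dots> = (\<Sum>e\<in>E. \<sigma> (rank_one_coord v e) *v \<rho> (\<phi> (e * x)) w)"
    by (simp only: \<phi>e[symmetric])
  also have "\<dots> = \<rho> (\<phi> x) (twist \<sigma> \<phi> w v)"
    unfolding twist_def using w
    by (simp add: \<rho>_setsum_right scale_closed \<rho>_closed \<rho>_scale_right \<rho>_mult \<phi>(3))
  finally show ?thesis .
qed

theorem invariant_connection_exists:
  assumes \<delta>: "derivation \<delta>" "\<And>c. \<delta> (\<iota> c) = 0"
  shows "\<exists>nabla. differential_module scale \<delta> V nabla \<and> (\<forall>x. \<forall>v\<in>V. nabla (\<rho> x v) = \<rho> x (nabla v))"
proof -
  obtain w where w: "w \<in> V" "functional w = 1" using functional(1) by blast
  let ?N = "twist \<delta> (\<lambda>x. x) w"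
  have "differential_module scale \<delta> V ?N"
  proof
    show "derivation \<delta>" "K.subspace V" by (fact \<delta>(1), fact V)
    show "?N v \<in> V" for v by (rule twist_closed[OF w(1)])
    show "?N (u + v) = ?N u + ?N v" if "u \<in> V" "v \<in> V" for u v
      using that by (intro twist_add) (auto simp: derivation_rules(1)[OF \<delta>(1)])
    show "?N (a *v v) = a *v ?N v + \<delta> a *v v" if v: "v \<in> V" for a v
    proof -
      have "?N (a *v v) = (\<Sum>e\<in>E. a *v \<delta> (rank_one_coord v e) *v \<rho> e w + \<delta> a *v rank_one_coord v e *v \<rho> e w)"
        unfolding twist_def
        by (rule sum.cong) (auto simp: rank_one_coord_scale v derivation_rules(2)[OF \<delta>(1)] K.scale_left_distrib)
      also have "\<dots> = a *v ?N v + \<delta> a *v (\<Sum>e\<in>E. rank_one_coord v e *v \<rho> e w)"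
        by (simp only: sum.distrib twist_def K.scale_sum_right)
      finally show ?thesis using rank_one_coord[OF v w(1)] w(2) by simp
    qed
  qed
  moreover have "?N (\<rho> x v) = \<rho> x (?N v)" if "v \<in> V" for x v
    by (rule twist_semilinear) (use that w(1) \<delta>(2) in \<open>auto simp: derivation_rules(1,2)[OF \<delta>(1)]\<close>)
  ultimately show ?thesis by blast
qed

text \<open>
  For \<open>T = \<Sum> k\<^sub>e \<rho>(e)\<close> the commutator with \<open>nabla\<close> is \<open>\<Sum> \<delta>(k\<^sub>e) \<rho>(e)\<close>. If it vanishes, all
  \<open>k\<^sub>e\<close> are constants, that is, in \<open>F\<close>.
\<close>

lemma commutant_of_connection:
  assumes nabla: "differential_module scale \<delta> V nabla" "\<And>x v. v \<in> V \<Longrightarrow> nabla (\<rho> x v) = \<rho> x (nabla v)"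
    and const: "constants \<delta> = range \<iota>"
    and T: "\<And>v. v \<in> V \<Longrightarrow> T v \<in> V" "\<And>u v. u \<in> V \<Longrightarrow> v \<in> V \<Longrightarrow> T (u + v) = T u + T v"
      "\<And>a v. v \<in> V \<Longrightarrow> T (a *v v) = a *v T v" "\<And>v. v \<in> V \<Longrightarrow> T (nabla v) = nabla (T v)"
  shows "\<exists>b. \<forall>v\<in>V. T v = \<rho> b v"
proof -
  interpret D: differential_module scale \<delta> V nabla by (rule nabla(1))
  obtain k where k: "\<And>v. v \<in> V \<Longrightarrow> T v = (\<Sum>e\<in>E. k e *v \<rho> e v)" using \<rho>_full[of T] T by blast
  have nsum: "nabla (\<Sum>i\<in>I. g i) = (\<Sum>i\<in>I. nabla (g i))" if "\<And>i. i \<in> I \<Longrightarrow> g i \<in> V" for g and I :: "'b set"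
  proof -
    have "nabla 0 = 0" using D.nabla_add[of 0 0] zero_closed by simp
    then show ?thesis using that
      by (induction I rule: infinite_finite_induct) (auto simp: D.nabla_add sum_closed)
  qed
  have "(\<Sum>e\<in>E. \<delta> (k e) *v \<rho> e v) = 0" if v: "v \<in> V" for v
  proof -
    have "nabla (T v) = (\<Sum>e\<in>E. k e *v \<rho> e (nabla v) + \<delta> (k e) *v \<rho> e v)"
      unfolding k[OF v] by (subst nsum) (auto simp: scale_closed \<rho>_closed v D.nabla_scale nabla(2))
    also have "\<dots> = T (nabla v) + (\<Sum>e\<in>E. \<delta> (k e) *v \<rho> e v)"
      by (simp add: sum.distrib k[OF D.nabla_closed[OF v]])
    finally show ?thesis using T(4)[OF v] by simp
  qed
  then have "\<delta> (k e) = 0" if "e \<in> E" for e using \<rho>_independent[of "\<lambda>e. \<delta> (k e)" e] that by blast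
  then have "\<exists>c. k e = \<iota> c" if "e \<in> E" for e using const that unfolding constants_def by blast
  then obtain c where c: "\<And>e. e \<in> E \<Longrightarrow> k e = \<iota> (c e)" by metis
  have "T v = \<rho> (\<Sum>e\<in>E. s (c e) e) v" if "v \<in> V" for v
    using that c by (simp add: k \<rho>_setsum \<rho>_scale)
  then show ?thesis by blast
qed

text \<open>
  For suitable \<open>w\<close> the twist by \<open>\<phi>\<close> is a \<open>K\<close>-linear operator \<open>T \<noteq> 0\<close> with \<open>T \<rho>(x) = \<rho>(\<phi> x) T\<close>. Its
  \<open>K\<close>-coordinates \<open>k\<^sub>e\<close> solve a linear system over \<open>F\<close>, and so do their images under an
  \<open>F\<close>-linear map \<open>\<theta>\<close> from \<open>K\<close> to \<open>F\<close>. Choosing \<open>\<theta>\<close> nonzero on some \<open>k\<^sub>e\<close> gives a nonzero solution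
  in \<open>B\<close>.
\<close>

lemma intertwiner:
  assumes \<phi>: "\<And>x y. \<phi> (x + y) = \<phi> x + \<phi> y" "\<And>c x. \<phi> (s c x) = s c (\<phi> x)" "\<And>x y. \<phi> (x * y) = \<phi> x * \<phi> y"
    and \<phi>_inj: "inj \<phi>"
  shows "\<exists>b. b \<noteq> 0 \<and> (\<forall>x. x * b = b * \<phi> x)"
proof -
  have \<phi>sum: "\<phi> (sum g I) = (\<Sum>i\<in>I. \<phi> (g i))" for g and I :: "'b set"
  proof -
    have "\<phi> 0 = 0" using \<phi>(1)[of 0 0] by simp
    then show ?thesis by (induction I rule: infinite_finite_induct) (auto simp: \<phi>(1))
  qed
  interpret BB: vector_space_pair s s ..
  have "Vector_Spaces.linear s s \<phi>" using \<phi>(1,2) by unfold_locales auto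
  then obtain \<chi> where \<chi>: "Vector_Spaces.linear s s \<chi>" "\<chi> \<circ> \<phi> = id"
    using BB.linear_injective_left_inverse[OF _ \<phi>_inj] by blast
  interpret \<chi>: Vector_Spaces.linear s s \<chi> by (rule \<chi>(1))
  have \<chi>\<phi>: "\<chi> (\<phi> x) = x" for x using \<chi>(2) by (simp add: fun_eq_iff)
  obtain w0 where w0: "w0 \<in> V" "functional w0 = 1" using functional(1) by blast
  then have w0n: "w0 \<noteq> 0" using functional(3)[of 0 w0] by auto
  have "\<exists>w\<in>V. twist (\<lambda>a. a) \<phi> w w0 \<noteq> 0"
  proof (rule ccontr)
    assume "\<not> (\<exists>w\<in>V. twist (\<lambda>a. a) \<phi> w w0 \<noteq> 0)"
    then have "\<forall>v\<in>V. (\<Sum>e\<in>E. rank_one_coord w0 e *v \<rho> (\<phi> e) v) = 0" by (simp add: twist_def)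
    then have rel: "(\<Sum>e\<in>E. rank_one_coord w0 e * \<iota> (coord (\<phi> e) e')) = 0" if "e' \<in> E" for e'
      using relation_iff[OF E(1), of "rank_one_coord w0" \<phi>] that by blast
    have expand: "\<rho> e v = (\<Sum>e'\<in>E. \<iota> (coord (\<phi> e) e') *v \<rho> (\<chi> e') v)" if "v \<in> V" for e v
    proof -
      have "e = \<chi> (\<Sum>e'\<in>E. s (coord (\<phi> e) e') e')" by (simp add: coord_sum \<chi>\<phi>)
      also have "\<dots> = (\<Sum>e'\<in>E. s (coord (\<phi> e) e') (\<chi> e'))" by (simp add: \<chi>.sum \<chi>.scale)
      finally have "\<rho> e v = \<rho> (\<Sum>e'\<in>E. s (coord (\<phi> e) e') (\<chi> e')) v" by simp
      then show ?thesis using that by (simp add: \<rho>_setsum \<rho>_scale)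
    qed
    have "(\<Sum>e\<in>E. rank_one_coord w0 e *v \<rho> e v) = 0" if v: "v \<in> V" for v
    proof -
      have "(\<Sum>e\<in>E. rank_one_coord w0 e *v \<rho> e v) =
          (\<Sum>e\<in>E. \<Sum>e'\<in>E. (rank_one_coord w0 e * \<iota> (coord (\<phi> e) e')) *v \<rho> (\<chi> e') v)"
        by (rule sum.cong[OF refl]) (subst expand[OF v], simp add: K.scale_sum_right)
      also have "\<dots> = (\<Sum>e'\<in>E. (\<Sum>e\<in>E. rank_one_coord w0 e * \<iota> (coord (\<phi> e) e')) *v \<rho> (\<chi> e') v)"
        by (subst sum.swap) (simp add: K.scale_sum_left)
      also have "\<dots> = 0" using rel by simp
      finally show ?thesis .
    qed
    then have "functional w0 *v w0 = 0" using rank_one_coord[OF w0(1) w0(1)] w0(1) by simp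
    then show False using w0(2) w0n by simp
  qed
  then obtain w where w: "w \<in> V" "twist (\<lambda>a. a) \<phi> w w0 \<noteq> 0" by blast
  define T where "T = twist (\<lambda>a. a) \<phi> w"
  have T\<rho>: "T (\<rho> x v) = \<rho> (\<phi> x) (T v)" if "v \<in> V" for x v
    unfolding T_def by (rule twist_semilinear) (use \<phi> that w in auto)
  have Tc: "T v \<in> V" for v unfolding T_def by (rule twist_closed[OF w(1)])
  have "\<exists>k. \<forall>v\<in>V. T v = (\<Sum>e\<in>E. k e *v \<rho> e v)"
  proof (rule \<rho>_full)
    show "T v \<in> V" for v by (rule Tc)
    show "T (u + v) = T u + T v" if "u \<in> V" "v \<in> V" for u v
      unfolding T_def using that by (intro twist_add) auto
    show "T (a *v v) = a *v T v" if "v \<in> V" for a v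
      unfolding T_def twist_def K.scale_sum_right
      by (rule sum.cong) (auto simp: rank_one_coord_scale that)
  qed
  then obtain k where k: "\<And>v. v \<in> V \<Longrightarrow> T v = (\<Sum>e\<in>E. k e *v \<rho> e v)" by blast
  have "T w0 \<noteq> 0" using w(2) by (simp add: T_def)
  then have "(\<Sum>e\<in>E. k e *v \<rho> e w0) \<noteq> 0" using k[OF w0(1)] by simp
  then obtain e0 where e0: "e0 \<in> E" "k e0 *v \<rho> e0 w0 \<noteq> 0" by (rule sum.not_neutral_contains_not_neutral)
  then have "k e0 \<noteq> 0" by auto
  note e0 = e0(1) this
  have rel: "(\<Sum>e\<in>E. k e * \<iota> (coord (x * e - e * \<phi> x) e')) = 0" if e': "e' \<in> E" for x e'
  proof -
    have "(\<Sum>e\<in>E. k e *v \<rho> (x * e - e * \<phi> x) v) = 0" if v: "v \<in> V" for v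
    proof -
      have "(\<Sum>e\<in>E. k e *v \<rho> (x * e) v) = T (\<rho> x v)" using v by (simp add: k \<rho>_closed \<rho>_mult)
      also have "\<dots> = \<rho> (\<phi> x) (T v)" by (rule T\<rho>[OF v])
      also have "\<dots> = (\<Sum>e\<in>E. k e *v \<rho> (e * \<phi> x) v)"
        using v by (simp add: k \<rho>_setsum_right scale_closed \<rho>_closed \<rho>_scale_right \<rho>_mult)
      finally show ?thesis using v by (simp add: \<rho>_diff K.scale_right_diff_distrib sum_subtractf)
    qed
    then show ?thesis using relation_iff[OF E(1), of k "\<lambda>e. x * e - e * \<phi> x"] e' by blast
  qed
  (* K as a vector space over F, in order to choose a linear functional \<theta> with values in F *)
  define sc where "sc c a = \<iota> c * a" for c a
  interpret KF: vector_space sc by standard (auto simp: sc_def algebra_simps \<iota>.hom_add \<iota>.hom_mult)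
  interpret FF: vector_space "(*) :: 'f \<Rightarrow> 'f \<Rightarrow> 'f" by standard (auto simp: algebra_simps)
  interpret KP: vector_space_pair sc "(*) :: 'f \<Rightarrow> 'f \<Rightarrow> 'f" ..
  have "KF.independent {k e0}" using e0(2) by simp
  then obtain \<theta> where \<theta>: "Vector_Spaces.linear sc (*) \<theta>" "\<theta> (k e0) = 1"
    using KP.linear_independent_extend[of "{k e0}" "\<lambda>_. 1"] by auto
  interpret \<theta>: Vector_Spaces.linear sc "(*)" \<theta> by (rule \<theta>(1))
  have \<theta>s: "\<theta> (a * \<iota> c) = \<theta> a * c" for a c using \<theta>.scale[of c a] by (simp add: sc_def mult.commute)
  define b where "b = (\<Sum>e\<in>E. s (\<theta> (k e)) e)"
  have "b \<noteq> 0" using coord_combination[OF e0(1), of "\<lambda>e. \<theta> (k e)"] \<theta>(2) coord_zero[of e0] by (auto simp: b_def)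
  moreover have "x * b = b * \<phi> x" for x
  proof -
    have "x * b - b * \<phi> x = (\<Sum>e\<in>E. s (\<theta> (k e)) (x * e - e * \<phi> x))"
      by (simp add: b_def sum_distrib_left sum_distrib_right s_mult[symmetric] B.scale_right_diff_distrib sum_subtractf)
    also have "\<dots> = 0"
    proof (rule coord_eq_0)
      fix e' assume e': "e' \<in> E"
      have "coord (\<Sum>e\<in>E. s (\<theta> (k e)) (x * e - e * \<phi> x)) e' = \<theta> (\<Sum>e\<in>E. k e * \<iota> (coord (x * e - e * \<phi> x) e'))"
        by (simp add: coord_setsum coord_scale \<theta>.sum \<theta>s)
      then show "coord (\<Sum>e\<in>E. s (\<theta> (k e)) (x * e - e * \<phi> x)) e' = 0" using rel[OF e'] by (simp add: \<theta>.zero)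
    qed
    finally show ?thesis by simp
  qed
  ultimately show ?thesis by blast
qed

lemma ring_type_algebra: "ring (type_algebra s)"
proof (rule ringI)
  show "abelian_group (type_algebra s)"
    by (rule abelian_groupI) (auto simp: type_algebra_def add.assoc add.commute intro: exI[of _ "- _"])
  show "Group.monoid (type_algebra s)"
    by (rule monoidI) (auto simp: type_algebra_def mult.assoc)
qed (auto simp: type_algebra_def distrib_left distrib_right)

text \<open>
  For the intertwiner \<open>b\<close> the set \<open>b B = B b\<close> is a nonzero ideal, so \<open>b\<close> is a unit.
\<close>

theorem skolem_noether:
  assumes simple: "\<And>I. ideal I (type_algebra s) \<Longrightarrow> I = {0} \<or> I = UNIV"
    and \<phi>: "\<And>x y. \<phi> (x + y) = \<phi> x + \<phi> y" "\<And>c x. \<phi> (s c x) = s c (\<phi> x)" "\<And>x y. \<phi> (x * y) = \<phi> x * \<phi> y"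
      "bij \<phi>"
  shows "\<exists>u u'. u * u' = 1 \<and> u' * u = 1 \<and> (\<forall>x. \<phi> x = u * x * u')"
proof -
  obtain b where b: "b \<noteq> 0" "\<And>x. x * b = b * \<phi> x"
    using intertwiner[of \<phi>] \<phi> by (auto simp: bij_is_inj)
  define I where "I = range (\<lambda>z. b * z)"
  have "ideal I (type_algebra s)"
  proof (rule idealI[OF ring_type_algebra])
    interpret ring "type_algebra s" by (rule ring_type_algebra)
    have inv: "inv\<^bsub>add_monoid (type_algebra s)\<^esub> x = - x" for x
      using minus_equality[of "- x" x] by (simp add: type_algebra_def a_inv_def)
    show "subgroup I (add_monoid (type_algebra s))"
    proof (rule subgroup.intro)
      show "x \<otimes>\<^bsub>add_monoid (type_algebra s)\<^esub> y \<in> I" if "x \<in> I" "y \<in> I" for x y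
        using that by (auto simp: I_def type_algebra_def distrib_left[symmetric])
      show "\<one>\<^bsub>add_monoid (type_algebra s)\<^esub> \<in> I"
        by (auto simp: I_def type_algebra_def intro: range_eqI[of _ _ 0])
      show "inv\<^bsub>add_monoid (type_algebra s)\<^esub> x \<in> I" if "x \<in> I" for x
        using that unfolding inv by (auto simp: I_def mult_minus_right[symmetric] simp del: mult_minus_right)
    qed (simp add: type_algebra_def)
    fix a x assume "a \<in> I"
    then obtain z where a: "a = b * z" by (auto simp: I_def)
    have "x * a = b * (\<phi> x * z)" using b(2)[of x] by (simp add: a mult.assoc[symmetric])
    then show "x \<otimes>\<^bsub>type_algebra s\<^esub> a \<in> I" "a \<otimes>\<^bsub>type_algebra s\<^esub> x \<in> I"
      by (auto simp: type_algebra_def I_def a mult.assoc)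
  qed
  moreover have "b \<in> I" unfolding I_def by (rule range_eqI[of _ _ 1]) simp
  ultimately have I: "I = UNIV" using simple b(1) by blast
  then obtain z where z: "b * z = 1" unfolding I_def by (metis UNIV_I rangeE)
  obtain z' where "\<phi> z' = z" using \<phi>(4) by (metis bij_pointE)
  then have z': "z' * b = 1" using b(2)[of z'] z by simp
  have "z' = z" using z z' by (metis mult.assoc mult_1_left mult_1_right)
  then have zb: "z * b = 1" using z' by simp
  have "\<phi> x = z * x * b" for x
  proof -
    have "z * x * b = z * (b * \<phi> x)" using b(2)[of x] by (simp add: mult.assoc)
    also have "\<dots> = \<phi> x" using zb by (simp add: mult.assoc[symmetric])
    finally show ?thesis by simp
  qed
  then show ?thesis using z zb by blast
qed

end

section \<open>The matrix representation given by a splitting\<close>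

text \<open>
  The additive extension of \<open>g\<close> to the free abelian group, for values in a ring.
\<close>

definition frag_sum :: "('z \<Rightarrow> 'k::comm_ring_1) \<Rightarrow> ('z \<Rightarrow>\<^sub>0 int) \<Rightarrow> 'k" where
  "frag_sum g p = (\<Sum>z\<in>Poly_Mapping.keys p. of_int (Poly_Mapping.lookup p z) * g z)"

lemma frag_sum_of [simp]: "frag_sum g (frag_of z) = g z"
  by (simp add: frag_sum_def)

lemma frag_sum_zero [simp]: "frag_sum g 0 = 0"
  by (simp add: frag_sum_def)

lemma frag_sum_diff: "frag_sum g (p - q) = frag_sum g p - frag_sum g q"
proof -
  let ?A = "Poly_Mapping.keys p \<union> Poly_Mapping.keys q"
  have *: "frag_sum g r = (\<Sum>z\<in>?A. of_int (Poly_Mapping.lookup r z) * g z)" if "Poly_Mapping.keys r \<subseteq> ?A" for r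
    unfolding frag_sum_def using that by (intro sum.mono_neutral_left) (auto simp: in_keys_iff)
  have "Poly_Mapping.keys (p - q) \<subseteq> ?A" by (rule keys_diff)
  then show ?thesis
    by (simp add: * lookup_minus sum_subtractf[symmetric] algebra_simps)
qed

lemma frag_induct [case_names zero of diff]:
  assumes "P 0" "\<And>z. P (frag_of z)" "\<And>p q. P p \<Longrightarrow> P q \<Longrightarrow> P (p - q)"
  shows "P p"
  by (rule frag_induction[of p UNIV]) (use assms in auto)

lemma free_mult_diff_left: "free_mult (p - p') q = free_mult p q - free_mult p' q"
  by (simp add: free_mult_def frag_extend_diff)

lemma free_mult_diff_right: "free_mult p (q - q') = free_mult p q - free_mult p q'"
proof (induction p rule: frag_induct)
  case (of x)
  then show ?case by (simp add: free_mult_def frag_extend_diff split: prod.split)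
next
  case (diff a b)
  then show ?case by (simp add: free_mult_diff_left)
qed (simp_all add: free_mult_def)

lemma free_mult_of: "free_mult (frag_of (x, a)) (frag_of (y, b)) = frag_of (x * y, a * b)"
  by (simp add: free_mult_def)

lemma free_mult_zero: "free_mult 0 q = 0" "free_mult p 0 = 0"
  using free_mult_diff_left[of 0 0 q] free_mult_diff_right[of p 0 0] by simp_all

lemma free_scale_diff: "free_scale a (p - q) = free_scale a p - free_scale a q"
  by (simp add: free_scale_def frag_extend_diff)

lemma free_scale_of: "free_scale a (frag_of (x, b)) = frag_of (x, a * b)"
  by (simp add: free_scale_def)

context
  fixes s :: "'f::field \<Rightarrow> 'b::ring_1 \<Rightarrow> 'b" and \<iota> :: "'f \<Rightarrow> 'k::field"
  assumes s_mult: "\<And>c x y. s c (x * y) = s c x * y" "\<And>c x y. s c (x * y) = x * s c y"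
begin

lemma tensor_null_add: "p \<in> tensor_null s \<iota> \<Longrightarrow> q \<in> tensor_null s \<iota> \<Longrightarrow> p + q \<in> tensor_null s \<iota>"
  using tensor_null.diff[of p s \<iota> "0 - q"] tensor_null.diff[OF tensor_null.zero, of q s \<iota>] by simp

text \<open>
  The relations of the tensor product form an ideal, so that the operations on cosets are well
  defined.
\<close>

lemma free_mult_null_left: "p \<in> tensor_null s \<iota> \<Longrightarrow> free_mult p q \<in> tensor_null s \<iota>"
proof (induction q rule: frag_induct)
  case (of z)
  obtain y b where z: "z = (y, b)" by (cases z)
  show ?case using \<open>p \<in> tensor_null s \<iota>\<close>
    unfolding z
    by induction
       (auto simp: free_mult_diff_left free_mult_of free_mult_zero distrib_right mult.assoc s_mult(1)[symmetric]
         intro: tensor_null.intros)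
next
  case (diff a b)
  then show ?case by (simp add: free_mult_diff_right tensor_null.diff)
qed (simp_all add: free_mult_zero tensor_null.zero)

lemma free_mult_null_right: "q \<in> tensor_null s \<iota> \<Longrightarrow> free_mult p q \<in> tensor_null s \<iota>"
proof (induction p rule: frag_induct)
  case (of z)
  obtain y b where z: "z = (y, b)" by (cases z)
  have bal: "frag_of (s c x, b * a) - frag_of (x, b * (\<iota> c * a)) \<in> tensor_null s \<iota>" for c x a
    using tensor_null.balanced[of s c x "b * a" \<iota>] by (simp add: ac_simps)
  show ?case using \<open>q \<in> tensor_null s \<iota>\<close>
    unfolding z
    by induction
       (auto simp: free_mult_diff_right free_mult_of free_mult_zero distrib_left s_mult(2)[symmetric] bal
         intro: tensor_null.intros)
next
  case (diff a b)
  then show ?case by (simp add: free_mult_diff_left tensor_null.diff)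
qed (simp_all add: free_mult_zero tensor_null.zero)

lemma free_scale_null: "p \<in> tensor_null s \<iota> \<Longrightarrow> free_scale d p \<in> tensor_null s \<iota>"
proof (induction rule: tensor_null.induct)
  case zero
  then show ?case by (simp add: free_scale_def tensor_null.zero)
next
  case (balanced c x a)
  then show ?case using tensor_null.balanced[of s c x "d * a" \<iota>]
    by (simp add: free_scale_diff free_scale_of ac_simps)
qed (auto simp: free_scale_diff free_scale_of distrib_left intro: tensor_null.intros)

lemma equiv_tensor_rel: "equiv UNIV (tensor_rel s \<iota>)"
proof (rule equivI)
  show "refl (tensor_rel s \<iota>)" by (auto simp: refl_on_def tensor_rel_def tensor_null.zero)
  show "sym (tensor_rel s \<iota>)"
  proof (rule symI)
    fix p q assume "(p, q) \<in> tensor_rel s \<iota>"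
    then show "(q, p) \<in> tensor_rel s \<iota>"
      using tensor_null.diff[OF tensor_null.zero, of "p - q" s \<iota>] by (simp add: tensor_rel_def)
  qed
  show "trans (tensor_rel s \<iota>)"
  proof (rule transI)
    fix p q r assume "(p, q) \<in> tensor_rel s \<iota>" "(q, r) \<in> tensor_rel s \<iota>"
    then show "(p, r) \<in> tensor_rel s \<iota>"
      using tensor_null_add[of "p - q" "q - r"] by (simp add: tensor_rel_def)
  qed
qed auto

definition tensor_class :: "('b \<times> 'k \<Rightarrow>\<^sub>0 int) \<Rightarrow> ('b \<times> 'k \<Rightarrow>\<^sub>0 int) set" where
  "tensor_class p = tensor_rel s \<iota> `` {p}"

lemma tensor_class_eq_iff: "tensor_class p = tensor_class q \<longleftrightarrow> p - q \<in> tensor_null s \<iota>"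
  unfolding tensor_class_def using eq_equiv_class_iff[OF equiv_tensor_rel, of p q]
  by (simp add: tensor_rel_def)

lemma tensor_algebra_ops:
  "tensor_class p \<in> carrier (tensor_algebra s \<iota>)"
  "X \<in> carrier (tensor_algebra s \<iota>) \<Longrightarrow> \<exists>p. X = tensor_class p"
  "tensor_class p \<otimes>\<^bsub>tensor_algebra s \<iota>\<^esub> tensor_class q = tensor_class (free_mult p q)"
  "tensor_class p \<oplus>\<^bsub>tensor_algebra s \<iota>\<^esub> tensor_class q = tensor_class (p + q)"
  "a \<odot>\<^bsub>tensor_algebra s \<iota>\<^esub> tensor_class p = tensor_class (free_scale a p)"
proof -
  note E = equiv_tensor_rel
  show "tensor_class p \<in> carrier (tensor_algebra s \<iota>)"
    by (auto simp: tensor_algebra_def tensor_class_def intro: quotientI)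
  show "\<exists>p. X = tensor_class p" if "X \<in> carrier (tensor_algebra s \<iota>)"
    using that by (auto simp: tensor_algebra_def tensor_class_def elim: quotientE)
  have cls: "tensor_rel s \<iota> `` {p} = tensor_class p" for p by (simp add: tensor_class_def)
  show "tensor_class p \<otimes>\<^bsub>tensor_algebra s \<iota>\<^esub> tensor_class q = tensor_class (free_mult p q)"
  proof -
    have "congruent2 (tensor_rel s \<iota>) (tensor_rel s \<iota>) (\<lambda>p q. tensor_class (free_mult p q))"
    proof (rule congruent2I[OF E E])
      show "tensor_class (free_mult y q) = tensor_class (free_mult z q)" if "(y, z) \<in> tensor_rel s \<iota>" for y z q
        using that free_mult_null_left[of "y - z" q] by (simp add: tensor_class_eq_iff tensor_rel_def free_mult_diff_left)
      show "tensor_class (free_mult q y) = tensor_class (free_mult q z)" if "(y, z) \<in> tensor_rel s \<iota>" for y z q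
        using that free_mult_null_right[of "y - z" q] by (simp add: tensor_class_eq_iff tensor_rel_def free_mult_diff_right)
    qed
    from UN_equiv_class2[OF E E this, of p q] show ?thesis
      by (simp add: tensor_algebra_def cls)
  qed
  show "tensor_class p \<oplus>\<^bsub>tensor_algebra s \<iota>\<^esub> tensor_class q = tensor_class (p + q)"
  proof -
    have "congruent2 (tensor_rel s \<iota>) (tensor_rel s \<iota>) (\<lambda>p q. tensor_class (p + q))"
      by (rule congruent2I[OF E E]) (auto simp: tensor_class_eq_iff tensor_rel_def)
    from UN_equiv_class2[OF E E this, of p q] show ?thesis
      by (simp add: tensor_algebra_def cls)
  qed
  show "a \<odot>\<^bsub>tensor_algebra s \<iota>\<^esub> tensor_class p = tensor_class (free_scale a p)"
  proof -
    have "congruent (tensor_rel s \<iota>) (\<lambda>p. tensor_class (free_scale a p))"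
    proof (rule congruentI)
      show "tensor_class (free_scale a y) = tensor_class (free_scale a z)" if "(y, z) \<in> tensor_rel s \<iota>" for y z
        using that free_scale_null[of "y - z" a] by (simp add: tensor_class_eq_iff tensor_rel_def free_scale_diff)
    qed
    from UN_equiv_class[OF E this, of p] show ?thesis
      by (simp add: tensor_algebra_def cls)
  qed
qed

end

text \<open>
  The matrices \<open>\<psi> e\<close> for \<open>e\<close> in a basis \<open>E\<close> of \<open>B\<close> over \<open>F\<close> form a \<open>K\<close>-basis of the matrix
  algebra.
\<close>

definition splitting_representation ::
  "('f \<Rightarrow> 'b::ring_1 \<Rightarrow> 'b) \<Rightarrow> ('f \<Rightarrow> 'k::field) \<Rightarrow> nat \<Rightarrow> 'b set \<Rightarrow> ('b \<Rightarrow> 'k mat) \<Rightarrow> bool" where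
  "splitting_representation s \<iota> m E \<psi> \<longleftrightarrow>
    (\<forall>x. \<psi> x \<in> carrier_mat m m) \<and> (\<forall>x y. \<psi> (x + y) = \<psi> x + \<psi> y) \<and>
    (\<forall>c x. \<psi> (s c x) = \<iota> c \<cdot>\<^sub>m \<psi> x) \<and> (\<forall>x y. \<psi> (x * y) = \<psi> x * \<psi> y) \<and> \<psi> 1 = 1\<^sub>m m \<and>
    (\<forall>X\<in>carrier_mat m m. \<exists>k. \<forall>i<m. \<forall>j<m. X $$ (i, j) = (\<Sum>e\<in>E. k e * \<psi> e $$ (i, j))) \<and>
    (\<forall>k. (\<forall>i<m. \<forall>j<m. (\<Sum>e\<in>E. k e * \<psi> e $$ (i, j)) = 0) \<longrightarrow> (\<forall>e\<in>E. k e = 0))"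

text \<open>
  Take \<open>\<psi> x\<close> to be the image of \<open>x \<otimes> 1\<close>. For the independence, suppose that
  \<open>\<Sum> k\<^sub>e \<psi>(e) = 0\<close>. Then \<open>\<Sum> e \<otimes> k\<^sub>e\<close> is a consequence of the tensor relations, and the additive
  map \<open>x \<otimes> a \<mapsto> x\<^sub>e a\<close>, with \<open>x\<^sub>e\<close> the coordinate of \<open>x\<close> at \<open>e\<close>, respects these relations and
  maps the sum to \<open>k\<^sub>e\<close>.
\<close>

lemma splitting_representation_exists:
  fixes s :: "'f::field \<Rightarrow> 'b::ring_1 \<Rightarrow> 'b" and \<iota> :: "'f \<Rightarrow> 'k::field"
  assumes s_mult: "\<And>c x y. s c (x * y) = s c x * y" "\<And>c x y. s c (x * y) = x * s c y"
    and vs: "vector_space s" and hom: "field_hom \<iota>"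
    and E: "finite E" "\<not> Modules.module.dependent s E" "Modules.module.span s E = UNIV"
    and splits: "splits \<iota> s m"
  shows "\<exists>\<psi> :: 'b \<Rightarrow> 'k mat. splitting_representation s \<iota> m E \<psi>"
proof -
  interpret vector_space s by (rule vs)
  interpret \<iota>: field_hom \<iota> by (rule hom)
  obtain h where h: "algebra_iso (tensor_algebra s \<iota>) (module_mat TYPE('k) m m) h"
    using splits by (auto simp: splits_def)
  note T = tensor_algebra_ops[where s = s and \<iota> = \<iota>, OF s_mult]
  note Tc = tensor_class_eq_iff[where s = s and \<iota> = \<iota>, OF s_mult]
  define \<eta> where "\<eta> p = h (tensor_class s \<iota> p)" for p
  have bij: "bij_betw h (carrier (tensor_algebra s \<iota>)) (carrier_mat m m)"
    using h by (simp add: algebra_iso_def module_mat_simps)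
  have \<eta>c: "\<eta> p \<in> carrier_mat m m" for p
    using bij T(1)[of p] by (auto simp: bij_betw_def \<eta>_def)
  have \<eta>surj: "\<exists>p. X = \<eta> p" if X: "X \<in> carrier_mat m m" for X
  proof -
    have "X \<in> h ` carrier (tensor_algebra s \<iota>)" using X bij_betw_imp_surj_on[OF bij] by simp
    then obtain Y where Y: "Y \<in> carrier (tensor_algebra s \<iota>)" "X = h Y" by blast
    obtain p where "Y = tensor_class s \<iota> p" using T(2)[OF Y(1)] by blast
    then show ?thesis using Y(2) by (auto simp: \<eta>_def)
  qed
  have \<eta>eq: "\<eta> p = \<eta> q \<longleftrightarrow> p - q \<in> tensor_null s \<iota>" for p q
    unfolding \<eta>_def Tc[symmetric]
    by (rule inj_on_eq_iff[OF bij_betw_imp_inj_on[OF bij] T(1) T(1)])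
  have \<eta>add: "\<eta> (p + q) = \<eta> p + \<eta> q" for p q
    using h T(1) unfolding \<eta>_def T(4)[symmetric] algebra_iso_def module_mat_simps by blast
  have \<eta>mult: "\<eta> (free_mult p q) = \<eta> p * \<eta> q" for p q
    using h T(1) unfolding \<eta>_def T(3)[symmetric] algebra_iso_def module_mat_simps by blast
  have \<eta>scale: "\<eta> (free_scale a p) = a \<cdot>\<^sub>m \<eta> p" for a p
    using h T(1) unfolding \<eta>_def T(5)[symmetric] algebra_iso_def module_mat_simps by blast
  define \<psi> where "\<psi> x = \<eta> (frag_of (x, 1))" for x
  have \<eta>of: "\<eta> (frag_of (x, a)) = a \<cdot>\<^sub>m \<psi> x" for x a
    unfolding \<psi>_def \<eta>scale[symmetric] free_scale_of by simp
  have \<psi>c: "\<psi> x \<in> carrier_mat m m" for x by (simp add: \<psi>_def \<eta>c)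
  have \<psi>add: "\<psi> (x + y) = \<psi> x + \<psi> y" for x y
  proof -
    have "frag_of (x + y, 1) - (frag_of (x, 1) + frag_of (y, 1)) \<in> tensor_null s \<iota>"
      using tensor_null.add_left[of x y 1 s \<iota>] by (simp add: algebra_simps)
    then show ?thesis by (simp add: \<psi>_def \<eta>add[symmetric] \<eta>eq)
  qed
  have \<psi>scale: "\<psi> (s c x) = \<iota> c \<cdot>\<^sub>m \<psi> x" for c x
  proof -
    have "\<psi> (s c x) = \<eta> (frag_of (x, \<iota> c))"
      unfolding \<psi>_def using tensor_null.balanced[of s c x 1 \<iota>] by (simp add: \<eta>eq)
    also have "\<dots> = \<iota> c \<cdot>\<^sub>m \<psi> x" by (rule \<eta>of)
    finally show ?thesis .
  qed
  have \<psi>mult: "\<psi> (x * y) = \<psi> x * \<psi> y" for x y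
    by (simp add: \<psi>_def \<eta>mult[symmetric] free_mult_of)
  have \<psi>one: "\<psi> 1 = 1\<^sub>m m"
  proof -
    obtain p where p: "1\<^sub>m m = \<eta> p" using \<eta>surj[of "1\<^sub>m m"] by auto
    have "free_mult p (frag_of (1, 1)) = p"
      by (induction p rule: frag_induct)
         (auto simp: free_mult_zero free_mult_of free_mult_diff_left)
    then have "1\<^sub>m m * \<psi> 1 = 1\<^sub>m m" by (simp add: p \<psi>_def \<eta>mult[symmetric])
    then show ?thesis using \<psi>c[of 1] by simp
  qed
  have entry_add: "\<eta> (p + q) $$ (i, j) = \<eta> p $$ (i, j) + \<eta> q $$ (i, j)" if "i < m" "j < m" for p q i j
    using that \<eta>c[of q] by (auto simp: \<eta>add carrier_matD)
  have entry_diff: "\<eta> (p - q) $$ (i, j) = \<eta> p $$ (i, j) - \<eta> q $$ (i, j)" if "i < m" "j < m" for p q i j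
    using entry_add[OF that, of "p - q" q] by simp
  have entry_zero: "\<eta> 0 $$ (i, j) = 0" if "i < m" "j < m" for i j
    using entry_diff[OF that, of 0 0] by simp
  have entry_sum: "\<eta> (sum g I) $$ (i, j) = (\<Sum>e\<in>I. \<eta> (g e) $$ (i, j))" if "i < m" "j < m" for i j g and I :: "'b set"
    by (induction I rule: infinite_finite_induct) (auto simp: entry_zero entry_add that)
  have entry_of: "\<eta> (frag_of (x, a)) $$ (i, j) = a * \<psi> x $$ (i, j)" if "i < m" "j < m" for x a i j
    using that \<psi>c[of x] by (auto simp: \<eta>of carrier_matD)
  have \<psi>entry: "\<psi> x $$ (i, j) = (\<Sum>e\<in>E. \<iota> (representation E x e) * \<psi> e $$ (i, j))" if "i < m" "j < m" for x i j
  proof -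
    have sums: "\<psi> (sum g I) $$ (i, j) = (\<Sum>e\<in>I. \<psi> (g e) $$ (i, j))" for g and I :: "'b set"
    proof -
      have "\<psi> 0 = 0 \<cdot>\<^sub>m \<psi> 0" using \<psi>scale[of 0 0] by simp
      also have "\<dots> $$ (i, j) = 0" using that \<psi>c[of 0] by (auto simp: carrier_matD)
      finally have "\<psi> 0 $$ (i, j) = 0" .
      moreover have "\<psi> (x + y) $$ (i, j) = \<psi> x $$ (i, j) + \<psi> y $$ (i, j)" for x y
        using that \<psi>c[of y] by (auto simp: \<psi>add carrier_matD)
      ultimately show ?thesis by (induction I rule: infinite_finite_induct) auto
    qed
    have scale: "\<psi> (s c e) $$ (i, j) = \<iota> c * \<psi> e $$ (i, j)" for c e
      using that \<psi>c[of e] by (auto simp: \<psi>scale carrier_matD)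
    have "(\<Sum>e\<in>E. s (representation E x e) e) = x"
      using E by (intro sum_representation_eq) auto
    then have "\<psi> x $$ (i, j) = \<psi> (\<Sum>e\<in>E. s (representation E x e) e) $$ (i, j)" by (simp only:)
    also have "\<dots> = (\<Sum>e\<in>E. \<iota> (representation E x e) * \<psi> e $$ (i, j))"
      by (simp only: sums scale)
    finally show ?thesis .
  qed
  have full: "\<exists>k. \<forall>i<m. \<forall>j<m. \<eta> p $$ (i, j) = (\<Sum>e\<in>E. k e * \<psi> e $$ (i, j))" for p
  proof (induction p rule: frag_induct)
    case zero
    show ?case by (rule exI[of _ "\<lambda>_. 0"]) (simp add: entry_zero)
  next
    case (of z)
    obtain x a where z: "z = (x, a)" by (cases z)
    show ?case
      by (rule exI[of _ "\<lambda>e. a * \<iota> (representation E x e)"])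
         (auto simp: z entry_of \<psi>entry[of _ _ x] sum_distrib_left mult.assoc)
  next
    case (diff p q)
    then obtain k l where "\<forall>i<m. \<forall>j<m. \<eta> p $$ (i, j) = (\<Sum>e\<in>E. k e * \<psi> e $$ (i, j))"
      "\<forall>i<m. \<forall>j<m. \<eta> q $$ (i, j) = (\<Sum>e\<in>E. l e * \<psi> e $$ (i, j))" by blast
    then show ?case
      by (intro exI[of _ "\<lambda>e. k e - l e"]) (simp add: entry_diff left_diff_distrib sum_subtractf)
  qed
  have indep: "k e0 = 0" if z: "\<forall>i<m. \<forall>j<m. (\<Sum>e\<in>E. k e * \<psi> e $$ (i, j)) = 0" and e0: "e0 \<in> E" for k e0
  proof -
    define p where "p = (\<Sum>e\<in>E. frag_of (e, k e))"
    have "\<eta> p = \<eta> 0"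
    proof (rule eq_matI)
      show "\<eta> p $$ (i, j) = \<eta> 0 $$ (i, j)" if "i < dim_row (\<eta> 0)" "j < dim_col (\<eta> 0)" for i j
        using that \<eta>c[of 0] z by (simp add: p_def entry_sum entry_of entry_zero)
    qed (use \<eta>c[of p] \<eta>c[of 0] in auto)
    then have p: "p \<in> tensor_null s \<iota>" using \<eta>eq[of p 0] by simp
    define L where "L = frag_sum (\<lambda>(x, a). \<iota> (representation E x e0) * a)"
    have L: "L (q - r) = L q - L r" "L (frag_of (x, a)) = \<iota> (representation E x e0) * a" "L 0 = 0" for q r x a
      by (simp_all add: L_def frag_sum_diff)
    have Ladd: "L (q + r) = L q + L r" for q r using L(1)[of "q + r" r] by simp
    have "L q = 0" if "q \<in> tensor_null s \<iota>" for q
      using that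
      by induction
         (use E in \<open>auto simp: L Ladd representation_add representation_scale \<iota>.hom_add \<iota>.hom_mult algebra_simps\<close>)
    then have "L p = 0" using p by blast
    have Lsum: "L (sum g I) = (\<Sum>e\<in>I. L (g e))" for g and I :: "'b set"
      by (induction I rule: infinite_finite_induct) (auto simp: L(3) Ladd)
    have "L p = (\<Sum>e\<in>E. if e = e0 then k e else 0)"
      unfolding p_def Lsum L(2)
      by (rule sum.cong) (use E e0 in \<open>auto simp: representation_basis\<close>)
    then show ?thesis using \<open>L p = 0\<close> E(1) e0 by simp
  qed
  have full': "\<exists>k. \<forall>i<m. \<forall>j<m. X $$ (i, j) = (\<Sum>e\<in>E. k e * \<psi> e $$ (i, j))"
    if X: "X \<in> carrier_mat m m" for X
  proof -
    obtain p where "X = \<eta> p" using \<eta>surj[OF X] by blast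
    then show ?thesis using full[of p] by simp
  qed
  show ?thesis
    unfolding splitting_representation_def
    by (rule exI[of _ \<psi>]) (use \<psi>c \<psi>add \<psi>scale \<psi>mult \<psi>one full' indep in blast)
qed

section \<open>The Petit algebra of a split central simple algebra\<close>

context split_algebra
begin

text \<open>
  In the proof, \<open>\<beta> b\<close> is the element of \<open>S\<^sub>f\<close> with \<open>\<beta>(b) w = \<rho>(b) w\<close>. As \<open>\<rho>\<close> is an action from
  the right that commutes with \<open>K[t;\<delta>]\<close>, \<open>\<beta>\<close> is multiplicative:
  \<open>\<beta>(x) (\<beta>(y) w) = \<beta>(x) \<rho>(y) w = \<rho>(y) \<rho>(x) w = \<rho>(x y) w\<close>.
\<close>

lemma petit_algebra_of_splitting:
  assumes char: "char_zero_field TYPE('k)" and \<delta>: "derivation \<delta>" "constants \<delta> = range \<iota>" "range \<iota> \<noteq> UNIV"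
    and N: "finite N" "V \<subseteq> K.span N" and dim: "K.dim V = m" "m \<ge> 2"
    and simple: "\<And>I. ideal I (type_algebra s) \<Longrightarrow> I = {0} \<or> I = UNIV"
  shows "\<exists>f. degree f = m \<and>
    (let S = petit_algebra \<iota> \<delta> f; N = S\<lparr>carrier := nuc_right S\<rparr> in
       (\<exists>\<phi>. algebra_iso N (type_algebra s) \<phi>) \<and>
       nuc_left S = range (\<lambda>a. [:a:]) \<and>
       nuc_middle S = range (\<lambda>a. [:a:]) \<and>
       (\<forall>H. algebra_iso S S H \<longrightarrow>
          H ` nuc_right S = nuc_right S \<and>
          (\<exists>u\<in>Units N. \<forall>x\<in>nuc_right S. H x = u \<otimes>\<^bsub>N\<^esub> x \<otimes>\<^bsub>N\<^esub> inv\<^bsub>N\<^esub> u)))"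
proof -
  have const0: "\<delta> (\<iota> c) = 0" for c using \<delta>(2) by (auto simp: constants_def)
  obtain nabla where nabla: "differential_module scale \<delta> V nabla" "\<And>x v. v \<in> V \<Longrightarrow> nabla (\<rho> x v) = \<rho> x (nabla v)"
    using invariant_connection_exists[OF \<delta>(1) const0] by blast
  interpret D: differential_module scale \<delta> V nabla by (rule nabla(1))
  obtain a0 where a0: "\<delta> a0 \<noteq> 0" using \<delta>(2,3) by (auto simp: constants_def)
  obtain w where w: "w \<in> V" "\<And>x. x \<in> V \<Longrightarrow> \<exists>g. x = D.act g w"
    using D.cyclic_vector[OF char a0 N] by blast
  have m0: "m > 0" using dim(2) by simp
  obtain f where f: "degree f = m" "lead_coeff f = 1" "D.act f w = 0"
    and bij: "bij_betw (\<lambda>g. D.act g w) {g. degree g < m} V"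
    using D.cyclic_presentation[OF w N dim(1) m0] by blast
  interpret P: petit_presentation scale \<delta> V nabla w f m \<iota>
    by unfold_locales (use char a0 w f bij dim(2) in blast)+
  let ?S = "petit_algebra \<iota> \<delta> f"
  let ?N = "?S\<lparr>carrier := nuc_right ?S\<rparr>"
  have pow: "\<rho> b ((nabla ^^ i) v) = (nabla ^^ i) (\<rho> b v)" if "v \<in> V" for b v i
    by (induction i) (use that in \<open>auto simp: nabla(2)[OF D.pow_closed, symmetric]\<close>)
  have \<rho>act: "\<rho> b (D.act g v) = D.act g (\<rho> b v)" if "v \<in> V" for b g v
    unfolding D.act_def using that
    by (simp add: \<rho>_setsum_right scale_closed D.pow_closed \<rho>_scale_right pow)
  have nucE: "\<exists>b. D.act z w = \<rho> b w" if z: "z \<in> nuc_right ?S" for z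
  proof -
    have fz: "D.act f (D.act z w) = 0" using z by (simp add: P.nuc_right_S)
    (* the operator g w \<mapsto> g (z w); it is well defined because f annihilates z w *)
    define T where "T v = D.act (SOME g. D.act g w = v) (D.act z w)" for v
    have zV: "D.act z w \<in> V" by (rule D.act_closed[OF w(1)])
    have well: "D.act g (D.act z w) = D.act h (D.act z w)" if gh: "D.act g w = D.act h w" for g h
    proof -
      obtain q where q: "degree (mod_right \<delta> (g - h) f) < m" "g - h = diff_mult \<delta> q f + mod_right \<delta> (g - h) f"
        by (rule P.mod_right_exists)
      have "D.act (g - h) w = D.act (mod_right \<delta> (g - h) f) w"
        using arg_cong[OF q(2), of "\<lambda>g. D.act g w"]
        by (simp add: D.act_add D.act_diff_mult[OF w(1)] f(3) D.act_zero_right)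
      then have "mod_right \<delta> (g - h) f = 0"
        using q(1) gh m0 by (intro P.eval_inj) (auto simp: D.act_diff)
      then have "D.act (g - h) (D.act z w) = 0"
        using arg_cong[OF q(2), of "\<lambda>g. D.act g (D.act z w)"]
        by (simp add: D.act_diff_mult[OF zV] fz D.act_zero_right)
      then show ?thesis by (simp add: D.act_diff)
    qed
    have T: "T (D.act g w) = D.act g (D.act z w)" for g
      unfolding T_def by (rule well) (rule someI[of "\<lambda>h. D.act h w = D.act g w" g, OF refl])
    have "\<exists>b. \<forall>v\<in>V. T v = \<rho> b v"
    proof (rule commutant_of_connection[OF nabla \<delta>(2)])
      fix u v a assume v: "v \<in> V"
      then obtain g where g: "v = D.act g w" using w(2) by blast
      show "T v \<in> V" unfolding g T by (rule D.act_closed[OF zV])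
      show "T (a *v v) = a *v T v" using T[of "Polynomial.smult a g"] by (simp add: g T D.act_smult)
      show "T (nabla v) = nabla (T v)" using T[of "t_mult \<delta> g"] by (simp add: g T D.act_t_mult w(1) zV)
      show "T (u + v) = T u + T v" if uV: "u \<in> V"
      proof -
        obtain h where h: "u = D.act h w" using w(2) uV by blast
        show ?thesis using T[of "h + g"] by (simp add: g h T D.act_add)
      qed
    qed
    then obtain b where "\<And>v. v \<in> V \<Longrightarrow> T v = \<rho> b v" by blast
    then have "T (D.act 1 w) = \<rho> b w" using w(1) D.act_const[of 1 w] by (simp add: one_pCons)
    then show ?thesis unfolding T by (metis D.act_const K.scale_one D.act_closed one_pCons)
  qed
  define \<beta> where "\<beta> b = inv_into {g. degree g < m} (\<lambda>g. D.act g w) (\<rho> b w)" for b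
  have \<beta>: "degree (\<beta> b) < m" "D.act (\<beta> b) w = \<rho> b w" for b
  proof -
    have "\<rho> b w \<in> (\<lambda>g. D.act g w) ` {g. degree g < m}"
      using bij \<rho>_closed[OF w(1)] by (simp add: bij_betw_def)
    from inv_into_into[OF this] f_inv_into_f[OF this]
    show "degree (\<beta> b) < m" "D.act (\<beta> b) w = \<rho> b w" by (auto simp: \<beta>_def)
  qed
  have \<beta>eqI: "z = \<beta> b" if "degree z < m" "D.act z w = \<rho> b w" for z b
    using P.eval_inj[OF that(1) \<beta>(1)] that(2) \<beta>(2) by metis
  have range_\<beta>: "range \<beta> = nuc_right ?S"
  proof (intro equalityI subsetI)
    fix z assume "z \<in> range \<beta>"
    then obtain b where b: "z = \<beta> b" by blast
    have "D.act f (\<rho> b w) = 0" unfolding \<rho>act[OF w(1), symmetric] f(3) by (rule \<rho>_zero_right)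
    then show "z \<in> nuc_right ?S" by (simp add: P.nuc_right_S b \<beta>)
  next
    fix z assume z: "z \<in> nuc_right ?S"
    then obtain b where "D.act z w = \<rho> b w" using nucE by blast
    then show "z \<in> range \<beta>" using \<beta>eqI[of z b] z by (auto simp: P.nuc_right_S)
  qed
  have inj_\<beta>: "inj \<beta>"
  proof (rule injI)
    fix b c assume eq: "\<beta> b = \<beta> c"
    have "b - c = 0"
    proof (rule faithful)
      fix v assume "v \<in> V"
      then obtain g where g: "v = D.act g w" using w(2) by blast
      have "\<rho> b w = \<rho> c w" using \<beta>(2)[of b] \<beta>(2)[of c] eq by simp
      then have "\<rho> (b - c) w = 0" by (simp add: \<rho>_diff[OF w(1)])
      then show "\<rho> (b - c) v = 0" by (simp add: g \<rho>act[OF w(1)] D.act_zero_right)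
    qed
    then show "b = c" by simp
  qed
  have \<beta>add: "\<beta> (x + y) = \<beta> x + \<beta> y" for x y
    by (rule \<beta>eqI[symmetric]) (simp_all add: \<beta> D.act_add \<rho>_add[OF w(1)] degree_add_less)
  have \<beta>scale: "\<beta> (s c x) = Polynomial.smult (\<iota> c) (\<beta> x)" for c x
    by (rule \<beta>eqI[symmetric]) (use \<beta>(1)[of x] m0 in \<open>simp_all add: \<beta> D.act_smult \<rho>_scale[OF w(1)]\<close>)
  have \<beta>mult: "\<beta> (x * y) = \<beta> x \<otimes>\<^bsub>?S\<^esub> \<beta> y" for x y
  proof (rule \<beta>eqI[symmetric, OF P.mult_closed_S])
    have "D.act (\<beta> x \<otimes>\<^bsub>?S\<^esub> \<beta> y) w = D.act (\<beta> x) (\<rho> y w)" by (simp add: P.eval_mult_S \<beta>)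
    also have "\<dots> = \<rho> y (D.act (\<beta> x) w)" by (rule \<rho>act[OF w(1), symmetric])
    also have "\<dots> = \<rho> (x * y) w" by (simp add: \<beta> \<rho>_mult[OF w(1)])
    finally show "D.act (\<beta> x \<otimes>\<^bsub>?S\<^esub> \<beta> y) w = \<rho> (x * y) w" .
  qed
  have \<beta>one: "\<beta> 1 = 1"
    by (rule \<beta>eqI[symmetric]) (use m0 D.act_const[of 1 w] in \<open>simp_all add: \<rho>_one[OF w(1)] one_pCons\<close>)
  have iso: "algebra_iso ?N (type_algebra s) (inv_into UNIV \<beta>)"
    unfolding algebra_iso_def
  proof (intro conjI ballI allI)
    show "bij_betw (inv_into UNIV \<beta>) (carrier ?N) (carrier (type_algebra s))"
      using bij_betw_inv_into[of \<beta> UNIV "nuc_right ?S"] inj_\<beta> range_\<beta>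
      by (simp add: bij_betw_def type_algebra_def)
    fix x y c assume "x \<in> carrier ?N"
    then obtain b where b: "x = \<beta> b" using range_\<beta> by auto
    show "inv_into UNIV \<beta> (c \<odot>\<^bsub>?N\<^esub> x) = c \<odot>\<^bsub>type_algebra s\<^esub> inv_into UNIV \<beta> x"
      using \<beta>scale[of c b] inj_\<beta> by (simp add: b petit_algebra_def type_algebra_def inv_into_f_eq)
    assume "y \<in> carrier ?N"
    then obtain b' where b': "y = \<beta> b'" using range_\<beta> by auto
    show "inv_into UNIV \<beta> (x \<oplus>\<^bsub>?N\<^esub> y) = inv_into UNIV \<beta> x \<oplus>\<^bsub>type_algebra s\<^esub> inv_into UNIV \<beta> y"
      using \<beta>add[of b b'] inj_\<beta> by (simp add: b b' petit_algebra_def type_algebra_def inv_into_f_eq)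
    show "inv_into UNIV \<beta> (x \<otimes>\<^bsub>?N\<^esub> y) = inv_into UNIV \<beta> x \<otimes>\<^bsub>type_algebra s\<^esub> inv_into UNIV \<beta> y"
      using \<beta>mult[of b b'] inj_\<beta> by (simp add: b b' type_algebra_def inv_into_f_eq)
  qed
  have auts: "\<exists>u\<in>Units ?N. \<forall>x\<in>nuc_right ?S. H x = u \<otimes>\<^bsub>?N\<^esub> x \<otimes>\<^bsub>?N\<^esub> inv\<^bsub>?N\<^esub> u"
    if H: "algebra_iso ?S ?S H" for H
  proof -
    have img: "H ` nuc_right ?S = nuc_right ?S" by (rule P.automorphism_image_nuc_right[OF H])
    have Hinj: "inj_on H (carrier ?S)" using H by (simp add: algebra_iso_def bij_betw_def)
    have \<beta>c: "\<beta> x \<in> carrier ?S" for x by (simp add: P.carrier_S \<beta>)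
    define \<phi> where "\<phi> x = inv_into UNIV \<beta> (H (\<beta> x))" for x
    have \<phi>: "\<beta> (\<phi> x) = H (\<beta> x)" for x
    proof -
      have "H (\<beta> x) \<in> range \<beta>" unfolding range_\<beta> using img range_\<beta> by blast
      then show ?thesis by (simp add: \<phi>_def f_inv_into_f)
    qed
    have Hadd: "H (\<beta> x + \<beta> y) = H (\<beta> x) + H (\<beta> y)" for x y
      by (rule P.automorphism_add[OF H]) (rule \<beta>)+
    have Hmult: "H (\<beta> x \<otimes>\<^bsub>?S\<^esub> \<beta> y) = H (\<beta> x) \<otimes>\<^bsub>?S\<^esub> H (\<beta> y)" for x y
      using H \<beta>c unfolding algebra_iso_def by blast
    have Hscale: "H (Polynomial.smult (\<iota> c) (\<beta> x)) = Polynomial.smult (\<iota> c) (H (\<beta> x))" for c x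
      using H \<beta>c[of x] by (auto simp: algebra_iso_def petit_algebra_def)
    have bij\<phi>: "bij \<phi>"
    proof (rule bijI)
      show "inj \<phi>"
      proof (rule injI)
        fix x y assume "\<phi> x = \<phi> y"
        then have "H (\<beta> x) = H (\<beta> y)" using \<phi> by metis
        then show "x = y" using inj_onD[OF Hinj _ \<beta>c \<beta>c] injD[OF inj_\<beta>] by blast
      qed
      have "\<exists>x. y = \<phi> x" for y
      proof -
        have "\<beta> y \<in> H ` range \<beta>" using img range_\<beta> by blast
        then obtain x where "\<beta> y = H (\<beta> x)" by blast
        then have "\<beta> y = \<beta> (\<phi> x)" by (simp add: \<phi>)
        then show ?thesis using injD[OF inj_\<beta>] by blast
      qed
      then show "surj \<phi>" by (auto simp: surj_def)
    qed
    have "\<exists>u u'. u * u' = 1 \<and> u' * u = 1 \<and> (\<forall>x. \<phi> x = u * x * u')"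
    proof (rule skolem_noether[OF simple _ _ _ bij\<phi>])
      show "\<phi> (x + y) = \<phi> x + \<phi> y" for x y
        by (rule injD[OF inj_\<beta>]) (simp add: \<beta>add \<phi> Hadd)
      show "\<phi> (s c x) = s c (\<phi> x)" for c x
        by (rule injD[OF inj_\<beta>]) (simp add: \<beta>scale \<phi> Hscale)
      show "\<phi> (x * y) = \<phi> x * \<phi> y" for x y
        by (rule injD[OF inj_\<beta>]) (simp add: \<beta>mult \<phi> Hmult)
    qed
    then obtain u u' where u: "u * u' = 1" "u' * u = 1" "\<And>x. \<phi> x = u * x * u'" by blast
    have oneN: "\<one>\<^bsub>?N\<^esub> = \<beta> 1" by (simp add: petit_algebra_def \<beta>one)
    have unit: "\<beta> u \<otimes>\<^bsub>?N\<^esub> \<beta> u' = \<one>\<^bsub>?N\<^esub>" "\<beta> u' \<otimes>\<^bsub>?N\<^esub> \<beta> u = \<one>\<^bsub>?N\<^esub>"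
      unfolding oneN using \<beta>mult[of u u'] \<beta>mult[of u' u] u by simp_all
    have cN: "\<beta> x \<in> carrier ?N" for x using range_\<beta> by auto
    have "\<beta> u \<in> Units ?N" unfolding Units_def using unit cN by blast
    moreover have inv: "inv\<^bsub>?N\<^esub> (\<beta> u) = \<beta> u'"
      unfolding m_inv_def
    proof (rule the_equality)
      show "\<beta> u' \<in> carrier ?N \<and> \<beta> u \<otimes>\<^bsub>?N\<^esub> \<beta> u' = \<one>\<^bsub>?N\<^esub> \<and> \<beta> u' \<otimes>\<^bsub>?N\<^esub> \<beta> u = \<one>\<^bsub>?N\<^esub>"
        using unit cN by blast
      fix y assume y: "y \<in> carrier ?N \<and> \<beta> u \<otimes>\<^bsub>?N\<^esub> y = \<one>\<^bsub>?N\<^esub> \<and> y \<otimes>\<^bsub>?N\<^esub> \<beta> u = \<one>\<^bsub>?N\<^esub>"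
      then obtain z where z: "y = \<beta> z" using range_\<beta> by auto
      have "\<beta> (u * z) = \<beta> 1" using y unfolding oneN by (simp add: \<beta>mult z)
      then have "u * z = 1" by (rule injD[OF inj_\<beta>])
      then have "u' * (u * z) = u'" by simp
      then have "z = u'" by (simp add: mult.assoc[symmetric] u(2))
      then show "y = \<beta> u'" by (simp add: z)
    qed
    moreover have "H x = \<beta> u \<otimes>\<^bsub>?N\<^esub> x \<otimes>\<^bsub>?N\<^esub> \<beta> u'" if xN: "x \<in> nuc_right ?S" for x
    proof -
      obtain b where b: "x = \<beta> b" using xN range_\<beta> by blast
      have "H x = \<beta> (u * b * u')" unfolding b \<phi>[symmetric] u(3) ..
      then show ?thesis by (simp add: \<beta>mult b)
    qed
    ultimately show ?thesis by (intro bexI[of _ "\<beta> u"] ballI) simp_all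
  qed
  show ?thesis
    unfolding Let_def
  proof (rule exI[of _ f], intro conjI allI impI)
    show "degree f = m" by (rule f(1))
    show "\<exists>\<phi>. algebra_iso ?N (type_algebra s) \<phi>" by (rule exI) (rule iso)
    show "nuc_left ?S = range (\<lambda>a. [:a:])" "nuc_middle ?S = range (\<lambda>a. [:a:])"
      by (rule P.nuc_left_S, rule P.nuc_middle_S)
    fix H assume H: "algebra_iso ?S ?S H"
    show "H ` nuc_right ?S = nuc_right ?S" by (rule P.automorphism_image_nuc_right[OF H])
    show "\<exists>u\<in>Units ?N. \<forall>x\<in>nuc_right ?S. H x = u \<otimes>\<^bsub>?N\<^esub> x \<otimes>\<^bsub>?N\<^esub> inv\<^bsub>?N\<^esub> u"
      by (rule auts[OF H])
  qed
qed

end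

section \<open>The splitting as an action on rows\<close>

lemma fun_sum_apply: "(\<Sum>i\<in>I. g i) x = (\<Sum>i\<in>I. g i x)" for g :: "'i \<Rightarrow> 'a \<Rightarrow> 'c::comm_monoid_add"
  by (induction I rule: infinite_finite_induct) auto

text \<open>
  Rows of length \<open>m\<close> are functions that vanish from \<open>m\<close> on, so that they live in a type that is an
  additive group. Algebra elements act by multiplication with a matrix from the right.
\<close>

definition row_space :: "nat \<Rightarrow> (nat \<Rightarrow> 'k::field) set" where
  "row_space m = {v. \<forall>i\<ge>m. v i = 0}"

definition row_scale :: "'k::field \<Rightarrow> (nat \<Rightarrow> 'k) \<Rightarrow> nat \<Rightarrow> 'k" where
  "row_scale a v = (\<lambda>i. a * v i)"

definition row_unit :: "nat \<Rightarrow> nat \<Rightarrow> 'k::field" where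
  "row_unit i = (\<lambda>j. of_bool (i = j))"

lemma vector_space_row: "vector_space (row_scale :: 'k::field \<Rightarrow> _)"
  by standard (auto simp: row_scale_def fun_eq_iff algebra_simps)

lemma row_expand:
  assumes "(v :: nat \<Rightarrow> 'k::field) \<in> row_space m"
  shows "v = (\<Sum>i\<in>{0..<m}. row_scale (v i) (row_unit i))"
proof
  fix j
  have "(\<Sum>i\<in>{0..<m}. row_scale (v i) (row_unit i) j) = (\<Sum>i\<in>{0..<m}. if i = j then v i else 0)"
    by (rule sum.cong) (auto simp: row_scale_def row_unit_def)
  then show "v j = (\<Sum>i\<in>{0..<m}. row_scale (v i) (row_unit i)) j"
    using assms by (auto simp: fun_sum_apply row_space_def)
qed

lemma row_unit_closed: "i < m \<Longrightarrow> row_unit i \<in> row_space m"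
  by (auto simp: row_unit_def row_space_def)

lemma dim_row_space:
  "(row_space m :: (nat \<Rightarrow> 'k::field) set) \<subseteq> Modules.module.span row_scale (row_unit ` {0..<m})"
  "vector_space.dim row_scale (row_space m :: (nat \<Rightarrow> 'k::field) set) = m"
proof -
  interpret vector_space "row_scale :: 'k \<Rightarrow> (nat \<Rightarrow> 'k) \<Rightarrow> nat \<Rightarrow> 'k" by (rule vector_space_row)
  have inj: "inj_on (row_unit :: nat \<Rightarrow> nat \<Rightarrow> 'k) {0..<m}"
    by (auto simp: inj_on_def row_unit_def fun_eq_iff)
  show sp: "(row_space m :: (nat \<Rightarrow> 'k) set) \<subseteq> span (row_unit ` {0..<m})"
  proof
    fix v :: "nat \<Rightarrow> 'k" assume v: "v \<in> row_space m"
    show "v \<in> span (row_unit ` {0..<m})"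
      by (subst row_expand[OF v]) (intro span_sum span_scale span_base imageI)
  qed
  have "independent (row_unit ` {0..<m} :: (nat \<Rightarrow> 'k) set)"
  proof (rule independent_if_scalars_zero)
    fix r :: "(nat \<Rightarrow> 'k) \<Rightarrow> 'k" and x :: "nat \<Rightarrow> 'k" assume z: "(\<Sum>x\<in>row_unit ` {0..<m}. row_scale (r x) x) = 0" and x: "x \<in> row_unit ` {0..<m}"
    obtain i where i: "i < m" "x = row_unit i" using x by auto
    have "(\<Sum>j\<in>{0..<m}. row_scale (r (row_unit j)) (row_unit j)) i = 0"
      using z sum.reindex[OF inj, of "\<lambda>x. row_scale (r x) x"] by simp
    moreover have "(\<Sum>j\<in>{0..<m}. row_scale (r (row_unit j)) (row_unit j) i) = (\<Sum>j\<in>{0..<m}. if j = i then r (row_unit j) else 0)"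
      by (rule sum.cong) (auto simp: row_scale_def row_unit_def)
    ultimately show "r x = 0" using i by (simp add: fun_sum_apply)
  qed simp
  then show "dim (row_space m :: (nat \<Rightarrow> 'k) set) = m"
    using sp inj by (intro dim_unique) (auto simp: row_unit_closed card_image)
qed

definition row_action :: "nat \<Rightarrow> ('b \<Rightarrow> 'k::field mat) \<Rightarrow> 'b \<Rightarrow> (nat \<Rightarrow> 'k) \<Rightarrow> nat \<Rightarrow> 'k" where
  "row_action m \<psi> x v = (\<lambda>j. if j < m then \<Sum>i\<in>{0..<m}. v i * \<psi> x $$ (i, j) else 0)"

lemma split_algebra_row_space:
  fixes s :: "'f::field \<Rightarrow> 'b::ring_1 \<Rightarrow> 'b" and \<iota> :: "'f \<Rightarrow> 'k::field"
  assumes s_mult: "\<And>c x y. s c (x * y) = s c x * y" "\<And>c x y. s c (x * y) = x * s c y"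
    and vs: "vector_space s" and hom: "field_hom \<iota>"
    and E: "finite E" "\<not> Modules.module.dependent s E" "Modules.module.span s E = UNIV"
    and splits: "splits \<iota> s m" and m: "m > 0"
  shows "\<exists>\<rho>. split_algebra row_scale s \<iota> (row_space m) E \<rho>"
proof -
  obtain \<psi> :: "'b \<Rightarrow> 'k mat" where "splitting_representation s \<iota> m E \<psi>"
    using splitting_representation_exists[OF s_mult vs hom E splits] by blast
  note this[unfolded splitting_representation_def]
  then have \<psi>: "\<psi> x \<in> carrier_mat m m" "\<psi> (x + y) = \<psi> x + \<psi> y" "\<psi> (s c x) = \<iota> c \<cdot>\<^sub>m \<psi> x"
      "\<psi> (x * y) = \<psi> x * \<psi> y" "\<psi> 1 = 1\<^sub>m m"
    and full: "\<forall>X\<in>carrier_mat m m. \<exists>k. \<forall>i<m. \<forall>j<m. X $$ (i, j) = (\<Sum>e\<in>E. k e * \<psi> e $$ (i, j))"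
    and indep: "\<forall>k. (\<forall>i<m. \<forall>j<m. (\<Sum>e\<in>E. k e * \<psi> e $$ (i, j)) = 0) \<longrightarrow> (\<forall>e\<in>E. k e = 0)" for x y c
    by simp_all
  have dims: "dim_row (\<psi> x) = m" "dim_col (\<psi> x) = m" for x using \<psi>(1)[of x] by auto
  interpret K: vector_space "row_scale :: 'k \<Rightarrow> (nat \<Rightarrow> 'k) \<Rightarrow> nat \<Rightarrow> 'k" by (rule vector_space_row)
  interpret B: vector_space s by (rule vs)
  interpret \<iota>: field_hom \<iota> by (rule hom)
  let ?\<rho> = "row_action m \<psi>"
  have "split_algebra row_scale s \<iota> (row_space m) E ?\<rho>"
  proof
    show "s c (x * y) = s c x * y" "s c (x * y) = x * s c y" for c x y by (fact s_mult)+
    show "K.subspace (row_space m)"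
      by (rule K.subspaceI) (auto simp: row_space_def row_scale_def)
    have "row_unit 0 \<in> row_space m" using m by (rule row_unit_closed)
    moreover have "(row_unit 0 :: nat \<Rightarrow> 'k) \<noteq> 0"
      by (auto simp: row_unit_def fun_eq_iff)
    ultimately show "row_space m \<noteq> {0 :: nat \<Rightarrow> 'k}" by blast
    show "finite E" "B.independent E" "B.span E = UNIV" by (fact E)+
    show "?\<rho> x v \<in> row_space m" for x v by (auto simp: row_action_def row_space_def)
    show "?\<rho> x (u + v) = ?\<rho> x u + ?\<rho> x v" for x u v
      by (auto simp: row_action_def fun_eq_iff distrib_right sum.distrib)
    show "?\<rho> x (row_scale a v) = row_scale a (?\<rho> x v)" for x a v
      by (auto simp: row_action_def row_scale_def fun_eq_iff sum_distrib_left mult.assoc)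
    show "?\<rho> (x + y) v = ?\<rho> x v + ?\<rho> y v" for x y v
      by (auto simp: row_action_def fun_eq_iff \<psi>(2) dims distrib_left sum.distrib)
    show "?\<rho> (s c x) v = row_scale (\<iota> c) (?\<rho> x v)" for c x v
      by (auto simp: row_action_def row_scale_def fun_eq_iff \<psi>(3) dims sum_distrib_left ac_simps)
    show "?\<rho> (x * y) v = ?\<rho> y (?\<rho> x v)" for x y v
    proof
      fix j
      show "?\<rho> (x * y) v j = ?\<rho> y (?\<rho> x v) j"
      proof (cases "j < m")
        case True
        have "?\<rho> (x * y) v j = (\<Sum>i\<in>{0..<m}. \<Sum>l\<in>{0..<m}. v i * \<psi> x $$ (i, l) * \<psi> y $$ (l, j))"
          using True by (simp add: row_action_def \<psi>(4) dims scalar_prod_def sum_distrib_left mult.assoc)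
        also have "\<dots> = ?\<rho> y (?\<rho> x v) j"
          using True by (subst sum.swap) (simp add: row_action_def sum_distrib_right)
        finally show ?thesis .
      qed (simp add: row_action_def)
    qed
    show "?\<rho> 1 v = v" if v: "v \<in> row_space m" for v
    proof
      fix j
      have "(\<Sum>i\<in>{0..<m}. v i * (1\<^sub>m m) $$ (i, j)) = (\<Sum>i\<in>{0..<m}. if i = j then v i else 0)" if "j < m"
        by (rule sum.cong) (use that in auto)
      then show "?\<rho> 1 v j = v j" using v by (auto simp: row_action_def \<psi>(5) row_space_def)
    qed
    show "k e = 0" if z: "\<And>v. v \<in> row_space m \<Longrightarrow> (\<Sum>e\<in>E. row_scale (k e) (?\<rho> e v)) = 0" and e: "e \<in> E" for k e
    proof (rule indep[rule_format, OF _ e])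
      fix i j assume ij: "i < m" "j < m"
      have "?\<rho> e (row_unit i) j = \<psi> e $$ (i, j)" for e
      proof -
        have "(\<Sum>l\<in>{0..<m}. row_unit i l * \<psi> e $$ (l, j)) = (\<Sum>l\<in>{0..<m}. if l = i then \<psi> e $$ (l, j) else 0)"
          by (rule sum.cong) (auto simp: row_unit_def)
        then show ?thesis using ij by (simp add: row_action_def)
      qed
      then show "(\<Sum>e\<in>E. k e * \<psi> e $$ (i, j)) = 0"
        using fun_cong[OF z[OF row_unit_closed[OF ij(1)]], of j] by (simp add: fun_sum_apply row_scale_def)
    qed
    show "\<exists>k. \<forall>v\<in>row_space m. T v = (\<Sum>e\<in>E. row_scale (k e) (?\<rho> e v))"
      if T: "\<And>v. v \<in> row_space m \<Longrightarrow> T v \<in> row_space m"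
        "\<And>u v. u \<in> row_space m \<Longrightarrow> v \<in> row_space m \<Longrightarrow> T (u + v) = T u + T v"
        "\<And>a v. v \<in> row_space m \<Longrightarrow> T (row_scale a v) = row_scale a (T v)" for T
    proof -
      define X where "X = mat m m (\<lambda>(i, j). T (row_unit i) j)"
      obtain k where k: "\<And>i j. i < m \<Longrightarrow> j < m \<Longrightarrow> T (row_unit i) j = (\<Sum>e\<in>E. k e * \<psi> e $$ (i, j))"
        using full[rule_format, of X] by (auto simp: X_def)
      have zero: "0 \<in> row_space m" "T 0 = 0"
        using T(3)[of 0 0] by (auto simp: row_space_def row_scale_def fun_eq_iff zero_fun_def)
      have Tsum: "T (sum g I) = (\<Sum>i\<in>I. T (g i)) \<and> sum g I \<in> row_space m"
        if "\<And>i. i \<in> I \<Longrightarrow> g i \<in> row_space m" for g and I :: "nat set"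
        using that
        by (induction I rule: infinite_finite_induct) (auto simp: zero T(2), auto simp: row_space_def)
      have sc: "row_scale a v \<in> row_space m" if "v \<in> row_space m" for a v
        using that by (auto simp: row_space_def row_scale_def)
      have "T v = (\<Sum>e\<in>E. row_scale (k e) (?\<rho> e v))" if v: "v \<in> row_space m" for v
      proof
        fix j
        show "T v j = (\<Sum>e\<in>E. row_scale (k e) (?\<rho> e v)) j"
        proof (cases "j < m")
          case True
          have "T v = T (\<Sum>i\<in>{0..<m}. row_scale (v i) (row_unit i))" using row_expand[OF v] by simp
          also have "\<dots> = (\<Sum>i\<in>{0..<m}. T (row_scale (v i) (row_unit i)))"
            by (intro conjunct1[OF Tsum] sc row_unit_closed) auto
          also have "\<dots> = (\<Sum>i\<in>{0..<m}. row_scale (v i) (T (row_unit i)))"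
            by (rule sum.cong) (auto simp: T(3) row_unit_closed)
          finally have "T v j = (\<Sum>i\<in>{0..<m}. \<Sum>e\<in>E. v i * (k e * \<psi> e $$ (i, j)))"
            using True by (simp add: fun_sum_apply row_scale_def k sum_distrib_left)
          also have "\<dots> = (\<Sum>e\<in>E. row_scale (k e) (?\<rho> e v)) j"
            using True by (subst sum.swap)
              (simp add: fun_sum_apply row_scale_def row_action_def sum_distrib_left ac_simps)
          finally show ?thesis .
        next
          case False
          then show ?thesis using T(1)[OF v] by (simp add: row_space_def fun_sum_apply row_scale_def row_action_def)
        qed
      qed
      then show ?thesis by blast
    qed
  qed
  then show ?thesis by blast
qed

section \<open>The main theorem\<close>

lemma petit_algebra_infinite_dimensional:
  fixes \<iota> :: "'f::field \<Rightarrow> 'k::field"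
  assumes hom: "field_hom \<iota>" and closed: "algebraically_closed_in \<iota>" and proper: "range \<iota> \<noteq> UNIV"
    and f: "degree f > 0"
  shows "\<not> finite_dimensional_on (smult (petit_algebra \<iota> \<delta> f)) (carrier (petit_algebra \<iota> \<delta> f))"
proof
  interpret \<iota>: field_hom \<iota> by (rule hom)
  define sc where "sc c = (Polynomial.smult (\<iota> c) :: 'k poly \<Rightarrow> 'k poly)" for c
  interpret vector_space sc
    by standard (auto simp: sc_def smult_add_right smult_add_left \<iota>.hom_add \<iota>.hom_mult)
  assume "finite_dimensional_on (smult (petit_algebra \<iota> \<delta> f)) (carrier (petit_algebra \<iota> \<delta> f))"
  then obtain X where X: "finite X" "{g. degree g < degree f} \<subseteq> span X"
    by (auto simp: finite_dimensional_on_def petit_algebra_def sc_def[abs_def])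
  obtain a where a: "a \<notin> range \<iota>" using proper by blast
  have root: "p = 0" if "poly (map_poly \<iota> p) a = 0" for p
    using closed that a by (auto simp: algebraically_closed_in_def)
  have inj: "inj (\<lambda>i::nat. [:a ^ i:])"
  proof (rule injI)
    fix i j :: nat assume "[:a ^ i:] = [:a ^ j:]"
    moreover have "map_poly \<iota> (monom 1 i - monom 1 j) = monom 1 i - monom 1 j"
      by (rule poly_eqI) (simp add: coeff_map_poly \<iota>.hom_minus)
    ultimately have "poly (map_poly \<iota> (monom 1 i - monom 1 j)) a = 0"
      by (simp add: poly_monom)
    then have "monom (1::'f) i = monom 1 j" using root by fastforce
    then show "i = j" by (metis degree_monom_eq zero_neq_one)
  qed
  define A where "A = (\<lambda>i. [:a ^ i:]) ` {..card X}"
  have "independent A"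
  proof (rule independent_if_scalars_zero)
    fix r x assume z: "(\<Sum>x\<in>A. sc (r x) x) = 0" and x: "x \<in> A"
    obtain i where i: "i \<le> card X" "x = [:a ^ i:]" using x by (auto simp: A_def)
    define p where "p = (\<Sum>i\<le>card X. monom (r [:a ^ i:]) i)"
    have "(\<Sum>i\<le>card X. sc (r [:a ^ i:]) [:a ^ i:]) = 0"
      using z sum.reindex[OF inj_on_subset[OF inj subset_UNIV], where A = "{..card X}" and g = "\<lambda>x. sc (r x) x"]
      by (simp add: A_def)
    then have "poly (\<Sum>i\<le>card X. sc (r [:a ^ i:]) [:a ^ i:]) 0 = 0" by simp
    then have "(\<Sum>i\<le>card X. \<iota> (r [:a ^ i:]) * a ^ i) = 0" by (simp add: sc_def poly_sum)
    moreover have "map_poly \<iota> p = (\<Sum>i\<le>card X. monom (\<iota> (r [:a ^ i:])) i)"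
      by (rule poly_eqI) (simp add: p_def coeff_map_poly coeff_sum \<iota>.hom_sum if_distrib cong: if_cong)
    ultimately have "poly (map_poly \<iota> p) a = 0" by (simp add: poly_sum poly_monom)
    then have "p = 0" by (rule root)
    then have "coeff p i = 0" by simp
    then show "r x = 0" using i by (simp add: p_def coeff_sum)
  qed (simp add: A_def)
  moreover have "A \<subseteq> span X" using X(2) f by (auto simp: A_def)
  ultimately have "card A \<le> card X" using independent_span_bound[OF X(1)] by blast
  moreover have "card A = Suc (card X)" unfolding A_def by (subst card_image) (auto intro: inj_on_subset[OF inj])
  ultimately show False by simp
qed

theorem theorem8:
  fixes \<iota> :: "'f::field_char_0 \<Rightarrow> 'k::field"
    and s :: "'f \<Rightarrow> 'b::ring_1 \<Rightarrow> 'b"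
    and m :: nat
  assumes "field_hom \<iota>"
    and "range \<iota> \<noteq> UNIV"
    and "algebraically_closed_in \<iota>"
    and "central_simple_algebra s"
    and "algebra_degree s = real m"
    and "m \<ge> 2"
    and "splits \<iota> s m"
  shows "\<exists>\<delta> f. derivation \<delta> \<and> constants \<delta> = range \<iota> \<and> degree f = m \<and>
    (let S = petit_algebra \<iota> \<delta> f; N = S\<lparr>carrier := nuc_right S\<rparr> in
       \<not> finite_dimensional_on (smult S) (carrier S) \<and>
       (\<exists>\<phi>. algebra_iso N (type_algebra s) \<phi>) \<and>
       nuc_left S = range (\<lambda>a. [:a:]) \<and>
       nuc_middle S = range (\<lambda>a. [:a:]) \<and>
       (\<forall>H. algebra_iso S S H \<longrightarrow>
          H ` nuc_right S = nuc_right S \<and>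
          (\<exists>u\<in>Units N. \<forall>x\<in>nuc_right S. H x = u \<otimes>\<^bsub>N\<^esub> x \<otimes>\<^bsub>N\<^esub> inv\<^bsub>N\<^esub> u)))"
proof -
  interpret \<iota>: field_hom \<iota> by (rule assms(1))
  have char: "char_zero_field TYPE('k)"
  proof
    fix n
    have "\<iota> (of_nat (Suc n)) \<noteq> 0" by (simp del: of_nat_Suc)
    then show "of_nat (Suc n) \<noteq> (0::'k)" by (simp only: \<iota>.hom_of_nat not_False_eq_True)
  qed
  have F: "subfield_set (range \<iota>)"
    unfolding subfield_set_def
    by (auto simp: \<iota>.hom_minus[symmetric] \<iota>.hom_mult[symmetric] \<iota>.hom_inverse[symmetric] intro: range_eqI[of _ _ 1])
  have closed: "x \<in> range \<iota>" if "algebraic_over (range \<iota>) x" for x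
  proof -
    obtain p where p: "p \<in> polys_over (range \<iota>)" "p \<noteq> 0" "poly p x = 0" using \<open>algebraic_over (range \<iota>) x\<close> by (auto simp: algebraic_over_def)
    have inv0: "inv_into UNIV \<iota> 0 = 0" by (rule inv_into_f_eq) (auto simp: inj_def)
    have "map_poly \<iota> (map_poly (inv_into UNIV \<iota>) p) = p"
      using p(1) by (intro poly_eqI) (auto simp: coeff_map_poly inv0 polys_over_def f_inv_into_f)
    then have "map_poly (inv_into UNIV \<iota>) p \<noteq> 0" "poly (map_poly \<iota> (map_poly (inv_into UNIV \<iota>) p)) x = 0" using p(2,3) by auto
    then show ?thesis using assms(3) unfolding algebraically_closed_in_def by blast
  qed
  obtain \<delta> where \<delta>: "derivation \<delta>" "constants \<delta> = range \<iota>"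
    using exists_derivation_with_constants[OF char F closed assms(2)] by blast
  have vs: "vector_space s" and sm: "\<And>c x y. s c (x * y) = s c x * y" "\<And>c x y. s c (x * y) = x * s c y"
    and fin: "finite_dimensional_on s UNIV" and simple: "\<And>I. ideal I (type_algebra s) \<Longrightarrow> I = {0} \<or> I = UNIV"
    using assms(4) unfolding central_simple_algebra_def by blast+
  interpret B: vector_space s by (rule vs)
  obtain X where X: "finite X" "UNIV \<subseteq> B.span X" using fin by (auto simp: finite_dimensional_on_def)
  obtain E where E: "B.independent E" "B.span E = UNIV" "finite E"
    using B.finite_basis_in[OF empty_subsetI B.independent_empty X(2,1)] by blast
  have m: "m > 0" using assms(6) by simp
  obtain \<rho> where "split_algebra row_scale s \<iota> (row_space m) E \<rho>"
    using split_algebra_row_space[OF sm vs assms(1) E(3,1,2) assms(7) m] by blast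
  then interpret SA: split_algebra row_scale s \<iota> "row_space m" E \<rho> .
  obtain f where f: "degree f = m" and props: "let S = petit_algebra \<iota> \<delta> f; N = S\<lparr>carrier := nuc_right S\<rparr> in
       (\<exists>\<phi>. algebra_iso N (type_algebra s) \<phi>) \<and>
       nuc_left S = range (\<lambda>a. [:a:]) \<and>
       nuc_middle S = range (\<lambda>a. [:a:]) \<and>
       (\<forall>H. algebra_iso S S H \<longrightarrow>
          H ` nuc_right S = nuc_right S \<and>
          (\<exists>u\<in>Units N. \<forall>x\<in>nuc_right S. H x = u \<otimes>\<^bsub>N\<^esub> x \<otimes>\<^bsub>N\<^esub> inv\<^bsub>N\<^esub> u))"
    using SA.petit_algebra_of_splitting[OF char \<delta> assms(2) _ dim_row_space(1,2) assms(6) simple] by blast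
  have "\<not> finite_dimensional_on (smult (petit_algebra \<iota> \<delta> f)) (carrier (petit_algebra \<iota> \<delta> f))"
    by (rule petit_algebra_infinite_dimensional[OF assms(1,3,2)]) (use f m in simp)
  then show ?thesis using \<delta> f props unfolding Let_def by blast
qed

end
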